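(* Let $\theta$ be a uniclass automorphism of a thick spherical building of type $(W,S)$, with companion automorphism $\sigma\in\mathrm{Aut}(\Pi)$. Assume that $\mathrm{disp}(\theta)$ is a bi-capped class of $\sigma$-involutions. Let $J\subseteq S$ (respectively $J'\subseteq S$) be the unique subset such that $w_J$ is the minimal length element (respectively $w_{J'}w_0$ is the maximal length element) of $\mathrm{disp}(\theta)$. Then $$\mathrm{Fix}(\theta)=(\Pi,S\setminus J,\sigma)\quad\text{and}\quad \mathrm{Opp}(\theta)=(\Pi,S\setminus J',\sigma\sigma_0).$$ In particular, $\mathrm{Opp}(\theta)=\psi(\mathrm{Fix}(\theta))$. Moreover, if $\mathrm{Fix}(\theta)$ has relative type of rank $r$ and $\mathrm{Opp}(\theta)$ has relative type of rank $r'$, then $r+r'=|S|$.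
   Context: $(W,S)$ is a finite Coxeter system with Coxeter graph $\Pi$, $w_J$ the longest element of $W_J=\langle J\rangle$, $w_0=w_S$, and $\sigma_0\in\mathrm{Aut}(\Pi)$ is $s^{\sigma_0}=w_0sw_0$. For $\sigma\in \mathrm{Aut}(\Pi)$ the $\sigma$-conjugacy class of $w$ is $\{v^{-1}wv^\sigma\mid v\in W\}$; a $\sigma$-involution is $w$ with $ww^\sigma=1$ where $\sigma^2=1$. A class of $\sigma$-involutions is bi-capped if it has a unique minimal length element (necessarily of the form $w_J$ with $w_Jsw_J=s^\sigma$ for $s\in J$) and a unique maximal length element (necessarily of the form $w_{J'}w_0$, with $w_{J'}$ the unique minimal length element of the $\sigma\sigma_0$-class $\mathbf{C}w_0$). For an automorphism $\theta$ of a building with Weyl distance $\delta$, the companion automorphism is given by $\delta(C,D)=s\iff\delta(C^\theta,D^\theta)=s^\sigma$; $\mathrm{disp}(\theta)=\{\delta(C,C^\theta)\mid C\text{ a chamber}\}$; $\theta$ is uniclass if $\mathrm{disp}(\theta)$ is contained in a single $\sigma$-conjugacy class. The fixed diagram is $\mathrm{Fix}(\theta)=(\Pi,K,\sigma)$, where $K$ is the union of all $\sigma$-orbits $O\subseteq S$ for which there is a type $O$ simplex stabilised by $\theta$. The opposition diagram is $\mathrm{Opp}(\theta)=(\Pi,K',\sigma\sigma_0)$, where $K'$ is the union of all subsets $O\subseteq S$ for which there is a type $O$ simplex mapped onto an opposite simplex by $\theta$ (simplices $\alpha,\beta$ are opposite if $\beta$ has type $w_0\tau(\alpha)w_0$,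 where $\tau(\alpha)$ is the type of $\alpha$, and there are chambers $A\supseteq\alpha$, $B\supseteq\beta$ with $\delta(A,B)=w_0$). To each bi-capped class $\mathbf{C}$ of $\sigma$-involutions with minimal length element $w_J$ one associates the diagram $(\Pi,S\setminus J,\sigma)$; $\psi$ is the map on such diagrams sending the diagram of $\mathbf{C}$ to the diagram of $\mathbf{C}w_0$. The relative type of a diagram $D=(\Pi,K,\sigma)$ is the type of a Coxeter system with generators indexed by the $\sigma$-orbits in $K$, so its rank is the number of $\sigma$-orbits in $K$. *)

theory Defs
  imports "HOL-Algebra.Multiplicative_Group" "HOL-Algebra.Bij" "HOL-Algebra.Generated_Groups"
    "HOL-Combinatorics.Orbits"
begin

section \<open>Coxeter systems\<close>

definition word_val :: "('a, 'b) monoid_scheme \<Rightarrow> 'a list \<Rightarrow> 'a" where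
  "word_val W ws = foldr (\<lambda>x y. x \<otimes>\<^bsub>W\<^esub> y) ws \<one>\<^bsub>W\<^esub>"

text \<open>Deleting one relator \<open>(s t)^m\<close>, where \<open>m\<close> is the order of \<open>s t\<close>. An infinite order is
  \<open>group.ord = 0\<close>, and then the relator is the empty word. For \<open>s = t\<close> the relator is \<open>s s\<close>.\<close>

inductive relator_step :: "('a, 'b) monoid_scheme \<Rightarrow> 'a set \<Rightarrow> 'a list \<Rightarrow> 'a list \<Rightarrow> bool"
  for W S where
  "s \<in> S \<Longrightarrow> t \<in> S \<Longrightarrow>
    relator_step W S (us @ concat (replicate (group.ord W (s \<otimes>\<^bsub>W\<^esub> t)) [s, t]) @ vs) (us @ vs)"

text \<open>The last axiom says that \<open>W\<close> has the presentation
  \<open>\<langle>S | (s t)^m(s,t) = 1\<rangle>\<close>, with \<open>m(s,t)\<close> the order of \<open>s t\<close>.\<close>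

locale coxeter_system = group W for W (structure) +
  fixes S
  assumes gens_closed: "S \<subseteq> carrier W"
    and gens_generate: "generate W S = carrier W"
    and gens_nontrivial: "s \<in> S \<Longrightarrow> s \<noteq> \<one>"
    and gens_involution: "s \<in> S \<Longrightarrow> s \<otimes> s = \<one>"
    and presentation: "us \<in> lists S \<Longrightarrow> vs \<in> lists S \<Longrightarrow> word_val W us = word_val W vs \<Longrightarrow>
      equivclp (relator_step W S) us vs"

definition cox_length :: "('a, 'b) monoid_scheme \<Rightarrow> 'a set \<Rightarrow> 'a \<Rightarrow> nat" where
  "cox_length W S w = (LEAST n. \<exists>ws \<in> lists S. length ws = n \<and> word_val W ws = w)"

text \<open>The element \<open>w\<^sub>J\<close>; for finite \<open>W\<close> the longest element of a parabolic subgroup is unique, so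
  the choice made by \<open>arg_max\<close> is irrelevant.\<close>

definition longest :: "('a, 'b) monoid_scheme \<Rightarrow> 'a set \<Rightarrow> 'a set \<Rightarrow> 'a" where
  "longest W S J = arg_max (cox_length W S) (\<lambda>w. w \<in> generate W J)"

text \<open>The Coxeter graph as its vertex set together with its set of labelled edges; the label \<open>0\<close>
  stands for \<open>\<infinity>\<close>.\<close>

type_synonym 'a coxeter_graph = "'a set \<times> ('a \<times> 'a \<times> nat) set"

definition cox_graph :: "('a, 'b) monoid_scheme \<Rightarrow> 'a set \<Rightarrow> 'a coxeter_graph" where
  "cox_graph W S = (S, {(s, t, m). s \<in> S \<and> t \<in> S \<and> s \<noteq> t \<and>
      m = group.ord W (s \<otimes>\<^bsub>W\<^esub> t) \<and> m \<noteq> 2})"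

text \<open>Graph automorphisms are extensional functions on the vertex set (as in \<open>Bij\<close>), so that equal
  automorphisms are equal as HOL functions.\<close>

definition graph_aut :: "'a coxeter_graph \<Rightarrow> ('a \<Rightarrow> 'a) set" where
  "graph_aut = (\<lambda>(V, E). {\<sigma> \<in> Bij V. \<forall>s\<in>V. \<forall>t\<in>V. \<forall>m. (s, t, m) \<in> E \<longleftrightarrow> (\<sigma> s, \<sigma> t, m) \<in> E})"

definition sigma0 :: "('a, 'b) monoid_scheme \<Rightarrow> 'a set \<Rightarrow> 'a \<Rightarrow> 'a" where
  "sigma0 W S = (\<lambda>s\<in>S. longest W S S \<otimes>\<^bsub>W\<^esub> s \<otimes>\<^bsub>W\<^esub> longest W S S)"

text \<open>The product \<open>\<sigma>\<sigma>\<^sub>0\<close> in exponential notation: first \<open>\<sigma>\<close>, then \<open>\<sigma>\<^sub>0\<close>.\<close>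

definition times_sigma0 :: "('a, 'b) monoid_scheme \<Rightarrow> 'a set \<Rightarrow> ('a \<Rightarrow> 'a) \<Rightarrow> 'a \<Rightarrow> 'a" where
  "times_sigma0 W S \<sigma> = compose S (sigma0 W S) \<sigma>"

text \<open>The automorphism \<open>w \<mapsto> w\<^sup>\<sigma>\<close> of \<open>W\<close> extending \<open>\<sigma>\<close>; see \<open>aut_ext_unique\<close> below for
  existence and uniqueness.\<close>

definition aut_ext :: "('a, 'b) monoid_scheme \<Rightarrow> 'a set \<Rightarrow> ('a \<Rightarrow> 'a) \<Rightarrow> 'a \<Rightarrow> 'a" where
  "aut_ext W S \<sigma> =
     (THE f. f \<in> hom W W \<and> f \<in> extensional (carrier W) \<and> (\<forall>s\<in>S. f s = \<sigma> s))"


section \<open>Twisted conjugacy classes and bi-capped classes\<close>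

definition twisted_class ::
  "('a, 'b) monoid_scheme \<Rightarrow> 'a set \<Rightarrow> ('a \<Rightarrow> 'a) \<Rightarrow> 'a \<Rightarrow> 'a set" where
  "twisted_class W S \<sigma> w =
     {inv\<^bsub>W\<^esub> v \<otimes>\<^bsub>W\<^esub> w \<otimes>\<^bsub>W\<^esub> aut_ext W S \<sigma> v | v. v \<in> carrier W}"

definition twisted_involution ::
  "('a, 'b) monoid_scheme \<Rightarrow> 'a set \<Rightarrow> ('a \<Rightarrow> 'a) \<Rightarrow> 'a \<Rightarrow> bool" where
  "twisted_involution W S \<sigma> w \<longleftrightarrow>
     (\<forall>s\<in>S. \<sigma> (\<sigma> s) = s) \<and> w \<in> carrier W \<and> w \<otimes>\<^bsub>W\<^esub> aut_ext W S \<sigma> w = \<one>\<^bsub>W\<^esub>"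

definition min_length_elt :: "('a, 'b) monoid_scheme \<Rightarrow> 'a set \<Rightarrow> 'a set \<Rightarrow> 'a \<Rightarrow> bool" where
  "min_length_elt W S C = is_arg_min (cox_length W S) (\<lambda>w. w \<in> C)"

definition max_length_elt :: "('a, 'b) monoid_scheme \<Rightarrow> 'a set \<Rightarrow> 'a set \<Rightarrow> 'a \<Rightarrow> bool" where
  "max_length_elt W S C = is_arg_max (cox_length W S) (\<lambda>w. w \<in> C)"

definition bi_capped :: "('a, 'b) monoid_scheme \<Rightarrow> 'a set \<Rightarrow> ('a \<Rightarrow> 'a) \<Rightarrow> 'a set \<Rightarrow> bool" where
  "bi_capped W S \<sigma> C \<longleftrightarrow> \<sigma> \<in> graph_aut (cox_graph W S) \<and>
     (\<exists>w \<in> carrier W. C = twisted_class W S \<sigma> w) \<and> (\<forall>w\<in>C. twisted_involution W S \<sigma> w) \<and>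
     (\<exists>!w. min_length_elt W S C w) \<and> (\<exists>!w. max_length_elt W S C w)"


section \<open>Diagrams\<close>

type_synonym 'a diagram = "'a coxeter_graph \<times> 'a set \<times> ('a \<Rightarrow> 'a)"

definition class_diagram ::
  "('a, 'b) monoid_scheme \<Rightarrow> 'a set \<Rightarrow> ('a \<Rightarrow> 'a) \<Rightarrow> 'a set \<Rightarrow> 'a diagram" where
  "class_diagram W S \<sigma> C =
     (cox_graph W S, S - (THE J. J \<subseteq> S \<and> min_length_elt W S C (longest W S J)), \<sigma>)"

text \<open>The map \<open>\<psi>\<close>. It is meaningful on diagrams of bi-capped classes only; such a diagram determines
  \<open>\<sigma>\<close> and the minimal length element of the class, hence the class.\<close>

definition psi :: "('a, 'b) monoid_scheme \<Rightarrow> 'a set \<Rightarrow> 'a diagram \<Rightarrow> 'a diagram" where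
  "psi W S D = (THE D'. \<exists>\<sigma> C. bi_capped W S \<sigma> C \<and> D = class_diagram W S \<sigma> C \<and>
     D' = class_diagram W S (times_sigma0 W S \<sigma>) (C #>\<^bsub>W\<^esub> longest W S S))"

definition orbits_in :: "'a set \<Rightarrow> ('a \<Rightarrow> 'a) \<Rightarrow> 'a set \<Rightarrow> 'a set set" where
  "orbits_in V \<sigma> K = {T \<in> orbit \<sigma> ` V. T \<subseteq> K}"

text \<open>The generators of a Coxeter system of the relative type are indexed by the \<open>\<sigma>\<close>-orbits in
  \<open>K\<close>, so this is the rank of the relative type.\<close>

definition relative_rank :: "'a diagram \<Rightarrow> nat" where
  "relative_rank = (\<lambda>((V, E), K, \<sigma>). card (orbits_in V \<sigma> K))"


section \<open>Buildings\<close>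

locale building = coxeter_system W S for W (structure) and S +
  fixes Ch :: "'c set" and \<delta> :: "'c \<Rightarrow> 'c \<Rightarrow> 'a"
  assumes chambers_nonempty: "Ch \<noteq> {}"
    and dist_closed: "C \<in> Ch \<Longrightarrow> D \<in> Ch \<Longrightarrow> \<delta> C D \<in> carrier W"
    and dist_one: "C \<in> Ch \<Longrightarrow> D \<in> Ch \<Longrightarrow> \<delta> C D = \<one> \<longleftrightarrow> C = D"
    and dist_step: "C \<in> Ch \<Longrightarrow> D \<in> Ch \<Longrightarrow> C' \<in> Ch \<Longrightarrow> s \<in> S \<Longrightarrow> \<delta> C' C = s \<Longrightarrow>
      \<delta> C' D = s \<otimes> \<delta> C D \<or> \<delta> C' D = \<delta> C D"
    and dist_step_up: "C \<in> Ch \<Longrightarrow> D \<in> Ch \<Longrightarrow> C' \<in> Ch \<Longrightarrow> s \<in> S \<Longrightarrow> \<delta> C' C = s \<Longrightarrow>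
      cox_length W S (s \<otimes> \<delta> C D) = cox_length W S (\<delta> C D) + 1 \<Longrightarrow> \<delta> C' D = s \<otimes> \<delta> C D"
    and dist_ex: "C \<in> Ch \<Longrightarrow> D \<in> Ch \<Longrightarrow> s \<in> S \<Longrightarrow>
      \<exists>C'\<in>Ch. \<delta> C' C = s \<and> \<delta> C' D = s \<otimes> \<delta> C D"

locale spherical_building = building +
  assumes finite_type: "finite (carrier W)"

locale thick_spherical_building = spherical_building +
  assumes thick: "C \<in> Ch \<Longrightarrow> s \<in> S \<Longrightarrow>
    \<exists>D\<in>Ch. \<exists>D'\<in>Ch. D \<noteq> D' \<and> \<delta> C D = s \<and> \<delta> C D' = s"

definition residue ::
  "('a, 'b) monoid_scheme \<Rightarrow> 'c set \<Rightarrow> ('c \<Rightarrow> 'c \<Rightarrow> 'a) \<Rightarrow> 'a set \<Rightarrow> 'c \<Rightarrow> 'c set" where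
  "residue W Ch \<delta> J C = {D \<in> Ch. \<delta> C D \<in> generate W J}"

text \<open>A simplex is identified with the set of chambers containing it: a simplex of type \<open>T\<close>
  (one vertex of each type in \<open>T\<close>) is a residue of type \<open>S - T\<close>. Thus \<open>A \<supseteq> \<alpha>\<close>, for a chamber
  \<open>A\<close> and a simplex \<open>\<alpha>\<close>, is written \<open>A \<in> \<alpha>\<close>.\<close>

definition simplices ::
  "('a, 'b) monoid_scheme \<Rightarrow> 'a set \<Rightarrow> 'c set \<Rightarrow> ('c \<Rightarrow> 'c \<Rightarrow> 'a) \<Rightarrow> 'a set \<Rightarrow> 'c set set" where
  "simplices W S Ch \<delta> T = residue W Ch \<delta> (S - T) ` Ch"

definition opposite_of_type :: "('a, 'b) monoid_scheme \<Rightarrow> 'a set \<Rightarrow> 'c set \<Rightarrow> ('c \<Rightarrow> 'c \<Rightarrow> 'a) \<Rightarrow>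
    'a set \<Rightarrow> 'c set \<Rightarrow> 'c set \<Rightarrow> bool" where
  "opposite_of_type W S Ch \<delta> T \<alpha> \<beta> \<longleftrightarrow>
     \<alpha> \<in> simplices W S Ch \<delta> T \<and> \<beta> \<in> simplices W S Ch \<delta> (sigma0 W S ` T) \<and>
     (\<exists>A\<in>\<alpha>. \<exists>B\<in>\<beta>. \<delta> A B = longest W S S)"

definition building_aut :: "('a, 'b) monoid_scheme \<Rightarrow> 'a set \<Rightarrow> 'c set \<Rightarrow> ('c \<Rightarrow> 'c \<Rightarrow> 'a) \<Rightarrow>
    ('c \<Rightarrow> 'c) \<Rightarrow> ('a \<Rightarrow> 'a) \<Rightarrow> bool" where
  "building_aut W S Ch \<delta> \<theta> \<sigma> \<longleftrightarrow>
     bij_betw \<theta> Ch Ch \<and> \<sigma> \<in> graph_aut (cox_graph W S) \<and>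
     (\<forall>C\<in>Ch. \<forall>D\<in>Ch. \<forall>s\<in>S. \<delta> C D = s \<longleftrightarrow> \<delta> (\<theta> C) (\<theta> D) = \<sigma> s)"

definition disp :: "'c set \<Rightarrow> ('c \<Rightarrow> 'c \<Rightarrow> 'a) \<Rightarrow> ('c \<Rightarrow> 'c) \<Rightarrow> 'a set" where
  "disp Ch \<delta> \<theta> = {\<delta> C (\<theta> C) | C. C \<in> Ch}"

definition uniclass :: "('a, 'b) monoid_scheme \<Rightarrow> 'a set \<Rightarrow> 'c set \<Rightarrow> ('c \<Rightarrow> 'c \<Rightarrow> 'a) \<Rightarrow>
    ('c \<Rightarrow> 'c) \<Rightarrow> ('a \<Rightarrow> 'a) \<Rightarrow> bool" where
  "uniclass W S Ch \<delta> \<theta> \<sigma> \<longleftrightarrow> (\<exists>w\<in>carrier W. disp Ch \<delta> \<theta> \<subseteq> twisted_class W S \<sigma> w)"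

definition fix_diagram :: "('a, 'b) monoid_scheme \<Rightarrow> 'a set \<Rightarrow> 'c set \<Rightarrow> ('c \<Rightarrow> 'c \<Rightarrow> 'a) \<Rightarrow>
    ('c \<Rightarrow> 'c) \<Rightarrow> ('a \<Rightarrow> 'a) \<Rightarrow> 'a diagram" where
  "fix_diagram W S Ch \<delta> \<theta> \<sigma> =
     (cox_graph W S,
      \<Union>{T \<in> orbit \<sigma> ` S. \<exists>\<alpha> \<in> simplices W S Ch \<delta> T. \<theta> ` \<alpha> = \<alpha>},
      \<sigma>)"

definition opp_diagram :: "('a, 'b) monoid_scheme \<Rightarrow> 'a set \<Rightarrow> 'c set \<Rightarrow> ('c \<Rightarrow> 'c \<Rightarrow> 'a) \<Rightarrow>
    ('c \<Rightarrow> 'c) \<Rightarrow> ('a \<Rightarrow> 'a) \<Rightarrow> 'a diagram" where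
  "opp_diagram W S Ch \<delta> \<theta> \<sigma> =
     (cox_graph W S,
      \<Union>{T. T \<subseteq> S \<and> (\<exists>\<alpha>. opposite_of_type W S Ch \<delta> T \<alpha> (\<theta> ` \<alpha>))},
      times_sigma0 W S \<sigma>)"


section \<open>Extending graph automorphisms to the group\<close>

context coxeter_system
begin

lemma word_val_closed: "ws \<in> lists S \<Longrightarrow> word_val W ws \<in> carrier W"
  using gens_closed by (induction ws) (auto simp: word_val_def)

lemma word_val_append:
  "us \<in> lists S \<Longrightarrow> vs \<in> lists S \<Longrightarrow> word_val W (us @ vs) = word_val W us \<otimes> word_val W vs"
proof (induction us)
  case Nil
  then show ?case using word_val_closed[of vs] by (simp add: word_val_def)
next
  case (Cons a us)
  then have "a \<in> carrier W" "word_val W us \<in> carrier W" "word_val W vs \<in> carrier W"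
    using gens_closed word_val_closed by auto
  with Cons show ?case by (simp add: word_val_def m_assoc)
qed

lemma word_val_relator:
  assumes "s \<in> S" "t \<in> S"
  shows "word_val W (concat (replicate n [s, t])) = (s \<otimes> t) [^] n"
proof (induction n)
  case 0 then show ?case by (simp add: word_val_def)
next
  case (Suc n)
  have st: "s \<in> carrier W" "t \<in> carrier W" using assms gens_closed by auto
  have "word_val W (concat (replicate (Suc n) [s, t])) = s \<otimes> (t \<otimes> (s \<otimes> t) [^] n)"
    using Suc by (simp add: word_val_def)
  also have "\<dots> = (s \<otimes> t) [^] Suc n"
    using st by (metis m_assoc m_closed nat_pow_Suc2 nat_pow_closed)
  finally show ?case .
qed

lemma ex_word:
  assumes "w \<in> carrier W" shows "\<exists>ws\<in>lists S. word_val W ws = w"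
proof -
  from assms have "w \<in> generate W S" by (simp add: gens_generate)
  then show ?thesis
  proof (induction rule: generate.induct)
    case one show ?case by (intro bexI[of _ "[]"]) (auto simp: word_val_def)
  next
    case (incl h) then show ?case using gens_closed
      by (intro bexI[of _ "[h]"]) (auto simp: word_val_def)
  next
    case (inv h)
    then have "inv h = h" using gens_closed gens_involution by (metis inv_equality subsetD)
    then show ?case using gens_closed inv
      by (intro bexI[of _ "[h]"]) (auto simp: word_val_def)
  next
    case (eng h1 h2)
    then obtain u v where "u \<in> lists S" "v \<in> lists S" "word_val W u = h1" "word_val W v = h2"
      by blast
    then show ?case by (intro bexI[of _ "u @ v"]) (auto simp: word_val_append)
  qed
qed

lemma graph_aut_ord:
  assumes \<sigma>: "\<sigma> \<in> graph_aut (cox_graph W S)" and st: "s \<in> S" "t \<in> S"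
  shows "\<sigma> s \<in> S" "ord (\<sigma> s \<otimes> \<sigma> t) = ord (s \<otimes> t)"
proof -
  have bij: "bij_betw \<sigma> S S" using \<sigma> by (auto simp: graph_aut_def cox_graph_def Bij_def)
  then have im: "\<sigma> x \<in> S" if "x \<in> S" for x using that by (auto simp: bij_betw_def)
  then show "\<sigma> s \<in> S" using st by simp
  show "ord (\<sigma> s \<otimes> \<sigma> t) = ord (s \<otimes> t)"
  proof (cases "s = t")
    case True then show ?thesis using im st gens_involution by simp
  next
    case False
    then have ne: "\<sigma> s \<noteq> \<sigma> t" using bij st by (auto simp: bij_betw_def inj_on_def)
    have "\<forall>m. (s \<noteq> t \<and> m = ord (s \<otimes> t) \<and> m \<noteq> 2) \<longleftrightarrow> (\<sigma> s \<noteq> \<sigma> t \<and> m = ord (\<sigma> s \<otimes> \<sigma> t) \<and> m \<noteq> 2)"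
      using \<sigma> st im unfolding graph_aut_def cox_graph_def by simp
    then have "\<forall>m. (m = ord (s \<otimes> t) \<and> m \<noteq> 2) \<longleftrightarrow> (m = ord (\<sigma> s \<otimes> \<sigma> t) \<and> m \<noteq> 2)"
      using False ne by simp
    then show ?thesis by metis
  qed
qed

lemma aut_ext_unique:
  assumes \<sigma>: "\<sigma> \<in> graph_aut (cox_graph W S)"
  shows "\<exists>!f. f \<in> hom W W \<and> f \<in> extensional (carrier W) \<and> (\<forall>s\<in>S. f s = \<sigma> s)"
proof -
  note im = graph_aut_ord(1)[OF \<sigma>]
  have maps: "map \<sigma> ws \<in> lists S" if "ws \<in> lists S" for ws
    using that im by (induction ws) auto
  have relstep: "us \<in> lists S \<longleftrightarrow> vs \<in> lists S"
    "us \<in> lists S \<Longrightarrow> word_val W (map \<sigma> us) = word_val W (map \<sigma> vs)"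
    if "relator_step W S us vs" for us vs
  proof -
    from that obtain s t us' vs' where st: "s \<in> S" "t \<in> S"
      and us: "us = us' @ concat (replicate (ord (s \<otimes> t)) [s, t]) @ vs'" and vs: "vs = us' @ vs'"
      by cases
    have rel: "concat (replicate n [x, y]) \<in> lists S" if "x \<in> S" "y \<in> S" for n x y
      using that by (induction n) auto
    show "us \<in> lists S \<longleftrightarrow> vs \<in> lists S" using rel[OF st] by (auto simp: us vs)
    assume "us \<in> lists S"
    then have l: "us' \<in> lists S" "vs' \<in> lists S" by (auto simp: us)
    have m: "map \<sigma> (concat (replicate n [s, t])) = concat (replicate n [\<sigma> s, \<sigma> t])" for n
      by (induction n) auto
    have c: "\<sigma> s \<otimes> \<sigma> t \<in> carrier W" using im st gens_closed by (meson m_closed subsetD)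
    have "word_val W (map \<sigma> (concat (replicate (ord (s \<otimes> t)) [s, t]))) = \<one>"
      using graph_aut_ord[OF \<sigma> st] im st c
      by (metis m word_val_relator pow_ord_eq_1)
    then show "word_val W (map \<sigma> us) = word_val W (map \<sigma> vs)"
      using maps[OF l(1)] maps[OF l(2)] maps[OF rel[OF st]] word_val_closed
      by (simp add: us vs word_val_append del: map_concat)
  qed
  have wd: "word_val W (map \<sigma> us) = word_val W (map \<sigma> vs)"
    if "us \<in> lists S" "vs \<in> lists S" "word_val W us = word_val W vs" for us vs
  proof -
    have "(symclp (relator_step W S))\<^sup>*\<^sup>* us vs"
      using presentation[OF that] by (simp add: equivclp_def)
    then have "vs \<in> lists S \<and> word_val W (map \<sigma> us) = word_val W (map \<sigma> vs)"
    proof (induction rule: rtranclp_induct)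
      case base then show ?case using that by simp
    next
      case (step y z)
      then have "relator_step W S y z \<or> relator_step W S z y" by (simp add: symclp_def)
      then show ?case using step.IH relstep by metis
    qed
    then show ?thesis by simp
  qed
  define f where "f = (\<lambda>w\<in>carrier W. word_val W (map \<sigma> (SOME ws. ws \<in> lists S \<and> word_val W ws = w)))"
  have f: "f (word_val W ws) = word_val W (map \<sigma> ws)" if "ws \<in> lists S" for ws
  proof -
    let ?P = "\<lambda>u. u \<in> lists S \<and> word_val W u = word_val W ws"
    have P: "?P (SOME u. ?P u)" using that by (intro someI[of ?P ws]) simp
    have "f (word_val W ws) = word_val W (map \<sigma> (SOME u. ?P u))"
      using word_val_closed[OF that] by (simp add: f_def)
    also have "\<dots> = word_val W (map \<sigma> ws)"
      using P by (intro wd that) blast+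
    finally show ?thesis .
  qed
  have fhom: "f \<in> hom W W"
  proof (rule homI)
    fix x assume "x \<in> carrier W"
    then show "f x \<in> carrier W" using ex_word f maps word_val_closed by metis
  next
    fix x y assume "x \<in> carrier W" "y \<in> carrier W"
    then obtain u v where uv: "u \<in> lists S" "v \<in> lists S" "word_val W u = x" "word_val W v = y"
      using ex_word by metis
    then show "f (x \<otimes> y) = f x \<otimes> f y"
      using f[of "u @ v"] f[of u] f[of v] maps by (simp add: word_val_append)
  qed
  have fgen: "f s = \<sigma> s" if "s \<in> S" for s
    using f[of "[s]"] that im[OF that that] subsetD[OF gens_closed] by (simp add: word_val_def)
  have uniq: "g = f" if g: "g \<in> hom W W" "g \<in> extensional (carrier W)" "\<forall>s\<in>S. g s = \<sigma> s" for g
  proof (rule extensionalityI[OF g(2)])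
    show "f \<in> extensional (carrier W)" by (simp add: f_def)
    fix w assume "w \<in> carrier W"
    then obtain ws where ws: "ws \<in> lists S" "word_val W ws = w" using ex_word by blast
    have one: "g \<one> = \<one>" using g(1) hom_one is_group by blast
    from ws(1) have "g (word_val W ws) = word_val W (map \<sigma> ws)"
    proof (induction ws)
      case Nil then show ?case using one by (simp add: word_val_def)
    next
      case (Cons a ws)
      then have "a \<in> carrier W" "word_val W ws \<in> carrier W"
        using gens_closed word_val_closed by auto
      then have "g (a \<otimes> word_val W ws) = g a \<otimes> g (word_val W ws)" using g(1) hom_mult by metis
      with Cons g(3) show ?case by (simp add: word_val_def)
    qed
    then show "g w = f w" using f[OF ws(1)] by (simp only: ws(2))
  qed
  have fext: "f \<in> extensional (carrier W)" by (simp add: f_def)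
  show ?thesis
  proof (rule ex1I[of _ f])
    show "f \<in> hom W W \<and> f \<in> extensional (carrier W) \<and> (\<forall>s\<in>S. f s = \<sigma> s)"
      using fhom fext fgen by blast
    fix g assume "g \<in> hom W W \<and> g \<in> extensional (carrier W) \<and> (\<forall>s\<in>S. g s = \<sigma> s)"
    then show "g = f" by (elim conjE) (rule uniq)
  qed
qed

end

end

theory Submission
  imports Defs Complex_Main
begin

text \<open>A twisted involution \<open>w\<close> that cannot be shortened by a \<open>\<sigma>\<close>-conjugation with a generator equals
  \<open>w\<^sub>I\<close> for its set \<open>I\<close> of left descents, and all elements of this form in one class have the same
  length. Shortening therefore leads from any element of a bi-capped class inside a \<open>\<sigma>\<close>-stable
  parabolic subgroup to \<open>w\<^sub>J\<close> without leaving that subgroup. A type \<open>T\<close> simplex is stabilised iff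
  some displacement lies in \<open>W\<^bsub>S - T\<^esub>\<close> (for \<open>T\<close> stable under \<open>\<sigma>\<close>), and one is mapped to an opposite simplex
  iff \<open>T\<close> is stable under \<open>\<sigma>\<sigma>\<^sub>0\<close> and some displacement lies in \<open>W\<^bsub>S - T\<^esub>w\<^sub>0\<close>; this gives both diagrams, the
  second one by passing to the class \<open>\<^bold>Cw\<^sub>0\<close>.

  For the ranks, let \<open>W\<close> and \<open>\<sigma>\<close> act in the geometric representation. There \<open>w\<^sub>J\<sigma>\<close> is \<open>-1\<close> on the simple
  roots in \<open>J\<close> and permutes the others modulo these, and \<open>w\<^sub>0\<sigma>\<^sub>0 = -1\<close>. Hence the traces of \<open>w\<^sub>J\<sigma>\<close> and
  \<open>w\<^bsub>J'\<^esub>\<sigma>\<sigma>\<^sub>0\<close> are opposite, and they count fixed generators, which determines the numbers of orbits.\<close>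

text \<open>Behind the rank formula stands a count of eigenvalues. The operator w_J \<sigma> is an
  involution, equal to -1 on the span of J and permuting the basis of the quotient, so its
  1-eigenspace has one dimension for each \<sigma>-orbit in S - J. The factor w_0 \<sigma>_0 = -1
  exchanges the eigenvalues 1 and -1, which makes r and r' complementary dimensions in a space of
  dimension |S|; traces express this comparison. The delicate point is a sign: that w_J \<sigma>
  multiplies each simple root of J by 1 or -1 is formal, but excluding 1 requires that w maps the
  simple root of s to a nonnegative combination whenever w s is longer than w. This is derived from
  rank two, by angles.

  Two definitions shape the rest. The group is given by a presentation, so parity of length, the
  exchange condition and the representation are all obtained from functions of words that do not
  change when a relator is inserted. An automorphism of a building is only assumed to respect
  distances that are generators, so residues are rewritten as sets of chambers joined by galleries
  before images are taken.\<close>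

context coxeter_system
begin

section \<open>Invariants of words and the length function\<close>

abbreviation len :: "'a \<Rightarrow> nat" where "len w \<equiv> cox_length W S w"

lemma gen_closed [simp, intro]: "s \<in> S \<Longrightarrow> s \<in> carrier W"
  using gens_closed by blast

lemma inv_gen [simp]: "s \<in> S \<Longrightarrow> inv s = s"
  by (meson gen_closed gens_involution inv_equality)

lemma gen_cancel [simp]: "s \<in> S \<Longrightarrow> w \<in> carrier W \<Longrightarrow> s \<otimes> (s \<otimes> w) = w"
  by (metis gen_closed gens_involution l_one m_assoc)

lemma word_val_Nil [simp]: "word_val W [] = \<one>"
  by (simp add: word_val_def)

lemma word_val_Cons [simp]: "word_val W (s # ws) = s \<otimes> word_val W ws"
  by (simp add: word_val_def)

text \<open>Words of equal value are linked by a chain of insertions and deletions of relators, so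
  it suffices to test one relator in an arbitrary context. Length parity, counts of reflections and
  the geometric representation all descend from words to group elements in this way.\<close>

lemma word_invariant:
  assumes words: "us \<in> lists S" "vs \<in> lists S" "word_val W us = word_val W vs"
    and relator: "\<And>xs ys s t. xs \<in> lists S \<Longrightarrow> ys \<in> lists S \<Longrightarrow> s \<in> S \<Longrightarrow> t \<in> S \<Longrightarrow>
      f (xs @ concat (replicate (ord (s \<otimes> t)) [s, t]) @ ys) = f (xs @ ys)"
  shows "f us = f vs"
proof -
  have rel: "concat (replicate n [s, t]) \<in> lists S" if "s \<in> S" "t \<in> S" for n s t
    using that by (induction n) auto
  have relstep: "(x \<in> lists S \<longleftrightarrow> y \<in> lists S) \<and> (x \<in> lists S \<longrightarrow> f x = f y)"
    if "relator_step W S x y" for x y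
    using that
  proof cases
    case (1 s t xs ys)
    then show ?thesis using relator[of xs ys s t] rel[of s t "ord (s \<otimes> t)"] by auto
  qed
  have "(symclp (relator_step W S))\<^sup>*\<^sup>* us vs"
    using presentation[OF words] by (simp add: equivclp_def)
  then have "vs \<in> lists S \<and> f us = f vs"
  proof (induction rule: rtranclp_induct)
    case base then show ?case using words by simp
  next
    case (step y z)
    then have "relator_step W S y z \<or> relator_step W S z y" by (simp add: symclp_def)
    then show ?case using step.IH relstep by metis
  qed
  then show ?thesis by simp
qed

text \<open>Every relator has even length. This parity later excludes
  \<open>len (s \<otimes> w) = len w\<close>.\<close>

lemma even_length_word_val:
  assumes "us \<in> lists S" "vs \<in> lists S" "word_val W us = word_val W vs"
  shows "even (length us) = even (length vs)"
proof (rule word_invariant[OF assms, of "\<lambda>us. even (length us)"])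
  fix xs ys :: "'a list" and s t :: 'a
  have "even (length (concat (replicate n [s, t])))" for n by (induction n) auto
  then show "even (length (xs @ concat (replicate (ord (s \<otimes> t)) [s, t]) @ ys)) = even (length (xs @ ys))"
    by simp
qed

lemma reduced_word:
  assumes "w \<in> carrier W"
  obtains ws where "ws \<in> lists S" "word_val W ws = w" "length ws = len w"
proof -
  have "\<exists>n. \<exists>ws\<in>lists S. length ws = n \<and> word_val W ws = w" using ex_word[OF assms] by blast
  from LeastI_ex[OF this] show thesis using that unfolding cox_length_def by blast
qed

lemma len_word_val_le: "ws \<in> lists S \<Longrightarrow> len (word_val W ws) \<le> length ws"
  unfolding cox_length_def by (rule Least_le) blast

lemma len_mult_le:
  assumes "u \<in> carrier W" "v \<in> carrier W" shows "len (u \<otimes> v) \<le> len u + len v"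
proof -
  obtain us vs where "us \<in> lists S" "word_val W us = u" "length us = len u"
    "vs \<in> lists S" "word_val W vs = v" "length vs = len v"
    using assms reduced_word by metis
  then show ?thesis using len_word_val_le[of "us @ vs"] by (simp add: word_val_append)
qed

lemma even_len_mult:
  assumes "u \<in> carrier W" "v \<in> carrier W"
  shows "even (len (u \<otimes> v)) = even (len u + len v)"
proof -
  obtain us vs ws where ws: "us \<in> lists S" "word_val W us = u" "length us = len u"
    "vs \<in> lists S" "word_val W vs = v" "length vs = len v"
    "ws \<in> lists S" "word_val W ws = u \<otimes> v" "length ws = len (u \<otimes> v)"
    using assms reduced_word m_closed by metis
  then show ?thesis using even_length_word_val[of "us @ vs" ws] by (simp add: word_val_append)
qed

lemma word_val_rev: "ws \<in> lists S \<Longrightarrow> word_val W (rev ws) = inv (word_val W ws)"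
proof (induction ws)
  case (Cons a ws)
  then have "rev ws \<in> lists S" "[a] \<in> lists S" "a \<in> S" by auto
  with Cons show ?case using word_val_closed[of ws]
    by (simp add: word_val_append inv_mult_group del: lists.intros)
qed simp

lemma len_inv [simp]: "w \<in> carrier W \<Longrightarrow> len (inv w) = len w"
proof -
  have "len (inv w) \<le> len w" if "w \<in> carrier W" for w
    using reduced_word[OF that] word_val_rev len_word_val_le
    by (metis in_lists_conv_set length_rev set_rev)
  moreover assume "w \<in> carrier W"
  ultimately show ?thesis by (metis inv_closed inv_inv le_antisym)
qed

lemma len_one [simp]: "len \<one> = 0"
  using len_word_val_le[of "[]"] by simp

lemma len_eq_0: "w \<in> carrier W \<Longrightarrow> len w = 0 \<longleftrightarrow> w = \<one>"
  by (metis len_one length_0_conv reduced_word word_val_Nil)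

lemma len_gen [simp]: "s \<in> S \<Longrightarrow> len s = 1"
  using len_word_val_le[of "[s]"] len_eq_0[of s] gens_nontrivial[of s] by fastforce

lemma len_eq_1: "w \<in> carrier W \<Longrightarrow> len w = 1 \<longleftrightarrow> w \<in> S"
proof
  assume "w \<in> carrier W" "len w = 1"
  then obtain ws where "ws \<in> lists S" "word_val W ws = w" "length ws = 1" by (metis reduced_word)
  then show "w \<in> S" by (auto simp: length_Suc_conv)
qed simp

lemma len_gen_mult:
  assumes "s \<in> S" "w \<in> carrier W"
  shows "len (s \<otimes> w) = Suc (len w) \<or> Suc (len (s \<otimes> w)) = len w"
proof -
  have "len (s \<otimes> w) \<le> 1 + len w" "len w \<le> 1 + len (s \<otimes> w)"
    using len_mult_le[of s w] len_mult_le[of s "s \<otimes> w"] assms by auto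
  moreover have "even (len (s \<otimes> w)) = odd (len w)" using even_len_mult[of s w] assms by simp
  ultimately show ?thesis by presburger
qed

lemma len_inv_mult_gen:
  assumes "s \<in> S" "w \<in> carrier W" shows "len (s \<otimes> inv w) = len (w \<otimes> s)"
proof -
  have "inv (w \<otimes> s) = s \<otimes> inv w" using assms by (simp add: inv_mult_group)
  then show ?thesis using len_inv[of "w \<otimes> s"] assms by simp
qed

lemma len_mult_gen:
  assumes "s \<in> S" "w \<in> carrier W"
  shows "len (w \<otimes> s) = Suc (len w) \<or> Suc (len (w \<otimes> s)) = len w"
  using len_gen_mult[of s "inv w"] len_inv_mult_gen[OF assms] assms by simp

section \<open>The exchange condition\<close>

text \<open>The entry for position \<open>i\<close> of a word \<open>s1 ... sn\<close> is the
  conjugate of \<open>si\<close> by \<open>s1 ... s(i-1)\<close>; left multiplication by it deletes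
  the letter \<open>si\<close> from the word.\<close>

primrec reflections :: "'a list \<Rightarrow> 'a list" where
  "reflections [] = []"
| "reflections (s # ws) = s # map (\<lambda>t. s \<otimes> t \<otimes> s) (reflections ws)"

lemma reflections_closed: "ws \<in> lists S \<Longrightarrow> set (reflections ws) \<subseteq> carrier W"
  by (induction ws) auto

lemma reflections_append:
  assumes "us \<in> lists S" "vs \<in> lists S"
  shows "reflections (us @ vs) = reflections us @
    map (\<lambda>t. word_val W us \<otimes> t \<otimes> inv (word_val W us)) (reflections vs)"
  using assms(1)
proof (induction us)
  case Nil
  show ?case using reflections_closed[OF assms(2)] by (auto intro!: map_idI[symmetric])
next
  case (Cons a us)
  then show ?case using word_val_closed[of us] reflections_closed[OF assms(2)]
    by (auto simp: inv_mult_group m_assoc)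
qed

text \<open>The entry at position \<open>i\<close> is the alternating word of length
  \<open>2 * i + 1\<close> that begins with \<open>s\<close>.\<close>

lemma reflections_alternating:
  assumes "s \<in> S" "t \<in> S"
  shows "reflections (concat (replicate n [s, t])) = map (\<lambda>i. (s \<otimes> t) [^] i \<otimes> s) [0..<2 * n]"
proof (induction n)
  case (Suc n)
  have "[0..<2 * Suc n] = 0 # Suc 0 # map (\<lambda>i. Suc (Suc i)) [0..<2 * n]"
    by (simp add: upt_conv_Cons map_Suc_upt flip: map_map[unfolded comp_def])
  moreover have "s \<otimes> (t \<otimes> ((s \<otimes> t) [^] i \<otimes> s) \<otimes> t) \<otimes> s = (s \<otimes> t) [^] Suc (Suc i) \<otimes> s" for i
  proof -
    have "(s \<otimes> t) [^] Suc (Suc i) \<otimes> s = ((s \<otimes> t) \<otimes> (s \<otimes> t) [^] i \<otimes> (s \<otimes> t)) \<otimes> s"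
      using assms by (metis gen_closed m_closed nat_pow_Suc nat_pow_Suc2)
    then show ?thesis using assms by (simp add: m_assoc)
  qed
  ultimately show ?case using Suc assms by (simp add: m_assoc)
qed simp

text \<open>A relator \<open>(p q)^m\<close> lists each \<open>(p q)^i p\<close> with
  \<open>i < m\<close> twice, and having value 1 it does not disturb the reflections of the letters
  after it. Inserting it changes every count by an even number.\<close>

lemma even_count_reflections:
  assumes words: "us \<in> lists S" "vs \<in> lists S" "word_val W us = word_val W vs"
    and t: "t \<in> carrier W"
  shows "even (count_list (reflections us) t) = even (count_list (reflections vs) t)"
proof (rule word_invariant[OF words, of "\<lambda>us. even (count_list (reflections us) t)"])
  fix xs ys p q
  assume xs: "xs \<in> lists S" and ys: "ys \<in> lists S" and p: "p \<in> S" and q: "q \<in> S"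
  let ?m = "ord (p \<otimes> q)"
  let ?r = "concat (replicate ?m [p, q])"
  have r: "concat (replicate n [p, q]) \<in> lists S" for n using p q by (induction n) auto
  have val: "word_val W ?r = \<one>"
    using p q by (simp add: word_val_relator)
  have per: "(p \<otimes> q) [^] (i + ?m) = (p \<otimes> q) [^] i" for i
    using p q by (simp flip: nat_pow_mult)
  have "[0..<2 * ?m] = [0..<?m] @ map (\<lambda>i. i + ?m) [0..<?m]"
    using upt_add_eq_append[of 0 ?m ?m] by (simp add: map_add_upt mult_2)
  then have "reflections ?r = map (\<lambda>i. (p \<otimes> q) [^] i \<otimes> p) [0..<?m] @ map (\<lambda>i. (p \<otimes> q) [^] i \<otimes> p) [0..<?m]"
    unfolding reflections_alternating[OF p q] by (simp add: per)
  then have "even (count_list (map f (reflections ?r)) t)" for f by simp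
  then have *: "even (count_list (map f (reflections ?r) @ zs) t) = even (count_list zs t)" for f zs by simp
  have "map (\<lambda>t. \<one> \<otimes> t \<otimes> inv \<one>) (reflections ys) = reflections ys"
    using reflections_closed[OF ys] by (intro map_idI) auto
  then have "reflections (?r @ ys) = reflections ?r @ reflections ys"
    using reflections_append[OF r ys] val by simp
  then show "even (count_list (reflections (xs @ ?r @ ys)) t) = even (count_list (reflections (xs @ ys)) t)"
    using reflections_append[OF xs, of "?r @ ys"] reflections_append[OF xs ys] r[of ?m] ys *
    by (simp del: map_map)
qed

text \<open>If \<open>t\<close> comes from the letter \<open>x\<close>, it is the conjugate of
  \<open>x\<close> by the value of \<open>us\<close>, and the two copies of \<open>x\<close> cancel
  in the product.\<close>

lemma reflection_delete:
  assumes "ws \<in> lists S" "t \<in> set (reflections ws)"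
  shows "\<exists>us x vs. ws = us @ x # vs \<and> t \<otimes> word_val W ws = word_val W (us @ vs)"
  using assms
proof (induction ws arbitrary: t)
  case (Cons a ws)
  then have a: "a \<in> S" and ws: "ws \<in> lists S" by auto
  from Cons.prems consider "t = a" | t' where "t' \<in> set (reflections ws)" "t = a \<otimes> t' \<otimes> a" by auto
  then show ?case
  proof cases
    case 1
    then show ?thesis using a word_val_closed[OF ws] by (intro exI[of _ "[]"]) auto
  next
    case 2
    with Cons.IH ws obtain us x vs where *: "ws = us @ x # vs" "t' \<otimes> word_val W ws = word_val W (us @ vs)"
      by blast
    have "t \<otimes> word_val W (a # ws) = a \<otimes> (t' \<otimes> word_val W ws)"
      using 2 a word_val_closed[OF ws] reflections_closed[OF ws] by (auto simp: m_assoc)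
    with * show ?thesis by (intro exI[of _ "a # us"]) auto
  qed
qed simp

text \<open>Prefix \<open>s\<close> to a reduced word of \<open>s w\<close>, where \<open>w\<close>
  is the value of \<open>ws\<close>. The new word again has value \<open>w\<close>, and its
  reflections contain \<open>s\<close> exactly once, at the head. By parity \<open>s\<close> occurs
  among the reflections of \<open>ws\<close> as well, which names the letter to delete.\<close>

lemma exchange_word:
  assumes ws: "ws \<in> lists S" and s: "s \<in> S" and less: "len (s \<otimes> word_val W ws) < len (word_val W ws)"
  shows "\<exists>us x vs. ws = us @ x # vs \<and> s \<otimes> word_val W ws = word_val W (us @ vs)"
proof -
  let ?w = "word_val W ws"
  have w: "?w \<in> carrier W" using word_val_closed ws by blast
  obtain vs where vs: "vs \<in> lists S" "word_val W vs = s \<otimes> ?w" "length vs = len (s \<otimes> ?w)"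
    using reduced_word[of "s \<otimes> ?w"] s w by auto
  \<comment> \<open>A second occurrence would put \<open>s\<close> itself among the reflections of
    \<open>vs\<close>, and deleting the corresponding letter would make \<open>?w\<close> shorter
    than \<open>s \<otimes> ?w\<close>.\<close>
  have "s \<notin> set (map (\<lambda>t. s \<otimes> t \<otimes> s) (reflections vs))"
  proof
    assume "s \<in> set (map (\<lambda>t. s \<otimes> t \<otimes> s) (reflections vs))"
    then obtain t where t: "t \<in> set (reflections vs)" "s = s \<otimes> t \<otimes> s" by auto
    have tc: "t \<in> carrier W" using t vs reflections_closed by blast
    have "t = s \<otimes> (s \<otimes> t \<otimes> s) \<otimes> s" using tc s by (simp add: m_assoc gens_involution)
    then have "t = s" using t(2) s by (simp add: gens_involution)
    then obtain us x vs' where d: "vs = us @ x # vs'" "s \<otimes> word_val W vs = word_val W (us @ vs')"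
      using reflection_delete[OF vs(1) t(1)] by blast
    then have "?w = word_val W (us @ vs')" using vs s w by simp
    then have "len ?w \<le> length (us @ vs')"
      using d(1) vs(1) by (simp only:) (intro len_word_val_le, auto)
    then show False using d vs less by simp
  qed
  then have "count_list (reflections (s # vs)) s = 1" by (simp add: count_list_0_iff)
  moreover have "word_val W (s # vs) = ?w" using vs s w by simp
  ultimately have "odd (count_list (reflections ws) s)"
    using even_count_reflections[of "s # vs" ws s] vs s ws by simp
  then have "s \<in> set (reflections ws)" by (metis count_list_0_iff even_zero)
  then show ?thesis using reflection_delete[OF ws] by blast
qed

text \<open>The deleted letter lies either in a reduced word of \<open>a\<close>, which
  \<open>s\<close> then shortens, or in one of \<open>b\<close>, which leaves the shorter
  \<open>b'\<close>.\<close>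

lemma exchange:
  assumes "a \<in> carrier W" "b \<in> carrier W" "s \<in> S" "len (s \<otimes> (a \<otimes> b)) < len (a \<otimes> b)"
  shows "len (s \<otimes> a) < len a \<or> (\<exists>b'\<in>carrier W. len b' < len b \<and> s \<otimes> (a \<otimes> b) = a \<otimes> b')"
proof -
  obtain as bs where as: "as \<in> lists S" "word_val W as = a" "length as = len a"
    and bs: "bs \<in> lists S" "word_val W bs = b" "length bs = len b"
    using assms reduced_word by metis
  have "word_val W (as @ bs) = a \<otimes> b" using as bs by (simp add: word_val_append)
  then obtain us x vs where d: "as @ bs = us @ x # vs" "s \<otimes> (a \<otimes> b) = word_val W (us @ vs)"
    using exchange_word[of "as @ bs" s] as bs assms by auto
  from d(1) consider zs where "as = us @ x # zs" "vs = zs @ bs" | zs where "us = as @ zs" "bs = zs @ x # vs"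
    by (auto simp: append_eq_append_conv2 append_eq_Cons_conv Cons_eq_append_conv)
  then show ?thesis
  proof cases
    case 1
    have l: "us @ zs \<in> lists S" using 1 as by auto
    have "(s \<otimes> a) \<otimes> b = word_val W (us @ zs) \<otimes> b"
      using d(2) 1 l bs assms word_val_append[OF l bs(1)] by (simp add: m_assoc)
    then have "s \<otimes> a = word_val W (us @ zs)" using assms word_val_closed[OF l] by simp
    then have "len (s \<otimes> a) \<le> length (us @ zs)" using len_word_val_le[OF l] by simp
    then show ?thesis using 1 as by simp
  next
    case 2
    have l: "zs @ vs \<in> lists S" using 2 bs by auto
    have "s \<otimes> (a \<otimes> b) = a \<otimes> word_val W (zs @ vs)"
      using d(2) 2 as word_val_append[OF as(1) l] by simp
    moreover have "len (word_val W (zs @ vs)) < len b" using len_word_val_le[OF l] 2 bs by simp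
    ultimately show ?thesis using word_val_closed[OF l] by blast
  qed
qed

text \<open>Exchange is applied to \<open>inv w = (inv w \<otimes> s) \<otimes> s\<close>, which
  \<open>t\<close> shortens from the left. If \<open>t\<close> does not shorten the first factor,
  the letter deleted can only be the final \<open>s\<close>.\<close>

lemma two_sided_descent:
  assumes w: "w \<in> carrier W" and st: "s \<in> S" "t \<in> S"
    and less: "len (s \<otimes> w) < len w" "len (w \<otimes> t) < len w"
  shows "s \<otimes> w = w \<otimes> t \<or> len (s \<otimes> w \<otimes> t) < len (s \<otimes> w)"
proof (rule disjCI)
  assume not_less: "\<not> len (s \<otimes> w \<otimes> t) < len (s \<otimes> w)"
  have "inv (s \<otimes> w) = inv w \<otimes> s" using w st by (simp add: inv_mult_group)
  then have ge: "\<not> len (t \<otimes> (inv w \<otimes> s)) < len (inv w \<otimes> s)"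
    using not_less len_inv_mult_gen[of t "s \<otimes> w"] len_inv[of "s \<otimes> w"] w st by simp
  have "inv w = (inv w \<otimes> s) \<otimes> s" using w st by (simp add: m_assoc gens_involution)
  moreover have "len (t \<otimes> inv w) < len (inv w)"
    using less len_inv_mult_gen[of t w] w st by simp
  ultimately obtain b where b: "b \<in> carrier W" "len b < 1" "t \<otimes> inv w = (inv w \<otimes> s) \<otimes> b"
    using exchange[of "inv w \<otimes> s" s t] ge w st by auto
  then have "b = \<one>" using len_eq_0 by auto
  then have "t \<otimes> inv w = inv w \<otimes> s" using b w st by simp
  then have "inv (t \<otimes> inv w) = inv (inv w \<otimes> s)" by simp
  then show "s \<otimes> w = w \<otimes> t" using w st by (simp add: inv_mult_group)
qed

section \<open>Parabolic subgroups\<close>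

lemma inv_cancel [simp]:
  assumes "x \<in> carrier W" "y \<in> carrier W"
  shows "inv x \<otimes> (x \<otimes> y) = y" "x \<otimes> (inv x \<otimes> y) = y"
  using assms by (simp_all flip: m_assoc)

lemma parabolic_closed: "J \<subseteq> S \<Longrightarrow> w \<in> generate W J \<Longrightarrow> w \<in> carrier W"
  using generate_incl[of J] gens_closed by blast

lemma parabolic_inv: "J \<subseteq> S \<Longrightarrow> w \<in> generate W J \<Longrightarrow> inv w \<in> generate W J"
  using generate_m_inv_closed[of J w] gens_closed by blast

text \<open>The exchange condition shortens a word by deleting letters, so starting from a word over
  \<open>J\<close> the length with respect to all of \<open>S\<close> is reached without leaving
  \<open>J\<close>.\<close>

lemma reduced_word_parabolic:
  assumes J: "J \<subseteq> S" and w: "w \<in> generate W J"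
  obtains ws where "ws \<in> lists J" "word_val W ws = w" "length ws = len w"
proof -
  have JS: "lists J \<subseteq> lists S" using J by (rule lists_mono)
  have "\<exists>ws\<in>lists J. word_val W ws = w"
    using w
  proof (induction rule: generate.induct)
    case one show ?case by (intro bexI[of _ "[]"]) auto
  next
    case (incl h) then show ?case using J by (intro bexI[of _ "[h]"]) auto
  next
    case (inv h) then show ?case using J subsetD[OF J, of h] by (intro bexI[of _ "[h]"]) auto
  next
    case (eng h1 h2)
    then obtain u v where "u \<in> lists J" "v \<in> lists J" "word_val W u = h1" "word_val W v = h2"
      by blast
    then show ?case using word_val_append subsetD[OF JS] by (intro bexI[of _ "u @ v"]) auto
  qed
  then obtain ws where "ws \<in> lists J" "word_val W ws = w" by blast
  then have "\<exists>vs\<in>lists J. word_val W vs = w \<and> length vs = len w"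
  proof (induction ws arbitrary: w)
    case Nil then show ?case by (intro bexI[of _ "[]"]) auto
  next
    case (Cons a ws)
    then have a: "a \<in> J" "a \<in> S" and ws: "ws \<in> lists J" using J by auto
    obtain vs where vs: "vs \<in> lists J" "word_val W vs = word_val W ws" "length vs = len (word_val W ws)"
      using Cons.IH[OF refl] by blast
    have w: "w = a \<otimes> word_val W vs" using Cons.prems vs by simp
    have c: "word_val W vs \<in> carrier W" using vs JS word_val_closed by blast
    from len_gen_mult[OF a(2) c] show ?case
    proof
      assume "len (a \<otimes> word_val W vs) = Suc (len (word_val W vs))"
      then show ?thesis using vs a w by (intro bexI[of _ "a # vs"]) auto
    next
      assume l: "Suc (len (a \<otimes> word_val W vs)) = len (word_val W vs)"
      then have "len (a \<otimes> word_val W vs) < len (word_val W vs)" by simp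
      then obtain us x zs where d: "vs = us @ x # zs" "a \<otimes> word_val W vs = word_val W (us @ zs)"
        using exchange_word[OF _ a(2), of vs] vs JS by blast
      show ?thesis using d l w vs by (intro bexI[of _ "us @ zs"]) auto
    qed
  qed
  then show thesis using that by blast
qed

lemma gen_in_parabolic: "J \<subseteq> S \<Longrightarrow> s \<in> S \<Longrightarrow> s \<in> generate W J \<longleftrightarrow> s \<in> J"
proof
  assume J: "J \<subseteq> S" and s: "s \<in> S" "s \<in> generate W J"
  obtain ws where "ws \<in> lists J" "word_val W ws = s" "length ws = len s"
    using reduced_word_parabolic[OF J s(2)] .
  then show "s \<in> J" using J len_gen[OF s(1)] by (auto simp: length_Suc_conv)
qed (rule generate.incl)

text \<open>Deleting a letter from a word over \<open>J\<close> shows that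
  \<open>s \<otimes> w\<close> stays in the parabolic subgroup. Hence so does \<open>s\<close>, and
  a generator in that subgroup belongs to \<open>J\<close>.\<close>

lemma left_descent_parabolic:
  assumes J: "J \<subseteq> S" and w: "w \<in> generate W J" and s: "s \<in> S" "len (s \<otimes> w) < len w"
  shows "s \<in> J"
proof -
  have JS: "lists J \<subseteq> lists S" using J by (rule lists_mono)
  obtain ws where ws: "ws \<in> lists J" "word_val W ws = w"
    using reduced_word_parabolic[OF J w] by blast
  obtain us x vs where d: "ws = us @ x # vs" "s \<otimes> w = word_val W (us @ vs)"
    using exchange_word[of ws s] subsetD[OF JS ws(1)] ws(2) s by blast
  have val: "word_val W zs \<in> generate W J" if "zs \<in> lists J" for zs
    using that by (induction zs) (auto intro: generate.intros)
  have "us @ vs \<in> lists J" using d ws by auto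
  then have "s \<otimes> w \<in> generate W J" using d val by simp
  then have "(s \<otimes> w) \<otimes> inv w \<in> generate W J" using parabolic_inv[OF J w] by (rule generate.eng)
  moreover have "(s \<otimes> w) \<otimes> inv w = s" using s parabolic_closed[OF J w] by (simp add: m_assoc)
  ultimately show ?thesis using gen_in_parabolic[OF J s(1)] by simp
qed

lemma ex_right_descent:
  assumes J: "J \<subseteq> S" and w: "w \<in> generate W J" "w \<noteq> \<one>"
  obtains t where "t \<in> J" "len (w \<otimes> t) < len w"
proof -
  have wc: "w \<in> carrier W" using J w parabolic_closed by blast
  obtain ws where ws: "ws \<in> lists J" "word_val W ws = inv w" "length ws = len (inv w)"
    using reduced_word_parabolic[OF J parabolic_inv[OF J w(1)]] .
  have "ws \<noteq> []" using ws w(2) wc len_eq_0[of w] by auto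
  then obtain t us where t: "ws = t # us" by (cases ws) auto
  have tJ: "t \<in> J" "t \<in> S" "us \<in> lists S" using ws(1) t J by auto
  have "inv w = t \<otimes> word_val W us" using ws t by simp
  then have "t \<otimes> inv w = word_val W us" using tJ word_val_closed[OF tJ(3)] by simp
  then have "len (t \<otimes> inv w) \<le> length us" using len_word_val_le[OF tJ(3)] by simp
  then have "len (w \<otimes> t) < len w" using len_inv_mult_gen[OF tJ(2) wc] ws t wc by simp
  then show thesis using that tJ by blast
qed

text \<open>A reduced word of \<open>u\<close> is built up from its end. If \<open>x = a c\<close>
  adds lengths and \<open>s a\<close> is longer than \<open>a\<close>, then exchange for the descent
  \<open>s\<close> of \<open>x\<close> has to delete a letter of \<open>c\<close>, which makes room
  for \<open>s\<close> in front of \<open>a\<close>.\<close>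

lemma factor_full_descents:
  assumes J: "J \<subseteq> S" and x: "x \<in> carrier W" "\<And>s. s \<in> J \<Longrightarrow> len (s \<otimes> x) < len x"
    and u: "u \<in> generate W J"
  shows "len u + len (inv u \<otimes> x) = len x"
proof -
  have main: "len (word_val W ws) = length ws \<Longrightarrow>
      length ws + len (inv (word_val W ws) \<otimes> x) = len x" if "ws \<in> lists J" for ws
    using that
  proof (induction ws)
    case Nil then show ?case using x by simp
  next
    case (Cons s ws)
    then have s: "s \<in> J" "s \<in> S" and ws: "ws \<in> lists J" "ws \<in> lists S" using J by auto
    define a where "a = word_val W ws"
    define c where "c = inv a \<otimes> x"
    have ca: "a \<in> carrier W" "c \<in> carrier W" using word_val_closed[OF ws(2)] x unfolding a_def c_def by auto
    have "len a \<ge> length ws" using Cons.prems len_mult_le[of s a] s ca unfolding a_def by simp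
    then have la: "len a = length ws" using len_word_val_le[OF ws(2)] unfolding a_def by simp
    then have IH: "length ws + len c = len x" using Cons.IH ws unfolding a_def c_def by simp
    have xa: "x = a \<otimes> c" using ca x unfolding c_def by (simp flip: m_assoc)
    have "len (s \<otimes> (a \<otimes> c)) < len (a \<otimes> c)" using x(2)[OF s(1)] xa by simp
    moreover have "\<not> len (s \<otimes> a) < len a" using Cons.prems la unfolding a_def by simp
    ultimately obtain b where b: "b \<in> carrier W" "len b < len c" "s \<otimes> (a \<otimes> c) = a \<otimes> b"
      using exchange[OF ca s(2)] by blast
    have sx: "x = (s \<otimes> a) \<otimes> b" using xa gen_cancel[OF s(2), of "a \<otimes> c"] s ca b by (simp add: m_assoc)
    then have cb: "inv (s \<otimes> a) \<otimes> x = b" unfolding sx using inv_cancel(1)[of "s \<otimes> a" b] s ca b by simp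
    have "len x \<le> length (s # ws) + len b"
      using sx len_mult_le[of "s \<otimes> a" b] Cons.prems b s ca unfolding a_def by simp
    then show ?case using IH b(2) cb unfolding a_def by simp
  qed
  obtain ws where "ws \<in> lists J" "word_val W ws = u" "length ws = len u"
    using reduced_word_parabolic[OF J u] by blast
  then show ?thesis using main[of ws] by simp
qed

end

section \<open>Longest elements of parabolic subgroups\<close>

locale finite_coxeter_system = coxeter_system +
  assumes finite_carrier: "finite (carrier W)"
begin

abbreviation wlong :: "'a set \<Rightarrow> 'a" where "wlong J \<equiv> longest W S J"

lemma longest_in [intro]: "J \<subseteq> S \<Longrightarrow> wlong J \<in> generate W J"
  and len_le_longest: "J \<subseteq> S \<Longrightarrow> u \<in> generate W J \<Longrightarrow> len u \<le> len (wlong J)"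
proof -
  assume J: "J \<subseteq> S"
  have "finite (generate W J)"
    using finite_carrier generate_incl[of J] J gens_closed finite_subset by (metis subset_trans)
  then have fin: "finite (len ` generate W J)" by simp
  have b: "\<forall>y. y \<in> generate W J \<longrightarrow> len y < Suc (Max (len ` generate W J))"
    using Max_ge[OF fin] by (simp add: less_Suc_eq_le)
  have one: "\<one> \<in> generate W J" by (rule generate.one)
  show "wlong J \<in> generate W J"
    using arg_max_natI[of "\<lambda>w. w \<in> generate W J", OF one b] unfolding longest_def by simp
  show "len u \<le> len (wlong J)" if "u \<in> generate W J"
    using arg_max_nat_le[of "\<lambda>w. w \<in> generate W J", OF that b] unfolding longest_def by simp
qed

lemma longest_closed [simp]: "J \<subseteq> S \<Longrightarrow> wlong J \<in> carrier W"
  by (rule parabolic_closed) auto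

lemma len_gen_longest:
  assumes J: "J \<subseteq> S" and s: "s \<in> S"
  shows "len (s \<otimes> wlong J) < len (wlong J) \<longleftrightarrow> s \<in> J"
proof
  assume "s \<in> J"
  then have "s \<otimes> wlong J \<in> generate W J"
    by (intro generate.eng generate.incl longest_in[OF J])
  then have "len (s \<otimes> wlong J) \<le> len (wlong J)" by (rule len_le_longest[OF J])
  then show "len (s \<otimes> wlong J) < len (wlong J)" using len_gen_mult[OF s longest_closed[OF J]] by linarith
qed (use left_descent_parabolic[OF J longest_in[OF J] s] in blast)

lemma longest_inj: "I \<subseteq> S \<Longrightarrow> J \<subseteq> S \<Longrightarrow> wlong I = wlong J \<Longrightarrow> I = J"
  using len_gen_longest[of I] len_gen_longest[of J] by (auto dest: subsetD)

lemma len_longest_factor: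
  assumes "J \<subseteq> S" "x \<in> carrier W" "\<And>s. s \<in> J \<Longrightarrow> len (s \<otimes> x) < len x"
  shows "len (wlong J) + len (inv (wlong J) \<otimes> x) = len x"
  by (rule factor_full_descents) (use assms in auto)

text \<open>Splitting \<open>u\<close> off \<open>wlong J\<close> leaves a cofactor of length
  0.\<close>

lemma longest_unique:
  assumes J: "J \<subseteq> S" and u: "u \<in> generate W J" "len u = len (wlong J)"
  shows "u = wlong J"
proof -
  have uc: "u \<in> carrier W" using parabolic_closed J u by blast
  have "len u + len (inv u \<otimes> wlong J) = len (wlong J)"
    by (rule factor_full_descents[OF J]) (use J u len_gen_longest[OF J] in auto)
  then have "inv u \<otimes> wlong J = \<one>" using u uc J len_eq_0[of "inv u \<otimes> wlong J"] by simp
  then have "u \<otimes> (inv u \<otimes> wlong J) = u \<otimes> \<one>" by simp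
  then show ?thesis using uc J by simp
qed

lemma inv_longest [simp]: "J \<subseteq> S \<Longrightarrow> inv (wlong J) = wlong J"
  by (rule longest_unique) (auto intro: parabolic_inv)

lemma longest_square [simp]: "J \<subseteq> S \<Longrightarrow> wlong J \<otimes> wlong J = \<one>"
  by (metis inv_longest l_inv longest_closed)

lemma longest_cancel [simp]: "J \<subseteq> S \<Longrightarrow> w \<in> carrier W \<Longrightarrow> wlong J \<otimes> (wlong J \<otimes> w) = w"
  by (simp flip: m_assoc)

lemma len_longest_mult:
  assumes J: "J \<subseteq> S" and u: "u \<in> generate W J"
  shows "len u + len (wlong J \<otimes> u) = len (wlong J)" "len u + len (u \<otimes> wlong J) = len (wlong J)"
proof -
  have *: "len u + len (inv u \<otimes> wlong J) = len (wlong J)" if "u \<in> generate W J" for u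
    by (rule factor_full_descents[OF J]) (use J that len_gen_longest[OF J] in auto)
  have uc: "u \<in> carrier W" using parabolic_closed J u by blast
  show "len u + len (u \<otimes> wlong J) = len (wlong J)"
    using *[OF parabolic_inv[OF J u]] uc by simp
  have "inv (inv u \<otimes> wlong J) = wlong J \<otimes> u" using uc J by (simp add: inv_mult_group)
  then show "len u + len (wlong J \<otimes> u) = len (wlong J)"
    using *[OF u] uc J len_inv[of "inv u \<otimes> wlong J"] by simp
qed

text \<open>Multiplication by \<open>wlong J\<close> on either side complements lengths in the
  parabolic subgroup, so multiplying on both sides preserves length 1.\<close>

lemma longest_conj_gen:
  assumes J: "J \<subseteq> S" and s: "s \<in> J"
  shows "wlong J \<otimes> s \<otimes> wlong J \<in> J"
proof -
  have sS: "s \<in> S" using assms by blast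
  have sg: "s \<otimes> wlong J \<in> generate W J" using s J by (auto intro: generate.intros)
  have "len (s \<otimes> wlong J) + len (wlong J \<otimes> (s \<otimes> wlong J)) = len (wlong J)"
    by (rule len_longest_mult[OF J sg])
  moreover have "len s + len (s \<otimes> wlong J) = len (wlong J)"
    using s J by (intro len_longest_mult) (auto intro: generate.incl)
  ultimately have "len (wlong J \<otimes> s \<otimes> wlong J) = 1" using J sS by (simp add: m_assoc)
  then have "wlong J \<otimes> s \<otimes> wlong J \<in> S" using len_eq_1 J sS by (metis gen_closed longest_closed m_closed)
  moreover have "wlong J \<otimes> s \<otimes> wlong J \<in> generate W J"
    using sg J generate.eng[OF longest_in[OF J] sg] sS by (simp add: m_assoc)
  ultimately show ?thesis using gen_in_parabolic[OF J] by blast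
qed

lemma carrier_parabolic: "w \<in> carrier W \<longleftrightarrow> w \<in> generate W S"
  by (simp add: gens_generate)

lemma len_mult_w0:
  assumes "w \<in> carrier W"
  shows "len w + len (wlong S \<otimes> w) = len (wlong S)" "len w + len (w \<otimes> wlong S) = len (wlong S)"
  using len_longest_mult[of S w] assms carrier_parabolic by auto

text \<open>Multiplication by \<open>wlong S\<close> reverses lengths, so the ascents
  \<open>s \<in> J\<close> of \<open>b\<close> become descents of
  \<open>b \<otimes> wlong S\<close>, and \<open>factor_full_descents\<close> applies to that
  element.\<close>

lemma len_parabolic_mult:
  assumes J: "J \<subseteq> S" and u: "u \<in> generate W J"
    and b: "b \<in> carrier W" "\<And>s. s \<in> J \<Longrightarrow> len b < len (s \<otimes> b)"
  shows "len (u \<otimes> b) = len u + len b"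
proof -
  have uc: "u \<in> carrier W" using parabolic_closed J u by blast
  have "len (s \<otimes> (b \<otimes> wlong S)) < len (b \<otimes> wlong S)" if "s \<in> J" for s
  proof -
    have sS: "s \<in> S" using that J by blast
    show ?thesis
      using len_mult_w0(2)[of "s \<otimes> b"] len_mult_w0(2)[of b] b(1) b(2)[OF that] sS by (simp add: m_assoc)
  qed
  then have "len (inv u) + len (inv (inv u) \<otimes> (b \<otimes> wlong S)) = len (b \<otimes> wlong S)"
    by (intro factor_full_descents[OF J _ _ parabolic_inv[OF J u]]) (use b in auto)
  then have "len u + len ((u \<otimes> b) \<otimes> wlong S) = len (b \<otimes> wlong S)" using uc b by (simp add: m_assoc)
  then show ?thesis using len_mult_w0(2)[of "u \<otimes> b"] len_mult_w0(2)[of b] uc b by simp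
qed

lemma len_mult_parabolic:
  assumes J: "J \<subseteq> S" and u: "u \<in> generate W J"
    and b: "b \<in> carrier W" "\<And>s. s \<in> J \<Longrightarrow> len b < len (b \<otimes> s)"
  shows "len (b \<otimes> u) = len b + len u"
proof -
  have uc: "u \<in> carrier W" using parabolic_closed J u by blast
  have "len (inv u \<otimes> inv b) = len (inv u) + len (inv b)"
    by (rule len_parabolic_mult[OF J parabolic_inv[OF J u]])
      (use b J len_inv_mult_gen[OF _ b(1)] in \<open>auto simp: subset_iff\<close>)
  then show ?thesis using uc b len_inv[of "b \<otimes> u"] by (simp add: inv_mult_group)
qed

end

section \<open>The involution of the group induced by \<open>\<sigma>\<close>\<close>

locale twisted_coxeter_system = finite_coxeter_system +
  fixes \<sigma>
  assumes graph_aut: "\<sigma> \<in> graph_aut (cox_graph W S)"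
    and involutive: "s \<in> S \<Longrightarrow> \<sigma> (\<sigma> s) = s"
begin

abbreviation tw :: "'a \<Rightarrow> 'a" where "tw \<equiv> aut_ext W S \<sigma>"

lemma tw_props: "tw \<in> hom W W" "tw \<in> extensional (carrier W)" "\<And>s. s \<in> S \<Longrightarrow> tw s = \<sigma> s"
  using theI'[OF aut_ext_unique[OF graph_aut]] unfolding aut_ext_def by auto

lemma sigma_in [simp]: "s \<in> S \<Longrightarrow> \<sigma> s \<in> S"
  by (rule graph_aut_ord(1)[OF graph_aut])

lemma sigma_stable_iff:
  assumes "L \<subseteq> S" "\<sigma> ` L \<subseteq> L" "s \<in> S"
  shows "\<sigma> s \<in> L \<longleftrightarrow> s \<in> L"
  using assms involutive[OF assms(3)] by force

lemma tw_closed [simp]: "w \<in> carrier W \<Longrightarrow> tw w \<in> carrier W"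
  using tw_props(1) by (auto simp: hom_def)

lemma tw_mult [simp]: "u \<in> carrier W \<Longrightarrow> v \<in> carrier W \<Longrightarrow> tw (u \<otimes> v) = tw u \<otimes> tw v"
  using tw_props(1) by (rule hom_mult)

lemma tw_one [simp]: "tw \<one> = \<one>"
  using tw_props(1) hom_one is_group by blast

lemma tw_gen [simp]: "s \<in> S \<Longrightarrow> tw s = \<sigma> s"
  by (rule tw_props(3))

lemma tw_inv [simp]: "w \<in> carrier W \<Longrightarrow> tw (inv w) = inv (tw w)"
  using tw_mult[of "inv w" w] by (intro inv_equality[symmetric]) auto

lemma tw_word_val: "ws \<in> lists S \<Longrightarrow> tw (word_val W ws) = word_val W (map \<sigma> ws)"
  by (induction ws) (auto simp: word_val_closed)

lemma map_sigma_lists: "ws \<in> lists S \<Longrightarrow> map \<sigma> ws \<in> lists S"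
  by auto

lemma tw_tw [simp]:
  assumes "w \<in> carrier W" shows "tw (tw w) = w"
proof -
  obtain ws where ws: "ws \<in> lists S" "word_val W ws = w" using ex_word[OF assms] by blast
  have "map \<sigma> (map \<sigma> ws) = ws" using ws(1) involutive by (induction ws) auto
  then show ?thesis using ws tw_word_val map_sigma_lists by metis
qed

lemma len_tw [simp]:
  assumes "w \<in> carrier W" shows "len (tw w) = len w"
proof -
  have "len (tw v) \<le> len v" if "v \<in> carrier W" for v
    using reduced_word[OF that] tw_word_val map_sigma_lists len_word_val_le length_map by metis
  from this[OF assms] this[of "tw w"] show ?thesis using assms by simp
qed

lemma tw_parabolic:
  assumes L: "L \<subseteq> S" "\<sigma> ` L \<subseteq> L" and w: "w \<in> generate W L"
  shows "tw w \<in> generate W L"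
  using w
proof (induction rule: generate.induct)
  case (eng h1 h2)
  then show ?case using parabolic_closed[OF L(1)] by (auto intro: generate.eng)
qed (use L in \<open>auto intro!: generate.intros simp: subset_iff\<close>)

lemma tw_longest:
  assumes "L \<subseteq> S" "\<sigma> ` L \<subseteq> L" shows "tw (wlong L) = wlong L"
  using assms by (intro longest_unique) (auto intro: tw_parabolic)

lemma tw_w0 [simp]: "tw (wlong S) = wlong S"
  by (rule tw_longest) auto

section \<open>Minimal elements of classes of twisted involutions\<close>

text \<open>For such \<open>J\<close> and \<open>s \<in> J\<close> the twisted conjugate
  \<open>s \<otimes> wlong J \<otimes> \<sigma> s\<close> is \<open>wlong J\<close> itself. For
  trivial \<open>\<sigma>\<close> these are the sets with \<open>wlong J\<close> central in its
  parabolic subgroup.\<close>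

definition admissible :: "'a set \<Rightarrow> bool" where
  "admissible J \<longleftrightarrow> J \<subseteq> S \<and> (\<forall>s\<in>J. wlong J \<otimes> s \<otimes> wlong J = \<sigma> s)"

lemma admissible_subset: "admissible J \<Longrightarrow> J \<subseteq> S"
  by (simp add: admissible_def)

lemma admissible_image: "admissible J \<Longrightarrow> \<sigma> ` J \<subseteq> J"
  using longest_conj_gen unfolding admissible_def by (metis image_subsetI)

lemma admissible_commute:
  assumes "admissible J" "s \<in> J" shows "s \<otimes> wlong J = wlong J \<otimes> \<sigma> s"
proof -
  have "s \<in> S" "J \<subseteq> S" using assms admissible_subset by auto
  then have "wlong J \<otimes> (wlong J \<otimes> s \<otimes> wlong J) = s \<otimes> wlong J" by (simp add: m_assoc)
  then show ?thesis using assms by (simp add: admissible_def)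
qed

lemma tw_eq_inv:
  assumes "w \<in> carrier W" "w \<otimes> tw w = \<one>" shows "tw w = inv w"
  using inv_cancel(1)[of w "tw w"] assms by simp

lemma len_mult_sigma:
  assumes w: "w \<in> carrier W" "w \<otimes> tw w = \<one>" and s: "s \<in> S"
  shows "len (w \<otimes> \<sigma> s) = len (s \<otimes> w)"
proof -
  have "tw (s \<otimes> w) = \<sigma> s \<otimes> inv w" using s w tw_eq_inv[OF w] by simp
  then show ?thesis using s w len_inv_mult_gen[of "\<sigma> s" w] len_tw[of "s \<otimes> w"] by simp
qed

text \<open>A twisted form of Richardson's description of involutions. The factorisation
  \<open>w = wlong I \<otimes> c\<close> adds lengths. A right descent \<open>t\<close> of
  \<open>c\<close> would give \<open>s' \<otimes> c = c \<otimes> t\<close> with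
  \<open>s' \<in> I\<close>, and then both factors of
  \<open>w = (wlong I \<otimes> s') \<otimes> (s' \<otimes> c)\<close> would be too short.\<close>

lemma locally_minimal_longest:
  assumes w: "w \<in> carrier W" "w \<otimes> tw w = \<one>"
    and local: "\<And>s. s \<in> S \<Longrightarrow> len (s \<otimes> w) < len w \<Longrightarrow> s \<otimes> w = w \<otimes> \<sigma> s"
  defines "I \<equiv> {s \<in> S. len (s \<otimes> w) < len w}"
  shows "w = wlong I \<and> admissible I"
proof -
  have I: "I \<subseteq> S" unfolding I_def by blast
  have right: "len (w \<otimes> \<sigma> s) = len (s \<otimes> w)" if "s \<in> S" for s
    by (rule len_mult_sigma[OF w that])
  define c where "c = inv (wlong I) \<otimes> w"
  have c: "c \<in> carrier W" "w = wlong I \<otimes> c" using I w unfolding c_def by simp_all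
  have lw: "len (wlong I) + len c = len w"
    unfolding c_def by (rule len_longest_factor) (use I w I_def in auto)
  have "c = \<one>"
  proof (rule ccontr)
    assume "c \<noteq> \<one>"
    then obtain t where tS: "t \<in> S" and ct: "len (c \<otimes> t) < len c"
      using ex_right_descent[of S c] c(1) gens_generate by blast
    have wt_eq: "w \<otimes> t = wlong I \<otimes> (c \<otimes> t)" using c tS I by (simp add: m_assoc)
    then have wt: "len (w \<otimes> t) < len w"
      using len_mult_le[of "wlong I" "c \<otimes> t"] lw ct c tS I by simp
    \<comment> \<open>For a twisted involution, \<open>t\<close> is a right descent exactly when
      \<open>\<sigma> t\<close> is a left descent.\<close>
    define s where "s = \<sigma> t"
    have s: "s \<in> S" "\<sigma> s = t" using tS involutive by (simp_all add: s_def)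
    then have sI: "s \<in> I" using right[of s] wt by (simp add: I_def)
    define s' where "s' = wlong I \<otimes> s \<otimes> wlong I"
    have s': "s' \<in> I" "s' \<in> S" using longest_conj_gen[OF I sI] I by (auto simp: s'_def)
    have "s \<otimes> w = wlong I \<otimes> (s' \<otimes> c)"
      unfolding c(2) s'_def using c(1) I s by (simp add: m_assoc)
    moreover have "s \<otimes> w = wlong I \<otimes> (c \<otimes> t)"
      using local[OF s(1)] sI s(2) wt_eq by (simp add: I_def)
    ultimately have "wlong I \<otimes> (wlong I \<otimes> (s' \<otimes> c)) = wlong I \<otimes> (wlong I \<otimes> (c \<otimes> t))" by simp
    then have "s' \<otimes> c = c \<otimes> t" using I c(1) s' tS by simp
    moreover have "w = (wlong I \<otimes> s') \<otimes> (s' \<otimes> c)" using c I s' by (simp add: m_assoc)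
    then have "len w \<le> len (wlong I \<otimes> s') + len (s' \<otimes> c)"
      using len_mult_le[of "wlong I \<otimes> s'" "s' \<otimes> c"] I c s' by simp
    moreover have "len s' + len (wlong I \<otimes> s') = len (wlong I)"
      using s' by (intro len_longest_mult[OF I]) (rule generate.incl)
    ultimately show False using ct lw s' by simp
  qed
  then have wI: "w = wlong I" using c I by simp
  moreover have "wlong I \<otimes> s \<otimes> wlong I = \<sigma> s" if "s \<in> I" for s
  proof -
    have s: "s \<in> S" "s \<otimes> w = w \<otimes> \<sigma> s" using that local by (auto simp: I_def)
    have "wlong I \<otimes> s \<otimes> wlong I = wlong I \<otimes> (s \<otimes> w)" using s(1) I by (simp add: wI[symmetric] m_assoc w)
    also have "\<dots> = wlong I \<otimes> (wlong I \<otimes> \<sigma> s)" using s(2) wI by simp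
    finally show ?thesis using I s by simp
  qed
  ultimately show ?thesis using I by (simp add: admissible_def)
qed

lemma twisted_class_closed: "w \<in> carrier W \<Longrightarrow> twisted_class W S \<sigma> w \<subseteq> carrier W"
  unfolding twisted_class_def by auto

lemma twisted_class_conj:
  assumes "w \<in> carrier W" "x \<in> twisted_class W S \<sigma> w" "v \<in> carrier W"
  shows "inv v \<otimes> x \<otimes> tw v \<in> twisted_class W S \<sigma> w"
proof -
  obtain u where u: "u \<in> carrier W" "x = inv u \<otimes> w \<otimes> tw u"
    using assms(2) unfolding twisted_class_def by blast
  then have "inv v \<otimes> x \<otimes> tw v = inv (u \<otimes> v) \<otimes> w \<otimes> tw (u \<otimes> v)"
    using assms by (simp add: inv_mult_group m_assoc)
  then show ?thesis using u assms unfolding twisted_class_def by blast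
qed

lemma twisted_class_sym:
  assumes "w \<in> carrier W" "x \<in> twisted_class W S \<sigma> w"
  shows "w \<in> twisted_class W S \<sigma> x"
proof -
  obtain u where u: "u \<in> carrier W" "x = inv u \<otimes> w \<otimes> tw u"
    using assms(2) unfolding twisted_class_def by blast
  then have "w = inv (inv u) \<otimes> x \<otimes> tw (inv u)" using assms by (simp add: m_assoc)
  then show ?thesis using u unfolding twisted_class_def by blast
qed

lemma twisted_class_eq:
  assumes "w \<in> carrier W" "x \<in> twisted_class W S \<sigma> w"
  shows "twisted_class W S \<sigma> x = twisted_class W S \<sigma> w"
proof -
  have sub: "twisted_class W S \<sigma> x \<subseteq> twisted_class W S \<sigma> w"
    if "w \<in> carrier W" "x \<in> twisted_class W S \<sigma> w" for x w
    using twisted_class_conj[OF that] by (auto simp: twisted_class_def[of W S \<sigma> x])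
  have "x \<in> carrier W" using assms twisted_class_closed by blast
  then show ?thesis using sub assms twisted_class_sym by blast
qed

lemma ex_admissible_in_class:
  assumes c: "c \<in> carrier W" and inv: "\<And>x. x \<in> twisted_class W S \<sigma> c \<Longrightarrow> x \<otimes> tw x = \<one>"
    and L: "L \<subseteq> S" "\<sigma> ` L \<subseteq> L"
  shows "x \<in> twisted_class W S \<sigma> c \<Longrightarrow> x \<in> generate W L \<Longrightarrow>
    \<exists>I\<subseteq>L. admissible I \<and> wlong I \<in> twisted_class W S \<sigma> c"
proof (induction "len x" arbitrary: x rule: less_induct)
  case less
  have xc: "x \<in> carrier W" using less.prems c twisted_class_closed by blast
  show ?case
  proof (cases "\<exists>s\<in>S. len (s \<otimes> x) < len x \<and> s \<otimes> x \<noteq> x \<otimes> \<sigma> s")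
    case True
    then obtain s where s: "s \<in> S" "len (s \<otimes> x) < len x" "s \<otimes> x \<noteq> x \<otimes> \<sigma> s" by blast
    have sL: "s \<in> L" using left_descent_parabolic L less.prems s by blast
    \<comment> \<open>Both \<open>s\<close> on the left and \<open>\<sigma> s\<close> on the right
      shorten \<open>x\<close>; since the two products differ, \<open>two_sided_descent\<close>
      makes the second multiplication shorten once more.\<close>
    have "len (x \<otimes> \<sigma> s) < len x" using len_mult_sigma[OF xc inv[OF less.prems(1)] s(1)] s(2) by simp
    then have "len (s \<otimes> x \<otimes> \<sigma> s) < len x" using two_sided_descent[OF xc s(1) _ s(2)] s sigma_in[of s] by fastforce
    moreover have "s \<otimes> x \<otimes> \<sigma> s \<in> twisted_class W S \<sigma> c"
      using twisted_class_conj[OF c less.prems(1), of s] s by simp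
    moreover have "s \<otimes> x \<otimes> \<sigma> s \<in> generate W L"
      using generate.eng[OF generate.eng[OF generate.incl[OF sL] less.prems(2)] generate.incl] sL L by blast
    ultimately show ?thesis using less.hyps by blast
  next
    case False
    define I where "I = {s \<in> S. len (s \<otimes> x) < len x}"
    have "x = wlong I \<and> admissible I"
      unfolding I_def by (rule locally_minimal_longest) (use xc inv less.prems False in auto)
    moreover have "I \<subseteq> L" using left_descent_parabolic[OF L(1) less.prems(2)] by (auto simp: I_def)
    ultimately show ?thesis using less.prems by blast
  qed
qed

text \<open>An element of minimal length among those conjugating one longest element to the other is
  reduced with respect to both parabolic subgroups, so that lengths add up on both sides.\<close>

lemma len_admissible_eq:
  assumes I: "admissible I" and J: "admissible J"
    and conj: "wlong I \<in> twisted_class W S \<sigma> (wlong J)"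
  shows "len (wlong I) = len (wlong J)"
proof -
  have IS: "I \<subseteq> S" and JS: "J \<subseteq> S" using I J admissible_subset by auto
  \<comment> \<open>In this form the set of conjugators is closed under left multiplication by
    \<open>J\<close> and right multiplication by \<open>I\<close>: admissibility moves a generator
    past the longest element and turns it into its image under \<open>\<sigma>\<close>.\<close>
  define P where "P v \<longleftrightarrow> v \<in> carrier W \<and> v \<otimes> wlong I = wlong J \<otimes> tw v" for v
  obtain v0 where v0: "v0 \<in> carrier W" "wlong I = inv v0 \<otimes> wlong J \<otimes> tw v0"
    using conj unfolding twisted_class_def by blast
  then have "P v0" using JS by (simp add: P_def m_assoc)
  then obtain v where v: "P v" and min: "\<And>u. P u \<Longrightarrow> len v \<le> len u"
    using ex_has_least_nat[of P v0 len] by blast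
  have vc: "v \<in> carrier W" and veq: "v \<otimes> wlong I = wlong J \<otimes> tw v" using v by (auto simp: P_def)
  have left: "len v < len (s \<otimes> v)" if "s \<in> J" for s
  proof -
    have s: "s \<in> S" using that JS by blast
    have "(s \<otimes> v) \<otimes> wlong I = (s \<otimes> wlong J) \<otimes> tw v" using s vc veq IS JS by (simp add: m_assoc)
    also have "\<dots> = wlong J \<otimes> tw (s \<otimes> v)"
      using admissible_commute[OF J that] s vc JS by (simp add: m_assoc)
    finally have "P (s \<otimes> v)" using s vc by (simp add: P_def)
    then show ?thesis using min len_gen_mult[OF s vc] by fastforce
  qed
  have right: "len v < len (v \<otimes> s)" if "s \<in> I" for s
  proof -
    have s: "s \<in> S" using that IS by blast
    have "(v \<otimes> s) \<otimes> wlong I = (v \<otimes> wlong I) \<otimes> \<sigma> s"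
      using admissible_commute[OF I that] s vc IS by (simp add: m_assoc)
    also have "\<dots> = wlong J \<otimes> tw (v \<otimes> s)" using s vc veq JS by (simp add: m_assoc)
    finally have "P (v \<otimes> s)" using s vc by (simp add: P_def)
    then show ?thesis using min len_mult_gen[OF s vc] by fastforce
  qed
  have "len (tw v) < len (s \<otimes> tw v)" if "s \<in> J" for s
  proof -
    have s: "s \<in> S" "\<sigma> s \<in> J" using that J JS admissible_image by auto
    have "tw (\<sigma> s \<otimes> v) = s \<otimes> tw v" using s vc involutive by simp
    then show ?thesis using left[OF s(2)] len_tw[of "\<sigma> s \<otimes> v"] s vc by simp
  qed
  then have "len (wlong J \<otimes> tw v) = len (wlong J) + len (tw v)"
    by (intro len_parabolic_mult[OF JS]) (use JS vc in auto)
  moreover have "len (v \<otimes> wlong I) = len v + len (wlong I)"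
    by (rule len_mult_parabolic[OF IS]) (use IS vc right in auto)
  ultimately show ?thesis using veq vc by simp
qed

end

section \<open>Translation of twisted classes by the longest element\<close>

context finite_coxeter_system
begin

abbreviation s0 :: "'a \<Rightarrow> 'a" where "s0 \<equiv> sigma0 W S"

lemma sigma0_eq: "s \<in> S \<Longrightarrow> s0 s = wlong S \<otimes> s \<otimes> wlong S"
  by (simp add: sigma0_def)

lemma sigma0_in [simp]: "s \<in> S \<Longrightarrow> s0 s \<in> S"
  using longest_conj_gen[of S s] by (simp add: sigma0_eq)

lemma sigma0_sigma0 [simp]:
  assumes "s \<in> S" shows "s0 (s0 s) = s"
  unfolding sigma0_eq[OF sigma0_in[OF assms]] unfolding sigma0_eq[OF assms]
  using assms by (simp add: m_assoc)

lemma ord_sigma0: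
  assumes "s \<in> S" "t \<in> S" shows "ord (s0 s \<otimes> s0 t) = ord (s \<otimes> t)"
proof -
  have pow: "(s0 s \<otimes> s0 t) [^] n = wlong S \<otimes> (s \<otimes> t) [^] n \<otimes> wlong S" if "s \<in> S" "t \<in> S" for n :: nat and s t
    using that by (induction n) (simp_all add: sigma0_eq m_assoc)
  have "ord (s0 s \<otimes> s0 t) dvd ord (s \<otimes> t)" if "s \<in> S" "t \<in> S" for s t
    using that pow[OF that, of "ord (s \<otimes> t)"] pow_eq_id[of "s0 s \<otimes> s0 t" "ord (s \<otimes> t)"] by simp
  from this[OF assms] this[of "s0 s" "s0 t"] assms show ?thesis by (simp add: dvd_antisym)
qed

end

context twisted_coxeter_system
begin

abbreviation tau :: "'a \<Rightarrow> 'a" where "tau \<equiv> times_sigma0 W S \<sigma>"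

lemma tau_eq: "s \<in> S \<Longrightarrow> tau s = s0 (\<sigma> s)"
  by (simp add: times_sigma0_def compose_def)

lemma sigma_sigma0:
  assumes "s \<in> S" shows "\<sigma> (s0 s) = s0 (\<sigma> s)"
proof -
  have "\<sigma> (s0 s) = tw (wlong S \<otimes> s \<otimes> wlong S)"
    using tw_gen[OF sigma0_in[OF assms]] by (simp only: sigma0_eq[OF assms])
  then show ?thesis using assms by (simp add: sigma0_eq)
qed

lemma tau_tau: "s \<in> S \<Longrightarrow> tau (tau s) = s"
  by (simp add: tau_eq sigma_sigma0 involutive)

lemma tau_bij: "bij_betw tau S S"
  by (rule bij_betw_byWitness[of _ tau]) (auto simp: tau_tau, auto simp: tau_eq)

lemma tau_graph_aut: "tau \<in> graph_aut (cox_graph W S)"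
proof -
  have "tau \<in> extensional S" by (simp add: times_sigma0_def)
  moreover have "ord (tau s \<otimes> tau t) = ord (s \<otimes> t)" if "s \<in> S" "t \<in> S" for s t
    using that ord_sigma0[of "\<sigma> s" "\<sigma> t"] graph_aut_ord(2)[OF graph_aut that] by (simp add: tau_eq)
  moreover have "tau s = tau t \<longleftrightarrow> s = t" if "s \<in> S" "t \<in> S" for s t
    using tau_tau that by metis
  moreover have "tau s \<in> S" if "s \<in> S" for s using that by (simp add: tau_eq)
  ultimately show ?thesis
    using tau_bij unfolding graph_aut_def cox_graph_def Bij_def by simp
qed

text \<open>\<open>\<sigma>\<close> and \<open>s0\<close> commute because \<open>tw\<close> fixes
  \<open>wlong S\<close>, so their composite is again an involution. Everything proved for
  \<open>\<sigma>\<close> thereby becomes available for the translated class.\<close>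

lemma twisted_tau: "twisted_coxeter_system W S tau"
  by unfold_locales (auto simp: tau_graph_aut tau_tau)

interpretation tau: twisted_coxeter_system W S tau
  by (rule twisted_tau)

lemma aut_ext_tau:
  assumes "w \<in> carrier W" shows "aut_ext W S tau w = wlong S \<otimes> tw w \<otimes> wlong S"
proof -
  obtain ws where ws: "ws \<in> lists S" "word_val W ws = w" using ex_word[OF assms] by blast
  from ws(1) have "aut_ext W S tau (word_val W ws) = wlong S \<otimes> tw (word_val W ws) \<otimes> wlong S"
  proof (induction ws)
    case (Cons a ws)
    then have "a \<in> S" "word_val W ws \<in> carrier W" using word_val_closed by auto
    then show ?case using Cons.IH by (simp add: tau_eq sigma0_eq m_assoc)
  qed simp
  then show ?thesis using ws by simp
qed

text \<open>Insert \<open>wlong S \<otimes> wlong S\<close> between \<open>w\<close> and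
  \<open>tw v\<close>: the first copy joins \<open>w\<close>, and the second one together with the
  trailing \<open>wlong S\<close> turns \<open>tw v\<close> into the image under
  \<open>tau\<close>.\<close>

lemma twisted_class_tau:
  assumes w: "w \<in> carrier W"
  shows "twisted_class W S \<sigma> w #> wlong S = twisted_class W S tau (w \<otimes> wlong S)"
proof -
  have "twisted_class W S \<sigma> w #> wlong S = (\<lambda>v. inv v \<otimes> w \<otimes> tw v \<otimes> wlong S) ` carrier W"
    unfolding twisted_class_def r_coset_def by auto
  also have "\<dots> = (\<lambda>v. inv v \<otimes> (w \<otimes> wlong S) \<otimes> aut_ext W S tau v) ` carrier W"
    using w by (intro image_cong) (simp_all add: aut_ext_tau m_assoc)
  also have "\<dots> = twisted_class W S tau (w \<otimes> wlong S)"
    unfolding twisted_class_def by auto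
  finally show ?thesis .
qed

lemma mem_coset_w0:
  assumes "C \<subseteq> carrier W" "x \<in> carrier W"
  shows "x \<otimes> wlong S \<in> C #> wlong S \<longleftrightarrow> x \<in> C"
proof
  assume "x \<otimes> wlong S \<in> C #> wlong S"
  then obtain y where y: "y \<in> C" "x \<otimes> wlong S = y \<otimes> wlong S" by (auto simp: r_coset_def)
  then have "x \<otimes> wlong S \<otimes> wlong S = y \<otimes> wlong S \<otimes> wlong S" by simp
  then have "x = y" using y assms by (simp add: m_assoc subset_iff)
  with y show "x \<in> C" by simp
qed (auto simp: r_coset_def)

text \<open>Multiplication by \<open>wlong S\<close> replaces each length by its complement, so
  minima and maxima change places.\<close>

lemma
  assumes C: "C \<subseteq> carrier W" and x: "x \<in> carrier W"
  shows min_length_coset: "min_length_elt W S (C #> wlong S) (x \<otimes> wlong S) \<longleftrightarrow> max_length_elt W S C x"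
    and max_length_coset: "max_length_elt W S (C #> wlong S) (x \<otimes> wlong S) \<longleftrightarrow> min_length_elt W S C x"
proof -
  have less: "len (y \<otimes> wlong S) < len (x \<otimes> wlong S) \<longleftrightarrow> len x < len y" if "y \<in> carrier W" "x \<in> carrier W" for x y
    using len_mult_w0(2)[of x] len_mult_w0(2)[of y] that by auto
  have ball: "(\<forall>z. z \<in> C #> wlong S \<longrightarrow> Q z) \<longleftrightarrow> (\<forall>y\<in>C. Q (y \<otimes> wlong S))" for Q
    by (auto simp: r_coset_def)
  have "(\<forall>y\<in>C. len (x \<otimes> wlong S) \<le> len (y \<otimes> wlong S)) \<longleftrightarrow> (\<forall>y\<in>C. len y \<le> len x)"
    "(\<forall>y\<in>C. len (y \<otimes> wlong S) \<le> len (x \<otimes> wlong S)) \<longleftrightarrow> (\<forall>y\<in>C. len x \<le> len y)"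
    using less[OF x] less[OF _ x] C by (auto simp: not_less[symmetric] subset_iff)
  then show "min_length_elt W S (C #> wlong S) (x \<otimes> wlong S) \<longleftrightarrow> max_length_elt W S C x"
    "max_length_elt W S (C #> wlong S) (x \<otimes> wlong S) \<longleftrightarrow> min_length_elt W S C x"
    unfolding min_length_elt_def max_length_elt_def is_arg_min_linorder is_arg_max_linorder ball
      mem_coset_w0[OF C x] by auto
qed

lemma ex1_coset:
  assumes C: "C \<subseteq> carrier W" and ex: "\<exists>!x. P x" and P: "\<And>x. P x \<Longrightarrow> x \<in> C"
    and Q: "\<And>x. x \<in> carrier W \<Longrightarrow> Q (x \<otimes> wlong S) \<longleftrightarrow> P x" "\<And>x. Q x \<Longrightarrow> x \<in> C #> wlong S"
  shows "\<exists>!x. Q x"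
proof -
  obtain x where x: "P x" "\<And>y. P y \<Longrightarrow> y = x" using ex by blast
  show ?thesis
  proof (rule ex1I[of _ "x \<otimes> wlong S"])
    show "Q (x \<otimes> wlong S)" using Q(1) x P C by blast
    fix z assume z: "Q z"
    then obtain y where y: "y \<in> C" "z = y \<otimes> wlong S" using Q(2) by (auto simp: r_coset_def)
    then have "P y" using Q(1) z C by blast
    then show "z = x \<otimes> wlong S" using x(2) y by simp
  qed
qed

lemma bi_capped_coset:
  assumes "bi_capped W S \<sigma> C"
  shows "bi_capped W S tau (C #> wlong S)"
proof -
  obtain w where w: "w \<in> carrier W" "C = twisted_class W S \<sigma> w"
    and inv: "\<And>x. x \<in> C \<Longrightarrow> twisted_involution W S \<sigma> x"
    and ex: "\<exists>!x. min_length_elt W S C x" "\<exists>!x. max_length_elt W S C x"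
    using assms unfolding bi_capped_def by blast
  have C: "C \<subseteq> carrier W" using w twisted_class_closed by blast
  have "twisted_involution W S tau x" if x: "x \<in> C #> wlong S" for x
  proof -
    obtain y where y: "y \<in> C" "x = y \<otimes> wlong S" using x by (auto simp: r_coset_def)
    then have "y \<in> carrier W" "y \<otimes> tw y = \<one>" using inv C unfolding twisted_involution_def by auto
    \<comment> \<open>In the product of \<open>y \<otimes> wlong S\<close> with its image under
      \<open>tau\<close> the longest elements cancel, and \<open>y \<otimes> tw y\<close>
      remains.\<close>
    then show ?thesis unfolding twisted_involution_def y(2) by (simp add: tau_tau aut_ext_tau m_assoc)
  qed
  moreover have "\<exists>!x. min_length_elt W S (C #> wlong S) x"
    by (rule ex1_coset[OF C ex(2)])
      (auto simp: min_length_coset[OF C], auto simp: max_length_elt_def min_length_elt_def is_arg_max_def is_arg_min_def)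
  moreover have "\<exists>!x. max_length_elt W S (C #> wlong S) x"
    by (rule ex1_coset[OF C ex(1)])
      (auto simp: max_length_coset[OF C], auto simp: max_length_elt_def min_length_elt_def is_arg_max_def is_arg_min_def)
  ultimately show ?thesis
    using tau_graph_aut w twisted_class_tau[OF w(1)] unfolding bi_capped_def by auto
qed

section \<open>Bi-capped classes and their diagrams\<close>

lemma bi_cappedD:
  assumes "bi_capped W S \<sigma> C"
  obtains c where "c \<in> carrier W" "C = twisted_class W S \<sigma> c" "C \<subseteq> carrier W"
    "\<forall>x\<in>C. x \<otimes> tw x = \<one>" "\<exists>!w. min_length_elt W S C w"
proof -
  obtain c where c: "c \<in> carrier W" "C = twisted_class W S \<sigma> c"
    using assms unfolding bi_capped_def by blast
  show thesis
  proof (rule that[OF c])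
    show "C \<subseteq> carrier W" using c twisted_class_closed by blast
    show "\<forall>x\<in>C. x \<otimes> tw x = \<one>"
      using assms unfolding bi_capped_def twisted_involution_def by blast
    show "\<exists>!w. min_length_elt W S C w" using assms unfolding bi_capped_def by blast
  qed
qed

lemma bi_capped_admissible_min:
  assumes C: "bi_capped W S \<sigma> C"
  obtains J where "admissible J" "min_length_elt W S C (wlong J)"
proof -
  obtain c where c: "c \<in> carrier W" "C = twisted_class W S \<sigma> c" "C \<subseteq> carrier W"
    "\<forall>x\<in>C. x \<otimes> tw x = \<one>" "\<exists>!w. min_length_elt W S C w"
    using bi_cappedD[OF C] by blast
  obtain w where min: "min_length_elt W S C w" using c(5) by blast
  then have w: "w \<in> C" "w \<in> carrier W" and le: "\<And>y. y \<in> C \<Longrightarrow> len w \<le> len y"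
    using min c(3) by (auto simp: min_length_elt_def is_arg_min_linorder)
  have "w = wlong {s \<in> S. len (s \<otimes> w) < len w} \<and> admissible {s \<in> S. len (s \<otimes> w) < len w}"
  proof (rule locally_minimal_longest)
    fix s assume s: "s \<in> S" "len (s \<otimes> w) < len w"
    have less: "len (w \<otimes> \<sigma> s) < len w"
      using len_mult_sigma[OF w(2) bspec[OF c(4) w(1)] s(1)] s(2) by simp
    have "s \<otimes> w \<otimes> \<sigma> s \<in> C" using twisted_class_conj[OF c(1), of w s] w c(2) s by simp
    then have "\<not> len (s \<otimes> w \<otimes> \<sigma> s) < len (s \<otimes> w)" using le s by fastforce
    then show "s \<otimes> w = w \<otimes> \<sigma> s" using two_sided_descent[OF w(2) s(1) _ s(2) less] s by simp
  qed (use w c in auto)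
  then show thesis using that min by metis
qed

text \<open>By \<open>len_admissible_eq\<close> every admissible \<open>wlong I\<close> in the class
  attains the minimal length, and the class has only one element of that length.\<close>

lemma admissible_min_unique:
  assumes C: "bi_capped W S \<sigma> C" and J: "J \<subseteq> S" "min_length_elt W S C (wlong J)"
  shows "admissible J" and "admissible I \<Longrightarrow> wlong I \<in> C \<Longrightarrow> I = J"
proof -
  obtain c where c: "c \<in> carrier W" "C = twisted_class W S \<sigma> c" "C \<subseteq> carrier W"
    "\<forall>x\<in>C. x \<otimes> tw x = \<one>" "\<exists>!w. min_length_elt W S C w"
    using bi_cappedD[OF C] by blast
  obtain J' where J': "admissible J'" "min_length_elt W S C (wlong J')"
    using bi_capped_admissible_min[OF C] by blast
  then have "wlong J' = wlong J" using c(5) J by blast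
  then have "J' = J" using longest_inj J J' admissible_subset by blast
  then show adm: "admissible J" using J' by simp
  assume I: "admissible I" "wlong I \<in> C"
  have "wlong J \<in> C" using J by (simp add: min_length_elt_def is_arg_min_def)
  then have "wlong I \<in> twisted_class W S \<sigma> (wlong J)" using I c(1,2) twisted_class_eq by blast
  then have "len (wlong I) = len (wlong J)" by (rule len_admissible_eq[OF I(1) adm])
  then have "min_length_elt W S C (wlong I)" using J I by (simp add: min_length_elt_def is_arg_min_def)
  then have "wlong I = wlong J" using c(5) J by blast
  then show "I = J" using longest_inj J I admissible_subset by blast
qed

text \<open>Applied twice: for \<open>\<sigma>\<close> with \<open>L\<close> the complement of an
  orbit, and for \<open>tau\<close> with \<open>L\<close> the complement of the type of a simplex
  mapped to an opposite one.\<close>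

lemma min_subset_parabolic:
  assumes C: "bi_capped W S \<sigma> C" and J: "J \<subseteq> S" "min_length_elt W S C (wlong J)"
    and L: "L \<subseteq> S" "\<sigma> ` L \<subseteq> L" and x: "x \<in> C" "x \<in> generate W L"
  shows "J \<subseteq> L"
proof -
  obtain c where c: "c \<in> carrier W" "C = twisted_class W S \<sigma> c"
    "\<forall>x\<in>C. x \<otimes> tw x = \<one>" using bi_cappedD[OF C] by metis
  obtain I where "I \<subseteq> L" "admissible I" "wlong I \<in> C"
    using ex_admissible_in_class[OF c(1) _ L, of x] c x by blast
  then show ?thesis using admissible_min_unique(2)[OF C J] by blast
qed

lemma class_diagram_eq:
  assumes C: "bi_capped W S \<sigma> C" and J: "J \<subseteq> S" "min_length_elt W S C (wlong J)"
  shows "class_diagram W S \<sigma> C = (cox_graph W S, S - J, \<sigma>)"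
proof -
  have "(THE J. J \<subseteq> S \<and> min_length_elt W S C (wlong J)) = J"
  proof (rule the_equality)
    fix K assume K: "K \<subseteq> S \<and> min_length_elt W S C (wlong K)"
    have "\<exists>!w. min_length_elt W S C w" using C by (simp add: bi_capped_def)
    then have "wlong K = wlong J" using K J by blast
    then show "K = J" using longest_inj K J by blast
  qed (use J in blast)
  then show ?thesis by (simp add: class_diagram_def)
qed

text \<open>This makes \<open>psi\<close> well defined: the diagram determines \<open>J\<close>, and
  twisted classes that share \<open>wlong J\<close> coincide.\<close>

lemma bi_capped_eqI:
  assumes C: "bi_capped W S \<sigma> C" and D: "bi_capped W S \<sigma> D"
    and eq: "class_diagram W S \<sigma> C = class_diagram W S \<sigma> D"
  shows "C = D"
proof -
  obtain J where J: "admissible J" "min_length_elt W S C (wlong J)" using bi_capped_admissible_min[OF C] by blast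
  obtain K where K: "admissible K" "min_length_elt W S D (wlong K)" using bi_capped_admissible_min[OF D] by blast
  have "S - J = S - K"
    using eq class_diagram_eq[OF C _ J(2)] class_diagram_eq[OF D _ K(2)] J(1) K(1) admissible_subset by simp
  then have "J = K" using J K admissible_subset by blast
  then have "wlong J \<in> C" "wlong J \<in> D" using J K by (auto simp: min_length_elt_def is_arg_min_def)
  moreover obtain c d where "c \<in> carrier W" "C = twisted_class W S \<sigma> c"
    "d \<in> carrier W" "D = twisted_class W S \<sigma> d"
    using bi_cappedD[OF C] bi_cappedD[OF D] by metis
  ultimately show ?thesis using twisted_class_eq by blast
qed

end

context finite_coxeter_system
begin

text \<open>That \<open>\<sigma>\<close> is an involution is recorded in the members of the class,
  so a member has to be exhibited first.\<close>

lemma bi_capped_twisted: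
  assumes C: "bi_capped W S \<sigma> C" shows "twisted_coxeter_system W S \<sigma>"
proof -
  obtain c where c: "c \<in> carrier W" "C = twisted_class W S \<sigma> c" "\<sigma> \<in> graph_aut (cox_graph W S)"
    "\<forall>w\<in>C. twisted_involution W S \<sigma> w" using C unfolding bi_capped_def by blast
  have "aut_ext W S \<sigma> \<one> = \<one>"
    using theI'[OF aut_ext_unique[OF c(3)]] hom_one is_group unfolding aut_ext_def by blast
  then have "c \<in> C" using c(1) unfolding c(2) twisted_class_def by (intro CollectI exI[of _ \<one>]) simp
  then show ?thesis using c by unfold_locales (auto simp: twisted_involution_def)
qed

lemma psi_class_diagram:
  assumes C: "bi_capped W S \<sigma> C"
  shows "psi W S (class_diagram W S \<sigma> C) = class_diagram W S (times_sigma0 W S \<sigma>) (C #> wlong S)"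
  unfolding psi_def
proof (rule the_equality)
  fix D'
  assume "\<exists>\<sigma>' C'. bi_capped W S \<sigma>' C' \<and> class_diagram W S \<sigma> C = class_diagram W S \<sigma>' C' \<and>
    D' = class_diagram W S (times_sigma0 W S \<sigma>') (C' #> wlong S)"
  then obtain \<sigma>' C' where *: "bi_capped W S \<sigma>' C'" "class_diagram W S \<sigma> C = class_diagram W S \<sigma>' C'"
    "D' = class_diagram W S (times_sigma0 W S \<sigma>') (C' #> wlong S)" by blast
  interpret twisted_coxeter_system W S \<sigma> by (rule bi_capped_twisted[OF C])
  have "\<sigma>' = \<sigma>" using *(2) by (simp add: class_diagram_def)
  then show "D' = class_diagram W S (times_sigma0 W S \<sigma>) (C #> wlong S)"
    using bi_capped_eqI[OF C] * by blast
qed (use C in blast)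

end

section \<open>Traces of linear operators\<close>

definition basis_vec :: "'a \<Rightarrow> 'a \<Rightarrow> real" where
  "basis_vec s = (\<lambda>x. if x = s then 1 else 0)"

definition lin_op :: "(('a \<Rightarrow> real) \<Rightarrow> 'a \<Rightarrow> real) \<Rightarrow> bool" where
  "lin_op F \<longleftrightarrow> (\<forall>a b u v. F (\<lambda>x. a * u x + b * v x) = (\<lambda>x. a * F u x + b * F v x))"

definition supported :: "'a set \<Rightarrow> ('a \<Rightarrow> real) \<Rightarrow> bool" where
  "supported S v \<longleftrightarrow> (\<forall>x. x \<notin> S \<longrightarrow> v x = 0)"

text \<open>Operators act on all real functions on the type; this is the trace of the block with
  indices in \<open>S\<close>. It is cyclic for operators that preserve the functions vanishing
  outside \<open>S\<close>.\<close>

definition op_trace :: "'a set \<Rightarrow> (('a \<Rightarrow> real) \<Rightarrow> 'a \<Rightarrow> real) \<Rightarrow> real" where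
  "op_trace S F = (\<Sum>s\<in>S. F (basis_vec s) s)"

lemma basis_vec_simps [simp]: "basis_vec s s = 1" "x \<noteq> s \<Longrightarrow> basis_vec s x = 0"
  by (simp_all add: basis_vec_def)

lemma supported_basis: "s \<in> S \<Longrightarrow> supported S (basis_vec s)"
  by (auto simp: supported_def basis_vec_def)

lemma lin_op_comb: "lin_op F \<Longrightarrow> F (\<lambda>x. a * u x + b * v x) = (\<lambda>x. a * F u x + b * F v x)"
  by (simp add: lin_op_def)

lemma lin_op_scale: "lin_op F \<Longrightarrow> F (\<lambda>x. a * u x) = (\<lambda>x. a * F u x)"
  using lin_op_comb[of F a u 0 u] by simp

lemma lin_op_uminus: "lin_op F \<Longrightarrow> F (\<lambda>x. - u x) = (\<lambda>x. - F u x)"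
  using lin_op_scale[of F "-1" u] by simp

lemma lin_op_comp: "lin_op F \<Longrightarrow> lin_op G \<Longrightarrow> lin_op (F \<circ> G)"
  by (simp add: lin_op_def)

lemma lin_op_id: "lin_op id"
  by (simp add: lin_op_def)

lemma lin_op_funpow: "lin_op F \<Longrightarrow> lin_op (F ^^ n)"
  by (induction n) (simp_all add: lin_op_comp lin_op_id[unfolded id_def] lin_op_id)

lemma lin_op_sum:
  assumes F: "lin_op F" and A: "finite A"
  shows "F (\<lambda>x. \<Sum>y\<in>A. a y * f y x) = (\<lambda>x. \<Sum>y\<in>A. a y * F (f y) x)"
  using A
proof (induction A)
  case empty
  show ?case using lin_op_scale[OF F, of 0] by simp
next
  case (insert z A)
  then show ?case
    using lin_op_comb[OF F, of "a z" "f z" 1 "\<lambda>x. \<Sum>y\<in>A. a y * f y x"] by simp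
qed

lemma lin_op_expand:
  assumes F: "lin_op F" and S: "finite S" and u: "supported S u"
  shows "F u x = (\<Sum>y\<in>S. u y * F (basis_vec y) x)"
proof -
  have "u = (\<lambda>x. \<Sum>y\<in>S. u y * basis_vec y x)"
  proof
    fix x
    have "(\<Sum>y\<in>S. u y * basis_vec y x) = (\<Sum>y\<in>S. if y = x then u y else 0)"
      by (intro sum.cong) (auto simp: basis_vec_def)
    then show "u x = (\<Sum>y\<in>S. u y * basis_vec y x)" using S u by (simp add: supported_def)
  qed
  then have "F u = F (\<lambda>x. \<Sum>y\<in>S. u y * basis_vec y x)" by simp
  then show ?thesis using lin_op_sum[OF F S] by simp
qed

lemma op_trace_comm:
  assumes S: "finite S" and F: "lin_op F" "\<And>v. supported S v \<Longrightarrow> supported S (F v)"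
    and G: "lin_op G" "\<And>v. supported S v \<Longrightarrow> supported S (G v)"
  shows "op_trace S (F \<circ> G) = op_trace S (G \<circ> F)"
proof -
  have "op_trace S (F \<circ> G) = (\<Sum>s\<in>S. \<Sum>y\<in>S. G (basis_vec s) y * F (basis_vec y) s)"
    unfolding op_trace_def comp_def
    by (intro sum.cong refl lin_op_expand F S G(2) supported_basis)
  also have "\<dots> = (\<Sum>y\<in>S. \<Sum>s\<in>S. F (basis_vec y) s * G (basis_vec s) y)"
    by (subst sum.swap) (simp add: mult.commute)
  also have "\<dots> = op_trace S (G \<circ> F)"
    unfolding op_trace_def comp_def
    by (intro sum.cong refl lin_op_expand[symmetric] G S F(2) supported_basis)
  finally show ?thesis .
qed

section \<open>The geometric representation\<close>

context finite_coxeter_system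
begin

lemma finite_gens [simp]: "finite S"
  using finite_carrier gens_closed finite_subset by blast

lemma ord_gens_pos: "s \<in> S \<Longrightarrow> t \<in> S \<Longrightarrow> ord (s \<otimes> t) > 0"
  using finite_carrier ord_ge_1[of "s \<otimes> t"] by simp

lemma ord_gens_ge_2:
  assumes "s \<in> S" "t \<in> S" "s \<noteq> t" shows "ord (s \<otimes> t) \<ge> 2"
proof -
  have "ord (s \<otimes> t) \<noteq> 1"
  proof
    assume "ord (s \<otimes> t) = 1"
    then have "s \<otimes> t = \<one>" using assms ord_eq_1[of "s \<otimes> t"] by simp
    then have "s \<otimes> (s \<otimes> t) = s \<otimes> \<one>" by simp
    then show False using assms by simp
  qed
  then show ?thesis using ord_gens_pos[OF assms(1,2)] by simp
qed

text \<open>The Tits form on the simple roots. The same formula gives 1 on the diagonal, since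
  \<open>s \<otimes> s\<close> has order 1.\<close>

definition bil :: "'a \<Rightarrow> 'a \<Rightarrow> real" where
  "bil s t = - cos (pi / ord (s \<otimes> t))"

lemma ord_commute: "s \<in> S \<Longrightarrow> t \<in> S \<Longrightarrow> ord (t \<otimes> s) = ord (s \<otimes> t)"
  using ord_inv[of "s \<otimes> t"] by (simp add: inv_mult_group)

lemma bil_self [simp]: "s \<in> S \<Longrightarrow> bil s s = 1"
  by (simp add: bil_def gens_involution)

definition root_form :: "'a \<Rightarrow> ('a \<Rightarrow> real) \<Rightarrow> real" where
  "root_form s v = (\<Sum>y\<in>S. bil s y * v y)"

definition refl_op :: "'a \<Rightarrow> ('a \<Rightarrow> real) \<Rightarrow> 'a \<Rightarrow> real" where
  "refl_op s v = (\<lambda>x. v x - 2 * root_form s v * basis_vec s x)"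

lemma root_form_comb: "root_form s (\<lambda>x. a * u x + b * v x) = a * root_form s u + b * root_form s v"
  by (simp add: root_form_def sum.distrib sum_distrib_left algebra_simps)

lemma root_form_basis: "t \<in> S \<Longrightarrow> root_form s (basis_vec t) = bil s t"
proof -
  assume t: "t \<in> S"
  have "root_form s (basis_vec t) = (\<Sum>y\<in>S. if y = t then bil s y else 0)"
    unfolding root_form_def by (intro sum.cong) (auto simp: basis_vec_def)
  then show ?thesis using t by simp
qed

lemma lin_op_refl: "lin_op (refl_op s)"
  unfolding lin_op_def refl_op_def root_form_comb by (simp add: algebra_simps)

lemma refl_op_basis: "s \<in> S \<Longrightarrow> refl_op s (basis_vec s) = (\<lambda>x. - basis_vec s x)"
  by (rule ext) (simp add: refl_op_def root_form_basis)

lemma refl_op_refl_op [simp]: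
  assumes "s \<in> S" shows "refl_op s (refl_op s v) = v"
proof -
  have "root_form s (refl_op s v) = - root_form s v"
    using root_form_comb[of s 1 v "- 2 * root_form s v" "basis_vec s"] assms
    by (simp add: refl_op_def root_form_basis)
  then show ?thesis by (simp add: refl_op_def[of s "refl_op s v"]) (simp add: refl_op_def)
qed

text \<open>Multiples of the roots of the dihedral subgroup generated by \<open>s\<close> and \<open>t\<close>, by angle.\<close>

definition plane_vec :: "'a \<Rightarrow> 'a \<Rightarrow> real \<Rightarrow> 'a \<Rightarrow> real" where
  "plane_vec s t \<phi> = (\<lambda>x. sin (\<phi> + pi / ord (s \<otimes> t)) * basis_vec s x + sin \<phi> * basis_vec t x)"

text \<open>A reflection exchanges the two generators and advances the angle by \<theta> = pi / m.
  The identity behind it is sin \<phi> + sin (\<phi> + 2 \<theta>) = 2 cos \<theta> sin (\<phi> +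
  \<theta>).\<close>

lemma refl_plane_vec:
  assumes st: "s \<in> S" "t \<in> S"
  shows "refl_op t (plane_vec s t \<phi>) = plane_vec t s (\<phi> + pi / ord (s \<otimes> t))"
proof -
  define \<theta> where "\<theta> = pi / real (ord (s \<otimes> t))"
  define r where "r = root_form t (plane_vec s t \<phi>)"
  have \<theta>': "pi / real (ord (t \<otimes> s)) = \<theta>" by (simp add: \<theta>_def ord_commute[OF st])
  have "root_form t (plane_vec s t \<phi>) = sin (\<phi> + \<theta>) * bil t s + sin \<phi> * bil t t"
    unfolding plane_vec_def root_form_comb \<theta>_def using st by (simp add: root_form_basis)
  then have r: "r = sin \<phi> - cos \<theta> * sin (\<phi> + \<theta>)"
    using st by (simp add: r_def bil_def \<theta>' gens_involution)
  have "sin \<phi> - 2 * r = sin (\<phi> + \<theta> + \<theta>)"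
    using sin_add[of "\<phi> + \<theta>" \<theta>] sin_diff[of "\<phi> + \<theta>" \<theta>] r by (simp add: algebra_simps)
  moreover have "refl_op t (plane_vec s t \<phi>) = (\<lambda>x. plane_vec s t \<phi> x - 2 * r * basis_vec t x)"
    by (simp add: refl_op_def r_def)
  then have "refl_op t (plane_vec s t \<phi>) =
      (\<lambda>x. sin (\<phi> + \<theta>) * basis_vec s x + (sin \<phi> - 2 * r) * basis_vec t x)"
    by (simp add: plane_vec_def \<theta>_def algebra_simps)
  ultimately show ?thesis
    unfolding plane_vec_def[of t s] \<theta>' \<theta>_def[symmetric] by (simp add: add.commute)
qed

lemma refl_refl_plane_vec:
  assumes st: "s \<in> S" "t \<in> S"
  shows "((refl_op s \<circ> refl_op t) ^^ n) (plane_vec s t \<phi>) =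
    plane_vec s t (\<phi> + 2 * n * (pi / ord (s \<otimes> t)))"
proof (induction n)
  case (Suc n)
  then show ?case using st by (simp add: refl_plane_vec ord_commute algebra_simps)
qed simp

text \<open>On the plane of \<open>s\<close> and \<open>t\<close> the power is a rotation by
  \<open>2 * pi\<close>, and vectors orthogonal to both generators do not move. The Gram determinant
  of the plane is the square of sin (pi / m), which is not zero, so every vector is a sum of the two
  kinds.\<close>

lemma refl_op_braid:
  assumes st: "s \<in> S" "t \<in> S"
  shows "(refl_op s \<circ> refl_op t) ^^ ord (s \<otimes> t) = id"
proof (cases "s = t")
  case True
  then show ?thesis using st by (auto simp: gens_involution)
next
  case False
  let ?P = "refl_op s \<circ> refl_op t" and ?m = "ord (s \<otimes> t)"
  let ?\<theta> = "pi / real ?m"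
  have m: "?m \<ge> 2" by (rule ord_gens_ge_2[OF st False])
  then have \<theta>: "0 < ?\<theta>" "?\<theta> < pi" by (simp_all add: field_simps)
  then have sin: "sin ?\<theta> > 0" by (rule sin_gt_zero)
  have lin: "lin_op (?P ^^ ?m)" by (intro lin_op_funpow lin_op_comp lin_op_refl)
  have fix_plane: "(?P ^^ ?m) (plane_vec s t \<phi>) = plane_vec s t \<phi>" for \<phi>
  proof -
    have "\<phi> + 2 * ?m * ?\<theta> = \<phi> + 2 * pi" "\<phi> + 2 * ?m * ?\<theta> + ?\<theta> = \<phi> + ?\<theta> + 2 * pi" using m by auto
    then have "plane_vec s t (\<phi> + 2 * ?m * ?\<theta>) = plane_vec s t \<phi>"
      unfolding plane_vec_def by (simp only: sin_periodic)
    then show ?thesis using refl_refl_plane_vec[OF st] by simp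
  qed
  show ?thesis
  proof
    fix v
    define c where "c = cos ?\<theta>"
    \<comment> \<open>The coefficients solve \<open>a - c * b = root_form s v\<close> and
      \<open>b - c * a = root_form t v\<close>, so that \<open>r = v - u\<close> is orthogonal to
      both generators.\<close>
    define a where "a = (root_form s v + c * root_form t v) / (1 - c\<^sup>2)"
    define b where "b = (root_form t v + c * root_form s v) / (1 - c\<^sup>2)"
    define u where "u = (\<lambda>x. a * basis_vec s x + b * basis_vec t x)"
    define r where "r = (\<lambda>x. 1 * v x + (-1) * u x)"
    have "1 - c\<^sup>2 = (sin ?\<theta>)\<^sup>2" by (simp add: sin_squared_eq c_def)
    then have c: "1 - c\<^sup>2 \<noteq> 0" using sin by simp
    have bil: "bil s t = - c" "bil t s = - c" using st by (simp_all add: bil_def c_def ord_commute)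
    have "root_form s u = a - c * b" "root_form t u = b - c * a"
      unfolding u_def root_form_comb using st bil by (simp_all add: root_form_basis)
    moreover have "a - c * b = root_form s v" "b - c * a = root_form t v"
      unfolding a_def b_def using c by (simp_all add: divide_simps) (simp_all add: algebra_simps power2_eq_square)
    ultimately have "root_form s r = 0" "root_form t r = 0"
      unfolding r_def root_form_comb by simp_all
    then have "refl_op s r = r" "refl_op t r = r" by (simp_all add: refl_op_def)
    then have r: "(?P ^^ n) r = r" for n by (induction n) simp_all
    \<comment> \<open>At the angles \<open>0\<close> and \<open>- ?\<theta>\<close> one of the two
      sines vanishes, leaving multiples of the basis vectors.\<close>
    have "u = (\<lambda>x. (a / sin ?\<theta>) * plane_vec s t 0 x + (- b / sin ?\<theta>) * plane_vec s t (- ?\<theta>) x)"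
      using sin unfolding u_def plane_vec_def by simp
    then have u: "(?P ^^ ?m) u = u"
      by (simp only: lin_op_comb[OF lin] fix_plane)
    have v: "v = (\<lambda>x. 1 * r x + 1 * u x)" by (simp add: r_def)
    have "(?P ^^ ?m) (\<lambda>x. 1 * r x + 1 * u x) = (\<lambda>x. 1 * r x + 1 * u x)"
      by (simp only: lin_op_comb[OF lin] r u)
    then show "(?P ^^ ?m) v = id v" by (simp only: v[symmetric] id_apply)
  qed
qed

section \<open>The representation on group elements\<close>

definition rho_word :: "'a list \<Rightarrow> ('a \<Rightarrow> real) \<Rightarrow> 'a \<Rightarrow> real" where
  "rho_word ws = foldr (\<lambda>s F. refl_op s \<circ> F) ws id"

lemma rho_word_append: "rho_word (us @ vs) = rho_word us \<circ> rho_word vs"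
  by (induction us) (simp_all add: rho_word_def comp_assoc)

lemma rho_word_eq:
  assumes "us \<in> lists S" "vs \<in> lists S" "word_val W us = word_val W vs"
  shows "rho_word us = rho_word vs"
proof (rule word_invariant[OF assms])
  fix xs ys s t assume st: "s \<in> S" "t \<in> S"
  have "rho_word (concat (replicate n [s, t])) = (refl_op s \<circ> refl_op t) ^^ n" for n
    by (induction n) (simp_all add: rho_word_def comp_assoc id_def)
  then show "rho_word (xs @ concat (replicate (ord (s \<otimes> t)) [s, t]) @ ys) = rho_word (xs @ ys)"
    using refl_op_braid[OF st] by (simp add: rho_word_append)
qed

definition rho :: "'a \<Rightarrow> ('a \<Rightarrow> real) \<Rightarrow> 'a \<Rightarrow> real" where
  "rho w = rho_word (SOME ws. ws \<in> lists S \<and> word_val W ws = w)"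

lemma rho_word_val: "ws \<in> lists S \<Longrightarrow> rho (word_val W ws) = rho_word ws"
proof -
  assume ws: "ws \<in> lists S"
  let ?Q = "\<lambda>u. u \<in> lists S \<and> word_val W u = word_val W ws"
  have "?Q (SOME u. ?Q u)" using ws by (intro someI[of ?Q ws]) simp
  then show ?thesis unfolding rho_def by (intro rho_word_eq ws) blast+
qed

lemma rho_mult:
  assumes "u \<in> carrier W" "v \<in> carrier W" shows "rho (u \<otimes> v) = rho u \<circ> rho v"
proof -
  obtain us vs where "us \<in> lists S" "word_val W us = u" "vs \<in> lists S" "word_val W vs = v"
    using assms ex_word by metis
  then show ?thesis
    using rho_word_val[of us] rho_word_val[of vs] rho_word_val[of "us @ vs"]
    by (simp add: word_val_append rho_word_append)
qed

lemma rho_one: "rho \<one> = id"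
  using rho_word_val[of "[]"] by (simp add: rho_word_def)

lemma rho_gen: "s \<in> S \<Longrightarrow> rho s = refl_op s"
  using rho_word_val[of "[s]"] by (simp add: rho_word_def)

lemma rho_induct [consumes 1, case_names id comp]:
  assumes "w \<in> carrier W" "P id" "\<And>s F. s \<in> S \<Longrightarrow> P F \<Longrightarrow> P (refl_op s \<circ> F)"
  shows "P (rho w)"
proof -
  obtain ws where "ws \<in> lists S" "word_val W ws = w" using assms ex_word by metis
  moreover have "ws \<in> lists S \<Longrightarrow> P (rho_word ws)" for ws
    using assms(2,3) by (induction ws) (auto simp: rho_word_def)
  ultimately show ?thesis using rho_word_val by metis
qed

lemma lin_op_rho: "w \<in> carrier W \<Longrightarrow> lin_op (rho w)"
  by (induction rule: rho_induct) (rule lin_op_id, rule lin_op_comp[OF lin_op_refl])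

text \<open>A reflection changes only its own coordinate. Hence the diagonal entries of
  \<open>wlong J\<close> times a permutation are, outside \<open>J\<close>, those of the
  permutation.\<close>

lemma rho_outside:
  assumes J: "J \<subseteq> S" and w: "w \<in> generate W J" and x: "x \<notin> J"
  shows "rho w v x = v x"
proof -
  obtain ws where ws: "ws \<in> lists J" "word_val W ws = w" using reduced_word_parabolic[OF J w] .
  have "rho_word ws v x = v x"
    using ws(1)
  proof (induction ws)
    case (Cons a ws)
    then have "x \<noteq> a" using x by auto
    then show ?case using Cons by (simp add: rho_word_def refl_op_def)
  qed (simp add: rho_word_def)
  then show ?thesis using rho_word_val[OF subsetD[OF lists_mono[OF J] ws(1)]] ws(2) by simp
qed

lemma supported_rho: "w \<in> carrier W \<Longrightarrow> supported S v \<Longrightarrow> supported S (rho w v)"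
  using rho_outside[of S w] by (simp add: supported_def gens_generate)

text \<open>With \<open>x = s t\<close> of order \<open>m\<close>, the element is \<open>x^j\<close>
  or \<open>x^j s\<close> with \<open>j < m\<close>. Reading it directly and through its inverse
  bounds the length by \<open>2 j\<close> and \<open>2 (m - j)\<close> in the first case, by
  \<open>2 j + 1\<close> and \<open>2 (m - j) - 1\<close> in the second. Each pair has sum
  \<open>2 m\<close>, so the smaller bound is at most \<open>m\<close>.\<close>

lemma len_dihedral:
  assumes st: "s \<in> S" "t \<in> S" and a: "a \<in> generate W {s, t}"
  shows "len a \<le> ord (s \<otimes> t)"
proof -
  let ?x = "s \<otimes> t" and ?m = "ord (s \<otimes> t)"
  have J: "{s, t} \<subseteq> S" and x: "?x \<in> carrier W" using st by auto
  have m: "?m > 0" using ord_gens_pos st by blast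
  have pm: "?x [^] (i + ?m) = ?x [^] i" for i :: nat
    using x by (simp flip: nat_pow_mult)
  \<comment> \<open>The reversal lets an induction on lists append letters on the right.\<close>
  have form: "\<exists>i :: nat. word_val W (rev ws) = ?x [^] i \<or> word_val W (rev ws) = ?x [^] i \<otimes> s"
    if "ws \<in> lists {s, t}" for ws
    using that
  proof (induction ws)
    case Nil
    show ?case by (intro exI[of _ 0]) simp
  next
    case (Cons r ws)
    then have r: "r = s \<or> r = t" and ws: "rev ws \<in> lists S" "[r] \<in> lists S" using st by auto
    have val: "word_val W (rev (r # ws)) = word_val W (rev ws) \<otimes> r"
      using word_val_append[OF ws] ws(2) by simp
    obtain i :: nat where i: "word_val W (rev ws) = ?x [^] i \<or> word_val W (rev ws) = ?x [^] i \<otimes> s"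
      using Cons.IH by blast
    \<comment> \<open>The exponent \<open>i - 1\<close> is raised by the order to remain a natural
      number when \<open>i\<close> is 0.\<close>
    have "?x [^] i = ?x [^] Suc (i + ?m - 1)" using pm[of i] m by simp
    also have "\<dots> = ?x [^] (i + ?m - 1) \<otimes> ?x" by simp
    finally have t: "?x [^] i \<otimes> t = ?x [^] (i + ?m - 1) \<otimes> s" using st by (simp add: m_assoc gens_involution)
    have s: "?x [^] i \<otimes> s \<otimes> s = ?x [^] i" using st by (simp add: m_assoc gens_involution)
    have st': "?x [^] i \<otimes> s \<otimes> t = ?x [^] Suc i" using st by (simp add: m_assoc)
    from r i show ?case unfolding val using t s st' by metis
  qed
  obtain ws where ws: "ws \<in> lists {s, t}" "word_val W ws = a"
    using reduced_word_parabolic[OF J a] by metis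
  have "rev ws \<in> lists {s, t}" using ws(1) by auto
  then obtain i :: nat where i: "a = ?x [^] i \<or> a = ?x [^] i \<otimes> s"
    using form[of "rev ws"] ws by auto
  define j where "j = i mod ?m"
  have "?x [^] i = ?x [^] (j + ?m * (i div ?m))" by (simp add: j_def)
  also have "\<dots> = ?x [^] j" using x by (simp flip: nat_pow_mult nat_pow_pow)
  finally have j: "j < ?m" "a = ?x [^] j \<or> a = ?x [^] j \<otimes> s" using i m by (auto simp: j_def)
  have lp: "len (?x [^] n) \<le> 2 * n" for n :: nat
  proof (induction n)
    case (Suc n)
    then show ?case using len_mult_le[of "?x [^] n" ?x] len_mult_le[of s t] st by simp
  qed simp
  define k where "k = ?m - j"
  have "?x [^] k \<otimes> ?x [^] j = \<one>" using j(1) x by (simp add: k_def nat_pow_mult)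
  then have inv: "inv (?x [^] j) = ?x [^] k" using x by (intro inv_equality) auto
  from j(2) show ?thesis
  proof
    assume "a = ?x [^] j"
    then have "len a \<le> 2 * j" "len a \<le> 2 * k" using lp[of j] lp[of k] inv len_inv[of "?x [^] j"] x by simp_all
    then show ?thesis using j(1) by (simp add: k_def)
  next
    assume a: "a = ?x [^] j \<otimes> s"
    have k: "k = Suc (k - 1)" using j(1) by (simp add: k_def)
    have "inv a = s \<otimes> ?x [^] k" using a st inv by (simp add: inv_mult_group)
    also have "\<dots> = s \<otimes> (?x \<otimes> ?x [^] (k - 1))" using k x by (metis nat_pow_Suc2)
    also have "\<dots> = t \<otimes> ?x [^] (k - 1)" using st by (simp add: m_assoc)
    finally have "len (inv a) \<le> 1 + 2 * (k - 1)"
      using len_mult_le[of t "?x [^] (k - 1)"] lp[of "k - 1"] st by simp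
    moreover have "len (inv a) = len a" using a st by simp
    moreover have "len a \<le> 2 * j + 1" using a len_mult_le[of "?x [^] j" s] lp[of j] st by simp
    ultimately show ?thesis using j(1) by (simp add: k_def)
  qed
qed

text \<open>Since \<open>a\<close> does not end in \<open>s\<close>, its last letter is
  \<open>t\<close>; stripping it exchanges the roles of the generators and advances the angle by one
  step. The two alternatives correspond to the parity of \<open>len a\<close>.\<close>

lemma rho_plane_vec:
  assumes "s \<in> S" "t \<in> S" "a \<in> generate W {s, t}" "len a < len (a \<otimes> s)"
  shows "rho a (plane_vec s t \<phi>) \<in>
    {plane_vec s t (\<phi> + len a * (pi / ord (s \<otimes> t))), plane_vec t s (\<phi> + len a * (pi / ord (s \<otimes> t)))}"
  using assms
proof (induction "len a" arbitrary: a s t \<phi>)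
  case 0
  have "a \<in> carrier W" by (rule parabolic_closed[of "{s, t}"]) (use 0 in simp_all)
  then have "a = \<one>" using 0(1) len_eq_0[of a] by simp
  then show ?case by (simp add: rho_one)
next
  case (Suc k)
  have J: "{s, t} \<subseteq> S" using Suc.prems by simp
  have ac: "a \<in> carrier W" using parabolic_closed[OF J] Suc.prems by blast
  have "a \<noteq> \<one>" using Suc.hyps(2) by auto
  then obtain r where r: "r \<in> {s, t}" "len (a \<otimes> r) < len a"
    by (rule ex_right_descent[OF J Suc.prems(3)])
  then have at: "len (a \<otimes> t) < len a" using Suc.prems(4) by auto
  define b where "b = a \<otimes> t"
  have bc: "b \<in> carrier W" using ac Suc.prems by (simp add: b_def)
  have a: "a = b \<otimes> t" using ac Suc.prems by (simp add: b_def m_assoc gens_involution)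
  have lb: "k = len b" using at len_mult_gen[OF Suc.prems(2) ac] Suc.hyps(2) by (simp add: b_def)
  have b1: "b \<in> generate W {t, s}"
    unfolding b_def using generate.eng[OF Suc.prems(3) generate.incl[of t]] by (simp add: insert_commute)
  have b2: "len b < len (b \<otimes> t)" using at by (simp only: a[symmetric] b_def[symmetric])
  have IH: "rho b (plane_vec t s \<psi>) \<in>
    {plane_vec t s (\<psi> + len b * (pi / ord (t \<otimes> s))), plane_vec s t (\<psi> + len b * (pi / ord (t \<otimes> s)))}" for \<psi>
    by (rule Suc.hyps(1)[OF lb Suc.prems(2,1) b1 b2])
  have e1: "rho a (plane_vec s t \<phi>) = rho b (plane_vec t s (\<phi> + pi / ord (s \<otimes> t)))"
    using a rho_mult[OF bc, of t] Suc.prems by (simp add: rho_gen refl_plane_vec)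
  have e2: "\<phi> + pi / ord (s \<otimes> t) + len b * (pi / ord (t \<otimes> s)) = \<phi> + len a * (pi / ord (s \<otimes> t))"
    using ord_commute[OF Suc.prems(1,2)] lb Suc.hyps(2)[symmetric] by (simp add: algebra_simps add_divide_distrib)
  show ?case using IH[of "\<phi> + pi / ord (s \<otimes> t)"] unfolding e1 e2 by blast
qed

text \<open>The basis vector is the vector of angle 0 divided by \<open>sin \<theta>\<close>. By
  \<open>len_dihedral\<close> one has \<open>len a + 1 \<le> m\<close>, so the angles
  \<open>len a * \<theta>\<close> and \<open>len a * \<theta> + \<theta>\<close> stay in the
  interval from 0 to \<open>pi\<close>, where the sine is nonnegative.\<close>

lemma rho_dihedral_nonneg:
  assumes st: "s \<in> S" "t \<in> S" "s \<noteq> t" and a: "a \<in> generate W {s, t}" "len a < len (a \<otimes> s)"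
  obtains p q where "p \<ge> 0" "q \<ge> 0" "rho a (basis_vec s) = (\<lambda>x. p * basis_vec s x + q * basis_vec t x)"
proof -
  let ?m = "ord (s \<otimes> t)"
  define \<theta> where "\<theta> = pi / ?m"
  have J: "{s, t} \<subseteq> S" using st by simp
  have ac: "a \<in> carrier W" using parabolic_closed[OF J a(1)] .
  have m: "?m \<ge> 2" by (rule ord_gens_ge_2[OF st])
  have "len (a \<otimes> s) \<le> ?m" using len_dihedral[OF st(1,2) generate.eng[OF a(1) generate.incl]] by simp
  then have k: "len a + 1 \<le> ?m" using a(2) by simp
  have \<theta>: "0 < \<theta>" "\<theta> < pi" using m by (simp_all add: \<theta>_def field_simps)
  have bound: "n * \<theta> \<le> pi" if "n \<le> ?m" for n :: nat
  proof -
    have "n * \<theta> \<le> ?m * \<theta>" using that \<theta> by (intro mult_right_mono) auto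
    then show ?thesis using m by (simp add: \<theta>_def)
  qed
  have s1: "sin (len a * \<theta>) \<ge> 0" using bound[of "len a"] k \<theta> by (intro sin_ge_zero) auto
  have s2: "sin (len a * \<theta> + \<theta>) \<ge> 0"
    using bound[of "len a + 1"] k \<theta> by (intro sin_ge_zero) (auto simp: algebra_simps)
  have s: "sin \<theta> > 0" using \<theta> by (rule sin_gt_zero)
  have "basis_vec s = (\<lambda>x. (1 / sin \<theta>) * plane_vec s t 0 x)"
    using s by (simp add: plane_vec_def \<theta>_def)
  then have "rho a (basis_vec s) = (\<lambda>x. (1 / sin \<theta>) * rho a (plane_vec s t 0) x)"
    using lin_op_scale[OF lin_op_rho[OF ac], of "1 / sin \<theta>" "plane_vec s t 0"] by simp
  moreover have "\<exists>p q. p \<ge> 0 \<and> q \<ge> 0 \<and> rho a (plane_vec s t 0) = (\<lambda>x. p * basis_vec s x + q * basis_vec t x)"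
  proof -
    have eqs: "plane_vec s t (len a * \<theta>) = (\<lambda>x. sin (len a * \<theta> + \<theta>) * basis_vec s x + sin (len a * \<theta>) * basis_vec t x)"
      "plane_vec t s (len a * \<theta>) = (\<lambda>x. sin (len a * \<theta>) * basis_vec s x + sin (len a * \<theta> + \<theta>) * basis_vec t x)"
      using ord_commute[OF st(1,2)] by (simp_all add: plane_vec_def \<theta>_def add.commute)
    have "rho a (plane_vec s t 0) = plane_vec s t (len a * \<theta>) \<or> rho a (plane_vec s t 0) = plane_vec t s (len a * \<theta>)"
      using rho_plane_vec[OF st(1,2) a, of 0] by (simp add: \<theta>_def)
    then show ?thesis unfolding eqs using s1 s2 by blast
  qed
  ultimately have "\<exists>p q. p \<ge> 0 \<and> q \<ge> 0 \<and> rho a (basis_vec s) = (\<lambda>x. (1 / sin \<theta>) * (p * basis_vec s x + q * basis_vec t x))"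
    by metis
  then obtain p q where pq: "p \<ge> 0" "q \<ge> 0"
    "rho a (basis_vec s) = (\<lambda>x. (1 / sin \<theta>) * (p * basis_vec s x + q * basis_vec t x))" by blast
  show thesis
  proof (rule that[of "p / sin \<theta>" "q / sin \<theta>"])
    show "rho a (basis_vec s) = (\<lambda>x. p / sin \<theta> * basis_vec s x + q / sin \<theta> * basis_vec t x)"
      unfolding pq(3) by (simp add: add_divide_distrib)
  qed (use pq s in simp_all)
qed

text \<open>Pick a right descent \<open>t\<close> of \<open>w\<close> and write
  \<open>w = v \<otimes> a\<close> with \<open>v\<close> shortest in the coset modulo the subgroup
  generated by \<open>s\<close> and \<open>t\<close>. The rank two case expresses the image under
  \<open>a\<close> by both basis vectors with nonnegative coefficients, and induction applies to
  \<open>v\<close> on each of them.\<close>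

lemma rho_basis_nonneg:
  assumes "w \<in> carrier W" "s \<in> S" "len w < len (w \<otimes> s)"
  shows "rho w (basis_vec s) x \<ge> 0"
  using assms
proof (induction "len w" arbitrary: w s rule: less_induct)
  case less
  note w = less.prems(1) and s = less.prems(2)
  show ?case
  proof (cases "w = \<one>")
    case True
    then show ?thesis by (simp add: rho_one basis_vec_def)
  next
    case False
    then obtain t where t: "t \<in> S" "len (w \<otimes> t) < len w"
      using ex_right_descent[of S w] w gens_generate by blast
    have st: "s \<noteq> t" using t less.prems by auto
    have J: "{s, t} \<subseteq> S" using s t by simp
    define P where "P v \<longleftrightarrow> v \<in> carrier W \<and> (\<exists>a\<in>generate W {s, t}. w = v \<otimes> a)" for v
    have step: "P (v \<otimes> r)" if v: "P v" and r: "r \<in> {s, t}" for v r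
    proof -
      obtain a where a: "a \<in> generate W {s, t}" "w = v \<otimes> a" "v \<in> carrier W" using v by (auto simp: P_def)
      have rS: "r \<in> S" using r J by blast
      have "w = (v \<otimes> r) \<otimes> (r \<otimes> a)" using a rS parabolic_closed[OF J a(1)] by (simp add: m_assoc)
      moreover have "r \<otimes> a \<in> generate W {s, t}" using generate.eng[OF generate.incl[OF r] a(1)] .
      ultimately show ?thesis using a rS by (auto simp: P_def)
    qed
    have Pw: "P w" using w generate.one[of W "{s, t}"] by (auto simp: P_def intro!: bexI[of _ \<one>])
    obtain v where v: "P v" and min: "\<And>u. P u \<Longrightarrow> len v \<le> len u"
      using ex_has_least_nat[of P w len] Pw by blast
    obtain a where a: "a \<in> generate W {s, t}" "w = v \<otimes> a" and vc: "v \<in> carrier W" using v by (auto simp: P_def)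
    have ac: "a \<in> carrier W" using parabolic_closed[OF J a(1)] .
    have vr: "len v < len (v \<otimes> r)" if "r \<in> {s, t}" for r
      using min[OF step[OF v that]] len_mult_gen[of r v] J that vc by fastforce
    have add: "len (v \<otimes> b) = len v + len b" if "b \<in> generate W {s, t}" for b
      by (rule len_mult_parabolic[OF J that vc vr])
    \<comment> \<open>Removing the descent \<open>t\<close> already gives a shorter member of the
      coset, so the induction hypothesis covers \<open>v\<close>.\<close>
    have lv: "len v < len w" using min[OF step[OF Pw, of t]] t by simp
    have "w \<otimes> s = v \<otimes> (a \<otimes> s)" using a(2) vc ac s by (simp add: m_assoc)
    then have "len (w \<otimes> s) = len v + len (a \<otimes> s)"
      using add[OF generate.eng[OF a(1) generate.incl]] by simp
    then have as: "len a < len (a \<otimes> s)" using less.prems(3) add[OF a(1)] a(2) by simp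
    obtain p q where pq: "p \<ge> 0" "q \<ge> 0"
      "rho a (basis_vec s) = (\<lambda>x. p * basis_vec s x + q * basis_vec t x)"
      using rho_dihedral_nonneg[OF s t(1) st a(1) as] .
    have "rho w (basis_vec s) = (\<lambda>x. p * rho v (basis_vec s) x + q * rho v (basis_vec t) x)"
      unfolding a(2) rho_mult[OF vc ac] comp_apply pq(3) by (rule lin_op_comb[OF lin_op_rho[OF vc]])
    then show ?thesis
      using pq(1,2) less.hyps[OF lv vc s] less.hyps[OF lv vc t(1)] vr by simp
  qed
qed

end

section \<open>Twisted traces\<close>

context twisted_coxeter_system
begin

text \<open>Substituting \<open>\<sigma>\<close> for its inverse is correct because
  \<open>\<sigma>\<close> is an involution. Outside \<open>S\<close>, where \<open>\<sigma>\<close>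
  is \<open>undefined\<close>, coordinates are kept.\<close>

definition perm_op :: "('a \<Rightarrow> real) \<Rightarrow> 'a \<Rightarrow> real" where
  "perm_op v = (\<lambda>x. if x \<in> S then v (\<sigma> x) else v x)"

lemma lin_op_perm: "lin_op perm_op"
  by (auto simp: lin_op_def perm_op_def)

lemma supported_perm: "supported S v \<Longrightarrow> supported S (perm_op v)"
  by (simp add: supported_def perm_op_def)

lemma perm_op_basis: "s \<in> S \<Longrightarrow> perm_op (basis_vec s) = basis_vec (\<sigma> s)"
  using involutive by (fastforce simp: perm_op_def basis_vec_def)

lemma perm_op_refl_op:
  assumes s: "s \<in> S" shows "perm_op (refl_op s v) = refl_op (\<sigma> s) (perm_op v)"
proof -
  have "root_form (\<sigma> s) (perm_op v) = (\<Sum>y\<in>S. bil (\<sigma> s) y * v (\<sigma> y))"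
    unfolding root_form_def by (simp add: perm_op_def)
  also have "\<dots> = (\<Sum>y\<in>S. bil (\<sigma> s) (\<sigma> y) * v y)"
    by (rule sum.reindex_bij_witness[of _ \<sigma> \<sigma>]) (auto simp: involutive)
  also have "\<dots> = root_form s v"
    unfolding root_form_def using s by (intro sum.cong) (auto simp: bil_def graph_aut_ord(2)[OF graph_aut])
  finally have "root_form (\<sigma> s) (perm_op v) = root_form s v" .
  then show ?thesis
    using lin_op_comb[OF lin_op_perm, of 1 v "- 2 * root_form s v" "basis_vec s"] s
    by (simp add: refl_op_def perm_op_basis)
qed

text \<open>Conjugation by the permutation realises \<open>tw\<close>, so \<open>rho\<close> and
  \<open>perm_op\<close> together represent the group extended by \<open>\<sigma>\<close>.\<close>

lemma perm_op_rho:
  assumes "w \<in> carrier W" shows "perm_op (rho w v) = rho (tw w) (perm_op v)"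
proof -
  obtain ws where ws: "ws \<in> lists S" "word_val W ws = w" using ex_word[OF assms] by blast
  from ws(1) have "perm_op (rho (word_val W ws) v) = rho (tw (word_val W ws)) (perm_op v)"
  proof (induction ws)
    case (Cons a ws)
    then have "a \<in> S" "word_val W ws \<in> carrier W" using word_val_closed by auto
    then show ?case using Cons.IH by (simp add: rho_mult rho_gen perm_op_refl_op)
  qed (simp add: rho_one)
  then show ?thesis using ws by simp
qed

text \<open>Here \<open>w\<^sub>J \<sigma>\<close> sends \<open>e\<^sub>s\<close> to a multiple of itself because \<open>s\<close> reverses the image; the multiple
  is \<open>1\<close> or \<open>-1\<close> because \<open>w\<^sub>J \<sigma>\<close> is an involution, and positivity leaves \<open>-1\<close>.\<close>

lemma rho_admissible_basis:
  assumes J: "admissible J" and s: "s \<in> J"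
  shows "rho (wlong J) (basis_vec (\<sigma> s)) = (\<lambda>x. - basis_vec s x)"
proof -
  have JS: "J \<subseteq> S" and sS: "s \<in> S" using J s admissible_subset by auto
  have wc: "wlong J \<in> carrier W" using JS by simp
  have ss: "\<sigma> s \<in> J" using J s admissible_image by blast
  let ?u = "rho (wlong J) (basis_vec (\<sigma> s))"
  have neg: "rho (wlong J) (\<lambda>x. - v x) = (\<lambda>x. - rho (wlong J) v x)" for v
    by (rule lin_op_uminus[OF lin_op_rho[OF wc]])
  have "refl_op s ?u = rho (s \<otimes> wlong J) (basis_vec (\<sigma> s))"
    using rho_mult[of s "wlong J"] sS wc by (simp add: rho_gen)
  also have "\<dots> = rho (wlong J \<otimes> \<sigma> s) (basis_vec (\<sigma> s))"
    by (simp add: admissible_commute[OF J s])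
  also have "\<dots> = rho (wlong J) (refl_op (\<sigma> s) (basis_vec (\<sigma> s)))"
    using rho_mult[of "wlong J" "\<sigma> s"] sS wc by (simp add: rho_gen)
  also have "\<dots> = (\<lambda>x. - ?u x)" using sS by (simp add: refl_op_basis neg)
  finally have refl: "refl_op s ?u = (\<lambda>x. - ?u x)" .
  have zero: "?u x = 0" if "x \<noteq> s" for x
    using fun_cong[OF refl, of x] that by (simp add: refl_op_def)
  define c where "c = ?u s"
  have u: "?u = (\<lambda>x. c * basis_vec s x)"
    using zero by (auto simp: c_def basis_vec_def)
  have twJ: "tw (wlong J) = wlong J" by (rule tw_longest[OF JS admissible_image[OF J]])
  have "perm_op ?u = rho (wlong J) (basis_vec s)"
    using perm_op_rho[OF wc] twJ sS by (simp add: perm_op_basis involutive)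
  moreover have "perm_op ?u = (\<lambda>x. c * basis_vec (\<sigma> s) x)"
    unfolding u using lin_op_scale[OF lin_op_perm] sS by (simp add: perm_op_basis)
  ultimately have "rho (wlong J) (basis_vec s) = (\<lambda>x. c * basis_vec (\<sigma> s) x)" by simp
  then have "rho (wlong J) (rho (wlong J) (basis_vec s)) = (\<lambda>x. c * ?u x)"
    by (simp only: lin_op_scale[OF lin_op_rho[OF wc]])
  moreover have "rho (wlong J) (rho (wlong J) (basis_vec s)) = basis_vec s"
    using fun_cong[OF rho_mult[OF wc wc], of "basis_vec s"] JS by (simp add: rho_one)
  ultimately have "basis_vec s = (\<lambda>x. c * ?u x)" by (rule trans[OF sym, rotated])
  from fun_cong[OF this, of s] have "c * c = 1" by (simp add: c_def)
  moreover have "c \<le> 0"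
  proof -
    \<comment> \<open>Positivity is used for \<open>wlong J \<otimes> \<sigma> s\<close>, of which
      \<open>\<sigma> s\<close> is an ascent; it sends the basis vector to the negative of
      \<open>?u\<close>.\<close>
    have g: "wlong J \<otimes> \<sigma> s \<in> carrier W" using wc sS by simp
    have "len (wlong J \<otimes> \<sigma> s) < len (wlong J)"
      using len_longest_mult(1)[OF JS generate.incl[OF ss]] sS by simp
    then have pos: "rho (wlong J \<otimes> \<sigma> s) (basis_vec (\<sigma> s)) s \<ge> 0"
      using sS wc by (intro rho_basis_nonneg) (simp_all add: m_assoc gens_involution)
    have "rho (wlong J \<otimes> \<sigma> s) (basis_vec (\<sigma> s)) = (\<lambda>x. - ?u x)"
      using rho_mult[of "wlong J" "\<sigma> s"] sS wc by (simp add: rho_gen refl_op_basis neg)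
    then show ?thesis using pos by (simp add: c_def)
  qed
  ultimately have "c = -1" by (simp add: square_eq_1_iff)
  then show ?thesis using u by simp
qed

definition twisted_trace :: "'a \<Rightarrow> real" where
  "twisted_trace w = op_trace S (rho w \<circ> perm_op)"

text \<open>In the extended group the twisted conjugate of \<open>w\<close>, followed by \<sigma>,
  is the ordinary conjugate of \<open>w \<sigma>\<close> by \<open>v\<close>; the trace is
  cyclic.\<close>

lemma twisted_trace_conj:
  assumes w: "w \<in> carrier W" and v: "v \<in> carrier W"
  shows "twisted_trace (inv v \<otimes> w \<otimes> tw v) = twisted_trace w"
proof -
  have "rho (inv v \<otimes> w \<otimes> tw v) \<circ> perm_op = (rho (inv v) \<circ> (rho w \<circ> perm_op)) \<circ> rho v"
    using w v by (auto simp: rho_mult perm_op_rho)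
  moreover have "rho v \<circ> (rho (inv v) \<circ> (rho w \<circ> perm_op)) = rho w \<circ> perm_op"
    using rho_mult[of v "inv v"] v rho_one by (simp flip: comp_assoc)
  moreover have "lin_op (rho (inv v) \<circ> (rho w \<circ> perm_op))"
    using w v by (intro lin_op_comp lin_op_rho lin_op_perm) simp_all
  then have "op_trace S ((rho (inv v) \<circ> (rho w \<circ> perm_op)) \<circ> rho v) =
      op_trace S (rho v \<circ> (rho (inv v) \<circ> (rho w \<circ> perm_op)))"
    using w v by (intro op_trace_comm) (simp_all add: lin_op_rho supported_rho supported_perm)
  ultimately show ?thesis by (simp add: twisted_trace_def)
qed

lemma twisted_trace_admissible:
  assumes J: "admissible J"
  shows "twisted_trace (wlong J) = real (card {s \<in> S - J. \<sigma> s = s}) - real (card J)"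
proof -
  have JS: "J \<subseteq> S" using J admissible_subset by blast
  have fin: "finite J" using finite_subset[OF JS] by simp
  have "twisted_trace (wlong J) = (\<Sum>s\<in>S. rho (wlong J) (basis_vec (\<sigma> s)) s)"
    unfolding twisted_trace_def op_trace_def by (simp add: perm_op_basis)
  also have "\<dots> = (\<Sum>s\<in>S - J. rho (wlong J) (basis_vec (\<sigma> s)) s) + (\<Sum>s\<in>J. rho (wlong J) (basis_vec (\<sigma> s)) s)"
    by (rule sum.subset_diff[OF JS]) simp
  also have "(\<Sum>s\<in>J. rho (wlong J) (basis_vec (\<sigma> s)) s) = (\<Sum>s\<in>J. - 1)"
    by (intro sum.cong) (simp_all add: rho_admissible_basis[OF J])
  also have "(\<Sum>s\<in>S - J. rho (wlong J) (basis_vec (\<sigma> s)) s) = (\<Sum>s\<in>S - J. if \<sigma> s = s then 1 else 0)"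
    by (intro sum.cong) (auto simp: rho_outside[OF JS longest_in[OF JS]] basis_vec_def)
  also have "\<dots> = real (card {s \<in> S - J. \<sigma> s = s})"
    by (simp add: sum.If_cases Int_def)
  finally show ?thesis by simp
qed

end

context finite_coxeter_system
begin

lemma identity_twisted: "twisted_coxeter_system W S (\<lambda>s\<in>S. s)"
proof unfold_locales
  have "bij_betw (\<lambda>s\<in>S. s) S S" by (auto simp: bij_betw_def inj_on_def)
  then show "(\<lambda>s\<in>S. s) \<in> graph_aut (cox_graph W S)"
    by (auto simp: graph_aut_def cox_graph_def Bij_def)
qed simp

lemma sigma0_twisted: "twisted_coxeter_system W S s0"
proof -
  interpret I: twisted_coxeter_system W S "\<lambda>s\<in>S. s" by (rule identity_twisted)
  have "times_sigma0 W S (\<lambda>s\<in>S. s) = s0"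
    by (auto simp: times_sigma0_def compose_def sigma0_def)
  then show ?thesis using I.twisted_tau by simp
qed

text \<open>For the automorphism \<open>s0\<close> the whole of \<open>S\<close> is admissible,
  which makes the longest element a case of \<open>rho_admissible_basis\<close>.\<close>

lemma rho_w0_basis:
  assumes "s \<in> S" shows "rho (wlong S) (basis_vec (s0 s)) = (\<lambda>x. - basis_vec s x)"
proof -
  interpret Z: twisted_coxeter_system W S s0 by (rule sigma0_twisted)
  have "Z.admissible S" by (simp add: Z.admissible_def sigma0_eq)
  then show ?thesis using assms by (rule Z.rho_admissible_basis)
qed

end

context twisted_coxeter_system
begin

interpretation tau: twisted_coxeter_system W S tau
  by (rule twisted_tau)

text \<open>The permutation of \<open>tau\<close> moves the index \<open>s\<close> to
  \<open>s0 (\<sigma> s)\<close>, and \<open>wlong S\<close> sends that basis vector to minus the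
  one at \<open>\<sigma> s\<close>.\<close>

lemma twisted_trace_w0:
  assumes w: "w \<in> carrier W"
  shows "tau.twisted_trace (w \<otimes> wlong S) = - twisted_trace w"
proof -
  have "(rho (w \<otimes> wlong S) \<circ> tau.perm_op) (basis_vec s) = (\<lambda>x. - (rho w \<circ> perm_op) (basis_vec s) x)" if "s \<in> S" for s
    using that w lin_op_uminus[OF lin_op_rho[OF w]]
    by (simp add: tau.perm_op_basis perm_op_basis rho_mult tau_eq rho_w0_basis)
  then show ?thesis
    unfolding tau.twisted_trace_def twisted_trace_def op_trace_def by (simp flip: sum_negf)
qed

lemma card_fixed_balance:
  assumes J: "admissible J" and J': "tau.admissible J'"
    and conj: "wlong J' \<otimes> wlong S \<in> twisted_class W S \<sigma> (wlong J)"
  shows "card {s \<in> S - J. \<sigma> s = s} + card {s \<in> S - J'. tau s = s} = card J + card J'"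
proof -
  have JS: "J \<subseteq> S" "J' \<subseteq> S" using J J' admissible_subset tau.admissible_subset by auto
  obtain v where v: "v \<in> carrier W" "wlong J' \<otimes> wlong S = inv v \<otimes> wlong J \<otimes> tw v"
    using conj unfolding twisted_class_def by blast
  have "wlong J' = (wlong J' \<otimes> wlong S) \<otimes> wlong S" using JS by (simp add: m_assoc)
  then have "tau.twisted_trace (wlong J') = - twisted_trace (wlong J' \<otimes> wlong S)"
    using twisted_trace_w0[of "wlong J' \<otimes> wlong S"] JS by simp
  also have "\<dots> = - twisted_trace (wlong J)" unfolding v(2) using v JS by (simp add: twisted_trace_conj)
  finally have "real (card {s \<in> S - J. \<sigma> s = s} + card {s \<in> S - J'. tau s = s}) = real (card J + card J')"
    using twisted_trace_admissible[OF J] tau.twisted_trace_admissible[OF J'] by simp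
  then show ?thesis by (simp only: of_nat_eq_iff)
qed

end

section \<open>Counting the orbits of an involution\<close>

lemma orbit_involution:
  assumes "x \<in> V" "\<And>y. y \<in> V \<Longrightarrow> f (f y) = y" shows "orbit f x = {x, f x}"
proof
  show "orbit f x \<subseteq> {x, f x}"
  proof
    fix y assume "y \<in> orbit f x"
    then show "y \<in> {x, f x}" by induction (use assms in auto)
  qed
  \<comment> \<open>An orbit is generated from \<open>f x\<close>, so \<open>x\<close> itself is
    reached only at the second step.\<close>
  have "f (f x) \<in> orbit f x" by (intro orbit.intros)
  then show "{x, f x} \<subseteq> orbit f x" using assms by (auto intro: orbit.intros)
qed

text \<open>Give fixed points weight 2 and all other points weight 1; then every orbit has weight
  2.\<close>

lemma card_orbits_involution:
  assumes fin: "finite V" and f: "\<And>x. x \<in> V \<Longrightarrow> f x \<in> V" "\<And>x. x \<in> V \<Longrightarrow> f (f x) = x"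
    and K: "K \<subseteq> V" "f ` K \<subseteq> K"
  shows "2 * card (orbits_in V f K) = card K + card {x \<in> K. f x = x}"
proof -
  have orb: "orbit f x = {x, f x}" if "x \<in> V" for x
    by (rule orbit_involution[OF that f(2)])
  have finK: "finite K" using fin K finite_subset by blast
  have orbits: "orbits_in V f K = orbit f ` K"
  proof -
    have "orbit f x \<subseteq> K \<longleftrightarrow> x \<in> K" if "x \<in> V" for x using orb[OF that] K by auto
    then show ?thesis using K(1) unfolding orbits_in_def by blast
  qed
  have "(\<Sum>x\<in>K. 1 + (if f x = x then 1 else 0)) =
      (\<Sum>T\<in>orbit f ` K. \<Sum>x | x \<in> K \<and> orbit f x = T. 1 + (if f x = x then 1 else 0 :: nat))"
    by (rule sum.image_gen[OF finK])
  also have "\<dots> = (\<Sum>T\<in>orbit f ` K. 2)"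
  proof (rule sum.cong[OF refl])
    fix T assume "T \<in> orbit f ` K"
    then obtain y where y: "y \<in> K" "T = orbit f y" by blast
    then have "{x. x \<in> K \<and> orbit f x = T} = {y, f y}"
      using orb K f by (auto simp: subset_iff doubleton_eq_iff image_subset_iff)
    then show "(\<Sum>x | x \<in> K \<and> orbit f x = T. 1 + (if f x = x then 1 else 0)) = (2 :: nat)"
      using f(2)[of y] y K by (cases "f y = y") (auto simp: subset_iff)
  qed
  also have "\<dots> = 2 * card (orbits_in V f K)" by (simp add: orbits)
  also have "(\<Sum>x\<in>K. 1 + (if f x = x then 1 else 0)) = card K + card {x \<in> K. f x = x}"
    using finK by (subst sum.distrib) (simp add: sum.If_cases Int_def)
  finally show ?thesis by simp
qed

section \<open>Residues\<close>

context building
begin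

text \<open>One step of a gallery of type \<open>J\<close>. Its distance is a generator, the only
  kind of distance on which \<open>building_aut\<close> imposes a condition.\<close>

definition adjacent :: "'a set \<Rightarrow> ('c \<times> 'c) set" where
  "adjacent J = {(A, B). A \<in> Ch \<and> B \<in> Ch \<and> \<delta> A B \<in> J}"

lemma dist_self [simp]: "C \<in> Ch \<Longrightarrow> \<delta> C C = \<one>"
  by (simp add: dist_one)

text \<open>Of the two values that \<open>dist_step\<close> allows for \<open>\<delta> C C\<close>,
  the unchanged distance is impossible because \<open>C\<close> and \<open>D\<close> differ.\<close>

lemma dist_gen_sym:
  assumes "C \<in> Ch" "D \<in> Ch" "\<delta> C D \<in> S" shows "\<delta> D C = \<delta> C D"
proof -
  define s where "s = \<delta> C D"
  have s: "s \<in> S" using assms by (simp add: s_def)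
  have d: "\<delta> D C \<in> carrier W" using assms dist_closed by blast
  have "C \<noteq> D" using gens_nontrivial[OF assms(3)] dist_one[OF assms(1,2)] by blast
  then have "\<delta> D C \<noteq> \<one>" using dist_one[OF assms(2,1)] by blast
  then have "\<delta> C C \<noteq> \<delta> D C" using dist_self[OF assms(1)] by simp
  then have "\<delta> C C = s \<otimes> \<delta> D C"
    using dist_step[OF assms(2,1,1) s s_def[symmetric]] by blast
  then have "\<one> = s \<otimes> \<delta> D C" using dist_self[OF assms(1)] by simp
  then have "s \<otimes> \<one> = s \<otimes> (s \<otimes> \<delta> D C)" by simp
  then have "s = \<delta> D C" using s d by simp
  then show ?thesis by (simp only: s_def)
qed

lemma sym_adjacent:
  assumes "J \<subseteq> S" shows "sym (adjacent J)"
proof (rule symI)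
  fix A B assume "(A, B) \<in> adjacent J"
  then have AB: "A \<in> Ch" "B \<in> Ch" "\<delta> A B \<in> J" by (auto simp: adjacent_def)
  then have "\<delta> A B \<in> S" using assms by blast
  then show "(B, A) \<in> adjacent J" using AB dist_gen_sym[of A B] by (simp add: adjacent_def)
qed

lemma gallery_from_word:
  assumes J: "J \<subseteq> S" and CD: "C \<in> Ch" "D \<in> Ch" and ws: "ws \<in> lists J"
  shows "\<exists>C'\<in>Ch. \<delta> C' D = word_val W ws \<otimes> \<delta> C D \<and> (C, C') \<in> (adjacent J)\<^sup>*"
  using ws
proof (induction ws)
  case Nil
  show ?case using CD dist_closed by (intro bexI[of _ C]) auto
next
  case (Cons s ws)
  then have s: "s \<in> J" "s \<in> S" and ws: "ws \<in> lists S" using J lists_mono[OF J] by auto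
  obtain C' where C': "C' \<in> Ch" "\<delta> C' D = word_val W ws \<otimes> \<delta> C D" "(C, C') \<in> (adjacent J)\<^sup>*"
    using Cons.IH by blast
  obtain C'' where C'': "C'' \<in> Ch" "\<delta> C'' C' = s" "\<delta> C'' D = s \<otimes> \<delta> C' D"
    using dist_ex[OF C'(1) CD(2) s(2)] by blast
  have "(C', C'') \<in> adjacent J" using C' C'' s dist_gen_sym[of C'' C'] by (simp add: adjacent_def)
  then have "(C, C'') \<in> (adjacent J)\<^sup>*" using C'(3) by (rule rtrancl_into_rtrancl[rotated])
  moreover have "\<delta> C'' D = word_val W (s # ws) \<otimes> \<delta> C D"
    using C'' C' s word_val_closed[OF ws] dist_closed[OF CD] by (simp add: m_assoc)
  ultimately show ?case using C''(1) by blast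
qed

lemma gallery_from_parabolic:
  assumes J: "J \<subseteq> S" and CD: "C \<in> Ch" "D \<in> Ch" and u: "u \<in> generate W J"
  obtains C' where "C' \<in> Ch" "\<delta> C' D = u \<otimes> \<delta> C D" "(C, C') \<in> (adjacent J)\<^sup>*"
proof -
  obtain ws where ws: "ws \<in> lists J" "word_val W ws = u" using reduced_word_parabolic[OF J u] .
  show thesis using gallery_from_word[OF J CD ws(1)] ws(2) that by blast
qed

lemma dist_along_gallery:
  assumes J: "J \<subseteq> S" and D: "D \<in> Ch" and AB: "(A, B) \<in> (adjacent J)\<^sup>*" "B \<in> Ch"
  shows "A \<in> Ch \<and> (\<exists>u\<in>generate W J. \<delta> A D = u \<otimes> \<delta> B D)"
  using AB
proof (induction rule: converse_rtrancl_induct)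
  case base
  then show ?case using D dist_closed generate.one[of W J] by (intro conjI bexI[of _ \<one>]) auto
next
  case (step A E)
  then obtain u where u: "u \<in> generate W J" "\<delta> E D = u \<otimes> \<delta> B D" and E: "E \<in> Ch" by blast
  have A: "A \<in> Ch" "\<delta> A E \<in> J" using step by (auto simp: adjacent_def)
  define s where "s = \<delta> A E"
  have s: "s \<in> J" "s \<in> S" using A J by (auto simp: s_def)
  have uc: "u \<in> carrier W" using parabolic_closed[OF J u(1)] .
  have "\<delta> A D = s \<otimes> \<delta> E D \<or> \<delta> A D = \<delta> E D"
    using dist_step[OF E D A(1) s(2)] by (simp add: s_def)
  then show ?case
  proof
    assume "\<delta> A D = s \<otimes> \<delta> E D"
    then have "\<delta> A D = (s \<otimes> u) \<otimes> \<delta> B D" using u uc s step.prems D dist_closed by (simp add: m_assoc)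
    moreover have "s \<otimes> u \<in> generate W J" using generate.eng[OF generate.incl[OF s(1)] u(1)] .
    ultimately show ?thesis using A by blast
  next
    assume "\<delta> A D = \<delta> E D"
    then show ?thesis using A u by auto
  qed
qed

lemma mem_residue_iff:
  assumes J: "J \<subseteq> S" and C: "C \<in> Ch"
  shows "D \<in> residue W Ch \<delta> J C \<longleftrightarrow> D \<in> Ch \<and> (C, D) \<in> (adjacent J)\<^sup>*"
proof -
  have "(C, D) \<in> (adjacent J)\<^sup>*" if D: "D \<in> Ch" "\<delta> C D \<in> generate W J"
  proof -
    obtain C' where C': "C' \<in> Ch" "\<delta> C' D = inv (\<delta> C D) \<otimes> \<delta> C D" "(C, C') \<in> (adjacent J)\<^sup>*"
      using gallery_from_parabolic[OF J C D(1) parabolic_inv[OF J D(2)]] .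
    then have "C' = D" using dist_one D C dist_closed by simp
    then show ?thesis using C' by simp
  qed
  moreover have "\<delta> C D \<in> generate W J" if D: "D \<in> Ch" "(C, D) \<in> (adjacent J)\<^sup>*"
  proof -
    obtain u where u: "u \<in> generate W J" "\<delta> C D = u \<otimes> \<delta> D D"
      using dist_along_gallery[OF J D(1,2,1)] by blast
    then show ?thesis using D parabolic_closed[OF J u(1)] by simp
  qed
  ultimately show ?thesis unfolding residue_def by blast
qed

lemma residue_eq:
  assumes J: "J \<subseteq> S" and C: "C \<in> Ch" and D: "D \<in> residue W Ch \<delta> J C"
  shows "residue W Ch \<delta> J D = residue W Ch \<delta> J C"
proof -
  have D': "D \<in> Ch" "(C, D) \<in> (adjacent J)\<^sup>*" using mem_residue_iff[OF J C] D by blast+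
  then have "(D, C) \<in> (adjacent J)\<^sup>*" using sym_rtrancl[OF sym_adjacent[OF J]] by (metis symD)
  then show ?thesis
    using mem_residue_iff[OF J C] mem_residue_iff[OF J D'(1)] D'(2) by (auto intro: rtrancl_trans)
qed

lemma residue_self: "J \<subseteq> S \<Longrightarrow> C \<in> Ch \<Longrightarrow> C \<in> residue W Ch \<delta> J C"
  by (simp add: mem_residue_iff)

text \<open>Simplices are bare sets of chambers, so the type of an image has to be recovered from
  the set. For each \<open>s\<close> of the type, \<open>dist_ex\<close> supplies a chamber at
  distance \<open>s\<close> from \<open>C\<close>.\<close>

lemma residue_type_unique:
  assumes J: "J \<subseteq> S" and K: "K \<subseteq> S" and C: "C \<in> Ch"
    and eq: "residue W Ch \<delta> J C = residue W Ch \<delta> K C"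
  shows "J = K"
proof -
  have "I \<subseteq> L" if I: "I \<subseteq> S" and L: "L \<subseteq> S" and sub: "residue W Ch \<delta> I C \<subseteq> residue W Ch \<delta> L C" for I L
  proof
    fix s assume s: "s \<in> I"
    then have sS: "s \<in> S" using I by blast
    obtain D where D: "D \<in> Ch" "\<delta> D C = s" using dist_ex[OF C C sS] by blast
    then have CD: "\<delta> C D = s" using dist_gen_sym[of D C] C sS by simp
    then have "D \<in> residue W Ch \<delta> I C" using D s by (simp add: residue_def generate.incl)
    then have "s \<in> generate W L" using sub CD by (auto simp: residue_def)
    then show "s \<in> L" using gen_in_parabolic[OF L sS] by blast
  qed
  from this[OF J K] this[OF K J] eq show ?thesis by blast
qed

lemma residue_image:
  assumes \<theta>: "building_aut W S Ch \<delta> \<theta> \<sigma>" and J: "J \<subseteq> S" and C: "C \<in> Ch"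
  shows "\<theta> ` residue W Ch \<delta> J C = residue W Ch \<delta> (\<sigma> ` J) (\<theta> C)"
proof -
  have bij: "bij_betw \<theta> Ch Ch" and \<sigma>: "\<sigma> \<in> graph_aut (cox_graph W S)"
    and dist: "\<And>C D s. C \<in> Ch \<Longrightarrow> D \<in> Ch \<Longrightarrow> s \<in> S \<Longrightarrow> \<delta> C D = s \<longleftrightarrow> \<delta> (\<theta> C) (\<theta> D) = \<sigma> s"
    using \<theta> unfolding building_aut_def by blast+
  have in_Ch: "\<theta> D \<in> Ch" if "D \<in> Ch" for D using bij that by (auto simp: bij_betw_def)
  have \<sigma>J: "\<sigma> ` J \<subseteq> S" using graph_aut_ord(1)[OF \<sigma>] J by blast
  note iff = mem_residue_iff[OF J C] mem_residue_iff[OF \<sigma>J in_Ch[OF C]]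
  have fwd: "(\<theta> C, \<theta> D) \<in> (adjacent (\<sigma> ` J))\<^sup>*" if "(C, D) \<in> (adjacent J)\<^sup>*" for D
    using that
  proof (induction rule: rtrancl_induct)
    case (step D E)
    then have DE: "D \<in> Ch" "E \<in> Ch" "\<delta> D E \<in> J" by (auto simp: adjacent_def)
    have "\<delta> (\<theta> D) (\<theta> E) = \<sigma> (\<delta> D E)" using dist[OF DE(1,2)] DE(3) J by blast
    then have "(\<theta> D, \<theta> E) \<in> adjacent (\<sigma> ` J)" using DE in_Ch by (simp add: adjacent_def)
    then show ?case using step.IH by (rule rtrancl_into_rtrancl[rotated])
  qed simp
  have bwd: "\<exists>D\<in>Ch. E = \<theta> D \<and> (C, D) \<in> (adjacent J)\<^sup>*" if "(\<theta> C, E) \<in> (adjacent (\<sigma> ` J))\<^sup>*" for E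
    using that
  proof (induction rule: rtrancl_induct)
    case base
    then show ?case using C by blast
  next
    case (step E F)
    obtain D where D: "D \<in> Ch" "E = \<theta> D" "(C, D) \<in> (adjacent J)\<^sup>*" using step.IH by blast
    have F: "F \<in> Ch" "\<delta> E F \<in> \<sigma> ` J" using step by (auto simp: adjacent_def)
    then obtain D' where D': "D' \<in> Ch" "F = \<theta> D'" using bij by (auto simp: bij_betw_def)
    obtain s where s: "s \<in> J" "\<delta> E F = \<sigma> s" using F by blast
    then have "\<delta> D D' = s" using dist[OF D(1) D'(1)] D D' J by blast
    then have "(D, D') \<in> adjacent J" using D D' s by (simp add: adjacent_def)
    then have "(C, D') \<in> (adjacent J)\<^sup>*" using D(3) by (rule rtrancl_into_rtrancl[rotated])
    then show ?case using D' by blast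
  qed
  show ?thesis
  proof
    show "\<theta> ` residue W Ch \<delta> J C \<subseteq> residue W Ch \<delta> (\<sigma> ` J) (\<theta> C)"
      using iff fwd in_Ch by blast
    show "residue W Ch \<delta> (\<sigma> ` J) (\<theta> C) \<subseteq> \<theta> ` residue W Ch \<delta> J C"
      using iff bwd by blast
  qed
qed

lemma image_complement:
  assumes \<sigma>: "\<sigma> \<in> graph_aut (cox_graph W S)" and T: "T \<subseteq> S"
  shows "\<sigma> ` (S - T) = S - \<sigma> ` T"
proof -
  have "bij_betw \<sigma> S S" using \<sigma> by (auto simp: graph_aut_def cox_graph_def Bij_def)
  then show ?thesis using T inj_on_image_set_diff[of \<sigma> S S T] by (simp add: bij_betw_def)
qed

lemma stabilised_simplex_iff:
  assumes \<theta>: "building_aut W S Ch \<delta> \<theta> \<sigma>" and T: "T \<subseteq> S" "\<sigma> ` T = T"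
  shows "(\<exists>\<alpha>\<in>simplices W S Ch \<delta> T. \<theta> ` \<alpha> = \<alpha>) \<longleftrightarrow> (\<exists>C\<in>Ch. \<delta> C (\<theta> C) \<in> generate W (S - T))"
proof -
  have \<sigma>: "\<sigma> \<in> graph_aut (cox_graph W S)" and bij: "bij_betw \<theta> Ch Ch"
    using \<theta> unfolding building_aut_def by blast+
  have R: "S - T \<subseteq> S" by blast
  have "\<theta> ` residue W Ch \<delta> (S - T) C = residue W Ch \<delta> (S - T) C \<longleftrightarrow> \<delta> C (\<theta> C) \<in> generate W (S - T)"
    if C: "C \<in> Ch" for C
  proof -
    have \<theta>C: "\<theta> C \<in> Ch" using bij C by (auto simp: bij_betw_def)
    have "\<theta> ` residue W Ch \<delta> (S - T) C = residue W Ch \<delta> (S - T) (\<theta> C)"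
      using residue_image[OF \<theta> R C] image_complement[OF \<sigma> T(1)] T(2) by simp
    moreover have "residue W Ch \<delta> (S - T) (\<theta> C) = residue W Ch \<delta> (S - T) C \<longleftrightarrow> \<theta> C \<in> residue W Ch \<delta> (S - T) C"
      using residue_eq[OF R C, of "\<theta> C"] residue_self[OF R \<theta>C] by blast
    ultimately show ?thesis using \<theta>C by (simp add: residue_def)
  qed
  then show ?thesis unfolding simplices_def by blast
qed

end

section \<open>Simplices mapped to opposite simplices\<close>

sublocale spherical_building \<subseteq> finite_coxeter_system
  by unfold_locales (rule finite_type)

context spherical_building
begin

text \<open>The image of \<alpha> has type \<sigma> T, and opposition demands type \<sigma>_0 T. If
  \<open>A\<close> in \<alpha> and \<open>\<theta> A'\<close> are opposite, a gallery inside
  \<alpha> from \<open>A'\<close> to \<open>A\<close> alters the distance to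
  \<open>\<theta> A'\<close> by a factor from the parabolic subgroup of \<open>S - T\<close>;
  running along such a gallery also gives the converse.\<close>

lemma opposite_simplex_iff:
  assumes \<theta>: "building_aut W S Ch \<delta> \<theta> \<sigma>" and T: "T \<subseteq> S"
  shows "(\<exists>\<alpha>. opposite_of_type W S Ch \<delta> T \<alpha> (\<theta> ` \<alpha>)) \<longleftrightarrow>
    \<sigma> ` T = s0 ` T \<and> (\<exists>C\<in>Ch. \<exists>u\<in>generate W (S - T). \<delta> C (\<theta> C) = u \<otimes> wlong S)"
proof -
  have \<sigma>: "\<sigma> \<in> graph_aut (cox_graph W S)" and bij: "bij_betw \<theta> Ch Ch"
    using \<theta> unfolding building_aut_def by blast+
  have in_Ch: "\<theta> D \<in> Ch" if "D \<in> Ch" for D using bij that by (auto simp: bij_betw_def)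
  have R: "S - T \<subseteq> S" by blast
  have sub: "\<sigma> ` T \<subseteq> S" "s0 ` T \<subseteq> S" using graph_aut_ord(1)[OF \<sigma>] T sigma0_in by blast+
  have image: "\<theta> ` residue W Ch \<delta> (S - T) C = residue W Ch \<delta> (S - \<sigma> ` T) (\<theta> C)" if "C \<in> Ch" for C
    using residue_image[OF \<theta> R that] image_complement[OF \<sigma> T] by simp
  show ?thesis
  proof
    assume "\<exists>\<alpha>. opposite_of_type W S Ch \<delta> T \<alpha> (\<theta> ` \<alpha>)"
    then obtain \<alpha> A B where \<alpha>: "\<alpha> \<in> simplices W S Ch \<delta> T" "\<theta> ` \<alpha> \<in> simplices W S Ch \<delta> (s0 ` T)"
      and AB': "A \<in> \<alpha>" "B \<in> \<theta> ` \<alpha>" and AB: "\<delta> A B = wlong S"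
      unfolding opposite_of_type_def by blast
    obtain C where C: "C \<in> Ch" "\<alpha> = residue W Ch \<delta> (S - T) C" using \<alpha>(1) unfolding simplices_def by blast
    obtain X where X: "X \<in> Ch" and eq: "\<theta> ` \<alpha> = residue W Ch \<delta> (S - s0 ` T) X"
      using \<alpha>(2) unfolding simplices_def by blast
    note eq = eq[unfolded C(2)] and A = AB'(1)[unfolded C(2)] and B = AB'(2)[unfolded C(2)] and C = C(1)
    have "\<theta> C \<in> residue W Ch \<delta> (S - s0 ` T) X" using eq residue_self[OF R C] by blast
    then have "residue W Ch \<delta> (S - s0 ` T) (\<theta> C) = residue W Ch \<delta> (S - s0 ` T) X"
      using residue_eq X by blast
    then have "residue W Ch \<delta> (S - s0 ` T) (\<theta> C) = residue W Ch \<delta> (S - \<sigma> ` T) (\<theta> C)"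
      using eq image[OF C] by simp
    then have "S - s0 ` T = S - \<sigma> ` T" using residue_type_unique[of "S - s0 ` T" "S - \<sigma> ` T" "\<theta> C"] in_Ch[OF C] by blast
    then have type: "\<sigma> ` T = s0 ` T" using sub by blast
    obtain A' where A': "A' \<in> residue W Ch \<delta> (S - T) C" "B = \<theta> A'" using B by blast
    have "A \<in> Ch" "A' \<in> Ch" using A A' by (auto simp: residue_def)
    moreover have "A \<in> residue W Ch \<delta> (S - T) A'" using A residue_eq[OF R C A'(1)] by blast
    ultimately have "(A', A) \<in> (adjacent (S - T))\<^sup>*" using mem_residue_iff[OF R] by blast
    then obtain u where "u \<in> generate W (S - T)" "\<delta> A' (\<theta> A') = u \<otimes> \<delta> A (\<theta> A')"
      using dist_along_gallery[OF R in_Ch[OF \<open>A' \<in> Ch\<close>]] \<open>A \<in> Ch\<close> by blast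
    then show "\<sigma> ` T = s0 ` T \<and> (\<exists>C\<in>Ch. \<exists>u\<in>generate W (S - T). \<delta> C (\<theta> C) = u \<otimes> wlong S)"
      using type \<open>A' \<in> Ch\<close> A'(2) AB by auto
  next
    assume "\<sigma> ` T = s0 ` T \<and> (\<exists>C\<in>Ch. \<exists>u\<in>generate W (S - T). \<delta> C (\<theta> C) = u \<otimes> wlong S)"
    then obtain C u where type: "\<sigma> ` T = s0 ` T" and C: "C \<in> Ch" and u: "u \<in> generate W (S - T)"
      and Cu: "\<delta> C (\<theta> C) = u \<otimes> wlong S" by blast
    obtain C' where C': "C' \<in> Ch" "\<delta> C' (\<theta> C) = inv u \<otimes> \<delta> C (\<theta> C)" "(C, C') \<in> (adjacent (S - T))\<^sup>*"
      using gallery_from_parabolic[OF R C in_Ch[OF C] parabolic_inv[OF R u]] .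
    let ?\<alpha> = "residue W Ch \<delta> (S - T) C"
    have "\<delta> C' (\<theta> C) = wlong S" using C' Cu parabolic_closed[OF R u] by simp
    moreover have "C' \<in> ?\<alpha>" using mem_residue_iff[OF R C] C' by blast
    moreover have "\<theta> C \<in> \<theta> ` ?\<alpha>" using residue_self[OF R C] by blast
    moreover have "\<theta> ` ?\<alpha> = residue W Ch \<delta> (S - s0 ` T) (\<theta> C)" using image[OF C] type by simp
    ultimately have "opposite_of_type W S Ch \<delta> T ?\<alpha> (\<theta> ` ?\<alpha>)"
      using C in_Ch[OF C] unfolding opposite_of_type_def simplices_def by blast
    then show "\<exists>\<alpha>. opposite_of_type W S Ch \<delta> T \<alpha> (\<theta> ` \<alpha>)" by blast
  qed
qed

end

theorem proposition2p14:
  fixes W :: "('a, 'b) monoid_scheme" and S J J' :: "'a set"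
    and Ch :: "'c set" and \<delta> :: "'c \<Rightarrow> 'c \<Rightarrow> 'a"
    and \<theta> :: "'c \<Rightarrow> 'c" and \<sigma> :: "'a \<Rightarrow> 'a"
  assumes "thick_spherical_building W S Ch \<delta>"
    and "building_aut W S Ch \<delta> \<theta> \<sigma>"
    and "uniclass W S Ch \<delta> \<theta> \<sigma>"
    and "bi_capped W S \<sigma> (disp Ch \<delta> \<theta>)"
    and "J \<subseteq> S" and "min_length_elt W S (disp Ch \<delta> \<theta>) (longest W S J)"
    and "J' \<subseteq> S" and "max_length_elt W S (disp Ch \<delta> \<theta>) (longest W S J' \<otimes>\<^bsub>W\<^esub> longest W S S)"
  shows "fix_diagram W S Ch \<delta> \<theta> \<sigma> = (cox_graph W S, S - J, \<sigma>)
    \<and> opp_diagram W S Ch \<delta> \<theta> \<sigma> = (cox_graph W S, S - J', times_sigma0 W S \<sigma>)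
    \<and> opp_diagram W S Ch \<delta> \<theta> \<sigma> = psi W S (fix_diagram W S Ch \<delta> \<theta> \<sigma>)
    \<and> relative_rank (fix_diagram W S Ch \<delta> \<theta> \<sigma>) + relative_rank (opp_diagram W S Ch \<delta> \<theta> \<sigma>) = card S"
proof -
  interpret thick_spherical_building W S Ch \<delta> by (rule assms(1))
  note aut = assms(2) and C = assms(4) and J = assms(5,6) and J' = assms(7)
  interpret twisted_coxeter_system W S \<sigma> by (rule bi_capped_twisted[OF C])
  interpret tau: twisted_coxeter_system W S tau by (rule twisted_tau)
  define X where "X = disp Ch \<delta> \<theta>"
  have X_I: "\<delta> C (\<theta> C) \<in> X" if "C \<in> Ch" for C
    using that by (auto simp: X_def disp_def)
  have X_E: "\<exists>C\<in>Ch. \<delta> C (\<theta> C) = x" if "x \<in> X" for x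
    using that by (auto simp: X_def disp_def)
  note CX = C[folded X_def] and JX = J(1) J(2)[folded X_def]
  obtain c where c: "c \<in> carrier W" "X = twisted_class W S \<sigma> c" "X \<subseteq> carrier W"
    by (rule bi_cappedD[OF CX])
  have capped': "bi_capped W S tau (X #>\<^bsub>W\<^esub> wlong S)" by (rule bi_capped_coset[OF CX])
  \<comment> \<open>A further multiplication by \<open>wlong S\<close> identifies
    \<open>wlong J'\<close> as the minimal element of the translated class.\<close>
  have "(wlong J' \<otimes>\<^bsub>W\<^esub> wlong S) \<otimes>\<^bsub>W\<^esub> wlong S = wlong J'" using J' by (simp add: m_assoc)
  then have min': "min_length_elt W S (X #>\<^bsub>W\<^esub> wlong S) (wlong J')"
    using min_length_coset[OF c(3), of "wlong J' \<otimes>\<^bsub>W\<^esub> wlong S"] assms(8) J' by (simp add: X_def)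
  have J_adm: "admissible J" by (rule admissible_min_unique(1)[OF CX JX])
  have J'_adm: "tau.admissible J'" by (rule tau.admissible_min_unique(1)[OF capped' J' min'])
  have J_mem: "wlong J \<in> X" using JX by (simp add: min_length_elt_def is_arg_min_def)
  have J'_mem: "wlong J' \<otimes>\<^bsub>W\<^esub> wlong S \<in> X"
    using assms(8) by (simp add: X_def max_length_elt_def is_arg_max_def)
  have J_stable: "\<sigma> ` J \<subseteq> J" by (rule admissible_image[OF J_adm])
  have J'_stable: "tau ` J' \<subseteq> J'" by (rule tau.admissible_image[OF J'_adm])
  have orb: "orbit \<sigma> x = {x, \<sigma> x}" if "x \<in> S" for x
    by (rule orbit_involution[OF that involutive])

  have fix_set: "\<Union>{T \<in> orbit \<sigma> ` S. \<exists>\<alpha> \<in> simplices W S Ch \<delta> T. \<theta> ` \<alpha> = \<alpha>} = S - J"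
  proof -
    have "(\<exists>\<alpha> \<in> simplices W S Ch \<delta> (orbit \<sigma> x). \<theta> ` \<alpha> = \<alpha>) \<longleftrightarrow> J \<subseteq> S - orbit \<sigma> x" if x: "x \<in> S" for x
    proof -
      have T: "orbit \<sigma> x \<subseteq> S" "\<sigma> ` orbit \<sigma> x = orbit \<sigma> x" using x involutive by (auto simp: orb)
      have L: "S - orbit \<sigma> x \<subseteq> S" "\<sigma> ` (S - orbit \<sigma> x) \<subseteq> S - orbit \<sigma> x"
        using image_complement[OF graph_aut T(1)] T(2) by auto
      have "(\<exists>C\<in>Ch. \<delta> C (\<theta> C) \<in> generate W (S - orbit \<sigma> x)) \<longleftrightarrow> (\<exists>w\<in>X. w \<in> generate W (S - orbit \<sigma> x))"
        by (auto simp: X_def disp_def)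
      \<comment> \<open>One direction shortens a displacement inside the parabolic subgroup; for the
        other, \<open>wlong J\<close> is itself a displacement.\<close>
      also have "\<dots> \<longleftrightarrow> J \<subseteq> S - orbit \<sigma> x"
        using min_subset_parabolic[OF CX JX L] J_mem longest_in[OF JX(1)] mono_generate[of J "S - orbit \<sigma> x"] by blast
      finally show ?thesis using stabilised_simplex_iff[OF aut T] by simp
    qed
    moreover have "J \<subseteq> S - orbit \<sigma> x \<longleftrightarrow> x \<notin> J" if "x \<in> S" for x
      using that orb[OF that] JX(1) J_stable sigma_stable_iff[OF JX(1) J_stable that] by auto
    ultimately have "{T \<in> orbit \<sigma> ` S. \<exists>\<alpha> \<in> simplices W S Ch \<delta> T. \<theta> ` \<alpha> = \<alpha>} = orbit \<sigma> ` (S - J)"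
      by auto
    moreover have "\<Union>(orbit \<sigma> ` (S - J)) = S - J"
      using orb sigma_stable_iff[OF JX(1) J_stable] by auto
    ultimately show ?thesis by simp
  qed

  have opp_iff: "(\<exists>\<alpha>. opposite_of_type W S Ch \<delta> T \<alpha> (\<theta> ` \<alpha>)) \<longleftrightarrow>
      tau ` T = T \<and> (\<exists>u\<in>generate W (S - T). u \<otimes>\<^bsub>W\<^esub> wlong S \<in> X)" if T: "T \<subseteq> S" for T
  proof -
    have inv: "s0 ` s0 ` A = A" if "A \<subseteq> S" for A
    proof -
      have "s0 ` s0 ` A = (\<lambda>x. x) ` A" unfolding image_image by (rule image_cong) (use that in auto)
      then show ?thesis by simp
    qed
    have tau: "tau ` T = s0 ` \<sigma> ` T" using T by (auto simp: tau_eq image_image subset_iff)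
    have "\<sigma> ` T \<subseteq> S" using T by auto
    then have inv_\<sigma>: "s0 ` s0 ` \<sigma> ` T = \<sigma> ` T" by (rule inv)
    have "\<sigma> ` T = s0 ` T \<longleftrightarrow> tau ` T = T"
    proof
      assume "\<sigma> ` T = s0 ` T"
      then show "tau ` T = T" using inv[OF T] tau by (simp only:)
    next
      assume "tau ` T = T"
      then have "s0 ` s0 ` \<sigma> ` T = s0 ` T" using tau by (simp only:)
      then show "\<sigma> ` T = s0 ` T" by (simp only: inv_\<sigma>)
    qed
    moreover have "(\<exists>C\<in>Ch. \<exists>u\<in>generate W (S - T). \<delta> C (\<theta> C) = u \<otimes>\<^bsub>W\<^esub> wlong S) \<longleftrightarrow>
        (\<exists>u\<in>generate W (S - T). u \<otimes>\<^bsub>W\<^esub> wlong S \<in> X)"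
    proof
      assume "\<exists>C\<in>Ch. \<exists>u\<in>generate W (S - T). \<delta> C (\<theta> C) = u \<otimes>\<^bsub>W\<^esub> wlong S"
      then obtain C u where "C \<in> Ch" "u \<in> generate W (S - T)" "\<delta> C (\<theta> C) = u \<otimes>\<^bsub>W\<^esub> wlong S" by blast
      then show "\<exists>u\<in>generate W (S - T). u \<otimes>\<^bsub>W\<^esub> wlong S \<in> X" using X_I[of C] by auto
    next
      assume "\<exists>u\<in>generate W (S - T). u \<otimes>\<^bsub>W\<^esub> wlong S \<in> X"
      then obtain u where u: "u \<in> generate W (S - T)" "u \<otimes>\<^bsub>W\<^esub> wlong S \<in> X" by blast
      from X_E[OF u(2)] obtain C where "C \<in> Ch" "\<delta> C (\<theta> C) = u \<otimes>\<^bsub>W\<^esub> wlong S" by blast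
      with u(1) show "\<exists>C\<in>Ch. \<exists>u\<in>generate W (S - T). \<delta> C (\<theta> C) = u \<otimes>\<^bsub>W\<^esub> wlong S" by blast
    qed
    ultimately show ?thesis using opposite_simplex_iff[OF aut T] by simp
  qed
  have opp_set: "\<Union>{T. T \<subseteq> S \<and> (\<exists>\<alpha>. opposite_of_type W S Ch \<delta> T \<alpha> (\<theta> ` \<alpha>))} = S - J'"
  proof
    have opp_sub: "T \<subseteq> S - J'" if T: "T \<subseteq> S" "tau ` T = T" and u: "u \<in> generate W (S - T)" "u \<otimes>\<^bsub>W\<^esub> wlong S \<in> X" for T u
    proof -
      have L: "S - T \<subseteq> S" "tau ` (S - T) \<subseteq> S - T"
        using image_complement[OF tau_graph_aut T(1)] T(2) by auto
      \<comment> \<open>Translation puts \<open>u\<close> itself into the class for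
        \<open>tau\<close>, where the inclusion criterion applies.\<close>
      have "(u \<otimes>\<^bsub>W\<^esub> wlong S) \<otimes>\<^bsub>W\<^esub> wlong S \<in> X #>\<^bsub>W\<^esub> wlong S" using u(2) by (auto simp: r_coset_def)
      then have "u \<in> X #>\<^bsub>W\<^esub> wlong S" using parabolic_closed[OF L(1) u(1)] by (simp add: m_assoc)
      then have "J' \<subseteq> S - T" using tau.min_subset_parabolic[OF capped' J' min' L _ u(1)] by blast
      then show ?thesis using T by blast
    qed
    show "\<Union>{T. T \<subseteq> S \<and> (\<exists>\<alpha>. opposite_of_type W S Ch \<delta> T \<alpha> (\<theta> ` \<alpha>))} \<subseteq> S - J'"
    proof (rule Union_least)
      fix T assume "T \<in> {T. T \<subseteq> S \<and> (\<exists>\<alpha>. opposite_of_type W S Ch \<delta> T \<alpha> (\<theta> ` \<alpha>))}"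
      then have T: "T \<subseteq> S" and opp: "\<exists>\<alpha>. opposite_of_type W S Ch \<delta> T \<alpha> (\<theta> ` \<alpha>)" by simp_all
      show "T \<subseteq> S - J'" using opp_sub[OF T] opp_iff[OF T, THEN iffD1, OF opp] by blast
    qed
    \<comment> \<open>The types in this union are arbitrary sets, so the bound is reached by the
      single set \<open>S - J'\<close>, with \<open>wlong J'\<close> as the parabolic
      factor.\<close>
    have "tau ` J' = J'"
    proof
      show "J' \<subseteq> tau ` J'"
      proof
        fix x assume x: "x \<in> J'"
        then have "x = tau (tau x)" "tau x \<in> J'" using J' J'_stable tau_tau by auto
        then show "x \<in> tau ` J'" by (rule image_eqI)
      qed
    qed (rule J'_stable)
    then have "tau ` (S - J') = S - J'" using image_complement[OF tau_graph_aut J'] by simp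
    moreover have "S - (S - J') = J'" using J' by blast
    ultimately have "\<exists>\<alpha>. opposite_of_type W S Ch \<delta> (S - J') \<alpha> (\<theta> ` \<alpha>)"
      using opp_iff[of "S - J'"] longest_in[OF J'] J'_mem by auto
    then show "S - J' \<subseteq> \<Union>{T. T \<subseteq> S \<and> (\<exists>\<alpha>. opposite_of_type W S Ch \<delta> T \<alpha> (\<theta> ` \<alpha>))}" by blast
  qed

  have fix_eq: "fix_diagram W S Ch \<delta> \<theta> \<sigma> = (cox_graph W S, S - J, \<sigma>)"
    by (simp only: fix_diagram_def fix_set)
  moreover have opp_eq: "opp_diagram W S Ch \<delta> \<theta> \<sigma> = (cox_graph W S, S - J', tau)"
    by (simp only: opp_diagram_def opp_set)
  moreover have "psi W S (fix_diagram W S Ch \<delta> \<theta> \<sigma>) = opp_diagram W S Ch \<delta> \<theta> \<sigma>"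
    using psi_class_diagram[OF CX] class_diagram_eq[OF CX JX] tau.class_diagram_eq[OF capped' J' min']
    by (simp add: fix_eq opp_eq)
  moreover have "relative_rank (cox_graph W S, S - J, \<sigma>) + relative_rank (cox_graph W S, S - J', tau) = card S"
  proof -
    have rank: "relative_rank (cox_graph W S, K, f) = card (orbits_in S f K)" for K f
      by (simp add: relative_rank_def cox_graph_def)
    \<comment> \<open>Twice the sum of the ranks is |S - J| + |S - J'| plus the two numbers of fixed
      generators, and these numbers add up to |J| + |J'|.\<close>
    have "2 * card (orbits_in S \<sigma> (S - J)) = card (S - J) + card {s \<in> S - J. \<sigma> s = s}"
      using involutive sigma_stable_iff[OF JX(1) J_stable] by (intro card_orbits_involution) auto
    moreover have "2 * card (orbits_in S tau (S - J')) = card (S - J') + card {s \<in> S - J'. tau s = s}"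
      using tau_tau tau.sigma_in tau.sigma_stable_iff[OF J' J'_stable] by (intro card_orbits_involution) auto
    moreover have "wlong J' \<otimes>\<^bsub>W\<^esub> wlong S \<in> twisted_class W S \<sigma> (wlong J)"
      using twisted_class_eq[OF c(1) J_mem[unfolded c(2)]] J'_mem c(2) by simp
    then have "card {s \<in> S - J. \<sigma> s = s} + card {s \<in> S - J'. tau s = s} = card J + card J'"
      by (rule card_fixed_balance[OF J_adm J'_adm])
    moreover have "card (S - J) + card J = card S" "card (S - J') + card J' = card S"
      using card_Diff_subset[OF finite_subset[OF JX(1) finite_gens] JX(1)] card_mono[OF finite_gens JX(1)]
        card_Diff_subset[OF finite_subset[OF J' finite_gens] J'] card_mono[OF finite_gens J'] by simp_all
    ultimately show ?thesis unfolding rank by linarith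
  qed
  ultimately show ?thesis by simp
qed

end
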